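(* Let $U$ be an m-cofibrant flow, i.e. a cofibrant object of the m-model structure of $\mathbf{Flow}$. Then the space of execution paths $\mathbb{P}U$ is m-cofibrant, i.e. cofibrant in the m-model structure of $\mathbf{Top}$.
   Context: $\mathbf{Top}$ is the category of $\Delta$-generated spaces, i.e. topological spaces that are colimits of standard topological simplices. An h-fibration is a map with the right lifting property with respect to $Z\times\{0\}\subset Z\times[0,1]$ for all spaces $Z$ of $\mathbf{Top}$. The m-model structure of $\mathbf{Top}$ is the unique model structure whose weak equivalences are the weak homotopy equivalences and whose fibrations are the h-fibrations. A flow $X$ consists of a space $\mathbb{P}X$ of $\mathbf{Top}$ (execution paths), a discrete space $X^0$ (states), two continuous maps $s,t:\mathbb{P}X\to X^0$ (source and target), and a continuous associative map $*:\{(x,y)\in\mathbb{P}X\times\mathbb{P}X\mid t(x)=s(y)\}\to\mathbb{P}X$ with $s(x*y)=s(x)$ and $t(x*y)=t(y)$ (no identities are required). A map of flows $f:X\to Y$ consists of a set map $f^0:X^0\to Y^0$ and a continuous map $\mathbb{P}f:\mathbb{P}X\to\mathbb{P}Y$ compatible with $s$, $t$ and $*$. The category is $\mathbf{Flow}$. $\mathbb{P}_{\alpha,\beta}X=\{x\in\mathbb{P}X\mid s(x)=\alpha,\ t(x)=\beta\}$. The m-model structure of $\mathbf{Flow}$ is the unique model structure such that $f:X\to Y$ is a weak equivalence iff $f^0$ is a bijection and each $\mathbb{P}_{\alpha,\beta}X\to \mathbb{P}_{f(\alpha),f(\beta)}Y$ is a weak homotopy equivalence, and a fibration iff each such map is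 an h-fibration. It exists. *)

theory Defs
  imports "HOL-Homology.Homology"
begin

section \<open>The universe\<close>

text \<open>
  A statement about all spaces cannot quantify over types, so spaces and flows live on subsets of a
  type. Lifting properties are tested against all objects carried by subsets of such a type
  \<open>'u\<close>, which is required to have at least two elements and to satisfy
  \<open>|'u| ^ |real| = |'u|\<close>, so that for every space \<open>X\<close> on \<open>'u\<close> the set of paths
  \<open>[0,1] \<rightarrow> X\<close> again fits into \<open>'u\<close>. The type \<open>real \<Rightarrow> 'a option\<close> has this property for
  every \<open>'a\<close>, and \<open>'a\<close> embeds into it.
\<close>

definition universe :: "'u itself \<Rightarrow> bool" where
  "universe _ \<longleftrightarrow> (\<exists>x y::'u. x \<noteq> y) \<and> (\<exists>e::(real \<Rightarrow> 'u) \<Rightarrow> 'u. inj e)"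

lemma universe_fun: "universe TYPE(real \<Rightarrow> 'a option)"
proof -
  have "(\<lambda>_. None) \<noteq> (\<lambda>_::real. Some (undefined::'a))"
    by (metis option.distinct(1))
  moreover
  have "\<exists>p::real \<Rightarrow> real \<times> real. bij p"
  proof -
    have "|UNIV::(real \<times> real) set| =o |UNIV::real set|"
      using card_of_Times_same_infinite[of "UNIV::real set"] infinite_UNIV_char_0
      by (metis UNIV_Times_UNIV)
    then have "\<exists>p. bij_betw p (UNIV::real set) (UNIV::(real \<times> real) set)"
      by (meson card_of_ordIso ordIso_symmetric)
    then show ?thesis by blast
  qed
  then obtain p :: "real \<Rightarrow> real \<times> real" where p: "bij p" by blast
  have "inj (\<lambda>f t. f (fst (p t)) (snd (p t)) :: 'a option)"
  proof (rule injI)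
    fix f g :: "real \<Rightarrow> real \<Rightarrow> 'a option"
    assume eq: "(\<lambda>t. f (fst (p t)) (snd (p t))) = (\<lambda>t. g (fst (p t)) (snd (p t)))"
    show "f = g"
    proof (intro ext)
      fix a b
      obtain t where "p t = (a, b)" using p by (metis bij_pointE)
      with fun_cong[OF eq, of t] show "f a b = g a b" by simp
    qed
  qed
  ultimately show ?thesis unfolding universe_def by blast
qed

lemma inj_into_universe: "inj (\<lambda>(x::'a) (_::real). Some x)"
  by (rule injI) (metis option.inject)


section \<open>Delta-generated spaces\<close>

abbreviation simplex_topology :: "nat \<Rightarrow> (nat \<Rightarrow> real) topology" where
  "simplex_topology n \<equiv> subtopology (powertop_real UNIV) (standard_simplex n)"

text \<open>
  A diagram of simplices consists of a set \<open>I\<close> of nodes, the dimension \<open>d i\<close> of the simplex at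
  \<open>i\<close>, and a set \<open>A\<close> of arrows \<open>(i, j, \<phi>)\<close> carrying a continuous map between the simplices.
  Its colimit in topological spaces is the quotient of the topological sum by the equivalence
  relation generated by \<open>(i, a) \<sim> (j, \<phi> a)\<close>; identities and composites of arrows
  do not change this relation, so the arrows need not form a category.
\<close>

definition simplex_glue ::
  "('i \<Rightarrow> nat) \<Rightarrow> ('i \<times> 'i \<times> ((nat \<Rightarrow> real) \<Rightarrow> (nat \<Rightarrow> real))) set
    \<Rightarrow> (('i \<times> (nat \<Rightarrow> real)) \<times> ('i \<times> (nat \<Rightarrow> real))) set" where
  "simplex_glue d A = {((i, a), (j, \<phi> a)) | i j \<phi> a. (i, j, \<phi>) \<in> A \<and> a \<in> standard_simplex (d i)}"

definition is_simplex_colimit ::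
  "'i set \<Rightarrow> ('i \<Rightarrow> nat) \<Rightarrow> ('i \<times> 'i \<times> ((nat \<Rightarrow> real) \<Rightarrow> (nat \<Rightarrow> real))) set
    \<Rightarrow> 'a topology \<Rightarrow> ('i \<times> (nat \<Rightarrow> real) \<Rightarrow> 'a) \<Rightarrow> bool" where
  "is_simplex_colimit I d A X q \<longleftrightarrow>
     (\<forall>(i, j, \<phi>) \<in> A. i \<in> I \<and> j \<in> I \<and>
        continuous_map (simplex_topology (d i)) (simplex_topology (d j)) \<phi>) \<and>
     quotient_map (sum_topology (\<lambda>i. simplex_topology (d i)) I) X q \<and>
     (\<forall>u \<in> Sigma I (\<lambda>i. standard_simplex (d i)). \<forall>v \<in> Sigma I (\<lambda>i. standard_simplex (d i)).
        q u = q v \<longleftrightarrow> (u, v) \<in> (simplex_glue d A \<union> (simplex_glue d A)\<inverse>)\<^sup>*)"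

text \<open>
  The type of nodes below is large enough for the diagram of all continuous maps from simplices to
  \<open>X\<close>; no generality is lost, see \<open>simplex_colimit_imp_delta_generated\<close>.
\<close>

definition delta_generated :: "'a topology \<Rightarrow> bool" where
  "delta_generated X \<longleftrightarrow>
     (\<exists>(I :: (nat \<times> ((nat \<Rightarrow> real) \<Rightarrow> 'a)) set) d A q. is_simplex_colimit I d A X q)"

text \<open>The coreflection of topological spaces onto Delta-generated spaces.\<close>

definition delta_kelley :: "'a topology \<Rightarrow> 'a topology" where
  "delta_kelley X = topology (\<lambda>U. U \<subseteq> topspace X \<and>
     (\<forall>n \<sigma>. continuous_map (simplex_topology n) X \<sigma> \<longrightarrow>
        openin (simplex_topology n) {a \<in> standard_simplex n. \<sigma> a \<in> U}))"

lemma openin_delta_kelley: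
  "openin (delta_kelley X) U \<longleftrightarrow> U \<subseteq> topspace X \<and>
     (\<forall>n \<sigma>. continuous_map (simplex_topology n) X \<sigma> \<longrightarrow>
        openin (simplex_topology n) {a \<in> standard_simplex n. \<sigma> a \<in> U})"
proof -
  let ?P = "\<lambda>U. U \<subseteq> topspace X \<and>
     (\<forall>n \<sigma>. continuous_map (simplex_topology n) X \<sigma> \<longrightarrow>
        openin (simplex_topology n) {a \<in> standard_simplex n. \<sigma> a \<in> U})"
  have "istopology ?P"
    unfolding istopology_def
  proof (intro conjI allI impI)
    fix S T assume S: "?P S" and T: "?P T"
    show "S \<inter> T \<subseteq> topspace X" using S by blast
    fix n \<sigma> assume \<sigma>: "continuous_map (simplex_topology n) X \<sigma>"
    have "{a \<in> standard_simplex n. \<sigma> a \<in> S \<inter> T}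
        = {a \<in> standard_simplex n. \<sigma> a \<in> S} \<inter> {a \<in> standard_simplex n. \<sigma> a \<in> T}" by blast
    then show "openin (simplex_topology n) {a \<in> standard_simplex n. \<sigma> a \<in> S \<inter> T}"
      using S T \<sigma> by (metis (no_types, lifting) openin_Int)
  next
    fix \<K> assume K: "\<forall>K\<in>\<K>. ?P K"
    then show "\<Union>\<K> \<subseteq> topspace X" by blast
    fix n \<sigma> assume \<sigma>: "continuous_map (simplex_topology n) X \<sigma>"
    have "{a \<in> standard_simplex n. \<sigma> a \<in> \<Union>\<K>}
        = (\<Union>K\<in>\<K>. {a \<in> standard_simplex n. \<sigma> a \<in> K})" by blast
    moreover have "openin (simplex_topology n) (\<Union>K\<in>\<K>. {a \<in> standard_simplex n. \<sigma> a \<in> K})"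
      using K \<sigma> by (intro openin_Union) blast
    ultimately show "openin (simplex_topology n) {a \<in> standard_simplex n. \<sigma> a \<in> \<Union>\<K>}" by simp
  qed
  then show ?thesis unfolding delta_kelley_def by simp
qed

lemma openin_imp_openin_delta_kelley: "openin X U \<Longrightarrow> openin (delta_kelley X) U"
  unfolding openin_delta_kelley
  by (auto simp: openin_subset topspace_standard_simplex dest!: openin_continuous_map_preimage)

lemma topspace_delta_kelley [simp]: "topspace (delta_kelley X) = topspace X"
  by (meson openin_delta_kelley openin_imp_openin_delta_kelley openin_subset openin_topspace subset_antisym)

lemma simplex_colimit_imp_delta_kelley:
  assumes "is_simplex_colimit I d A X q"
  shows "delta_kelley X = X"
proof -
  let ?S = "sum_topology (\<lambda>i. simplex_topology (d i)) I"
  have q: "quotient_map ?S X q" using assms by (simp add: is_simplex_colimit_def)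
  have "openin X U" if U: "openin (delta_kelley X) U" for U
  proof -
    have sub: "U \<subseteq> topspace X" using U by (simp add: openin_delta_kelley)
    have "openin (simplex_topology (d i)) {a. (i, a) \<in> {u \<in> topspace ?S. q u \<in> U}}"
      if i: "i \<in> I" for i
    proof -
      have "continuous_map (simplex_topology (d i)) X (q \<circ> (\<lambda>a. (i, a)))"
        using q i continuous_map_component_injection[of i I "\<lambda>i. simplex_topology (d i)"]
        by (metis continuous_map_compose quotient_imp_continuous_map)
      then have "openin (simplex_topology (d i)) {a \<in> standard_simplex (d i). (q \<circ> Pair i) a \<in> U}"
        using U unfolding openin_delta_kelley by blast
      moreover have "{a. (i, a) \<in> {u \<in> topspace ?S. q u \<in> U}}
          = {a \<in> standard_simplex (d i). (q \<circ> Pair i) a \<in> U}"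
        using i by (auto simp: topspace_standard_simplex)
      ultimately show ?thesis by simp
    qed
    then have "openin ?S {u \<in> topspace ?S. q u \<in> U}"
      by (subst openin_sum_topology) (auto simp: topspace_standard_simplex)
    then show ?thesis using q sub unfolding quotient_map_def by blast
  qed
  then show ?thesis
    by (meson openin_imp_openin_delta_kelley topology_eq)
qed

lemma delta_kelley_imp_delta_generated:
  assumes eq: "delta_kelley X = X"
  shows "delta_generated X"
proof -
  define I where "I = {(n, \<sigma>). continuous_map (simplex_topology n) X \<sigma>}"
  define d :: "nat \<times> ((nat \<Rightarrow> real) \<Rightarrow> 'a) \<Rightarrow> nat" where "d = fst"
  define A where "A = {(i, j, \<phi>). i \<in> I \<and> j \<in> I \<and>
      continuous_map (simplex_topology (d i)) (simplex_topology (d j)) \<phi> \<and>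
      (\<forall>a \<in> standard_simplex (d i). snd j (\<phi> a) = snd i a)}"
  define q where "q = (\<lambda>((n::nat, \<sigma>), a::nat \<Rightarrow> real). \<sigma> a :: 'a)"
  let ?S = "sum_topology (\<lambda>i. simplex_topology (d i)) I"
  let ?R = "simplex_glue d A"
  have tops: "topspace ?S = Sigma I (\<lambda>i. standard_simplex (d i))"
    by (auto simp: topspace_standard_simplex)
  have point: "(0, \<lambda>_. x) \<in> I" if "x \<in> topspace X" for x
    using that by (simp add: I_def)
  have img: "q ` topspace ?S = topspace X"
  proof
    show "q ` topspace ?S \<subseteq> topspace X"
      unfolding tops by (auto simp: q_def I_def d_def continuous_map_def)
    show "topspace X \<subseteq> q ` topspace ?S"
    proof
      fix x assume "x \<in> topspace X"
      moreover obtain a where "a \<in> standard_simplex 0" using nonempty_standard_simplex by blast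
      ultimately show "x \<in> q ` topspace ?S"
        unfolding tops using point
        by (intro image_eqI[of _ _ "((0, \<lambda>_. x), a)"]) (auto simp: q_def d_def)
    qed
  qed
  have quot: "quotient_map ?S X q"
    unfolding quotient_map_def
  proof (intro conjI allI impI img)
    fix U assume U: "U \<subseteq> topspace X"
    have "openin ?S {u \<in> topspace ?S. q u \<in> U} \<longleftrightarrow>
        (\<forall>i\<in>I. openin (simplex_topology (d i)) {a \<in> standard_simplex (d i). snd i a \<in> U})"
    proof -
      have "{a. (i, a) \<in> {u \<in> topspace ?S. q u \<in> U}} = {a \<in> standard_simplex (d i). snd i a \<in> U}"
        if "i \<in> I" for i
        using that unfolding tops by (auto simp: q_def split: prod.splits)
      moreover have "{u \<in> topspace ?S. q u \<in> U} \<subseteq> Sigma I (topspace \<circ> (\<lambda>i. simplex_topology (d i)))"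
        by auto
      ultimately show ?thesis by (subst openin_sum_topology) auto
    qed
    also have "\<dots> \<longleftrightarrow> openin (delta_kelley X) U"
      using U by (auto simp: openin_delta_kelley I_def d_def)
    finally show "openin ?S {u \<in> topspace ?S. q u \<in> U} \<longleftrightarrow> openin X U" using eq by simp
  qed
  have step_eq: "q u = q v" if "(u, v) \<in> ?R" for u v
    using that by (auto simp: simplex_glue_def A_def q_def split: prod.splits)
  have sound: "q u = q v" if "(u, v) \<in> (?R \<union> ?R\<inverse>)\<^sup>*" for u v
    using that
  proof (induction rule: rtrancl_induct)
    case (step v w)
    then have "q v = q w" using step_eq[of v w] step_eq[of w v] by (metis UnE converseD)
    then show ?case using step.IH by simp
  qed simp
  have to_point: "(((0, \<lambda>_. q u), e), u) \<in> ?R"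
    if u: "u \<in> Sigma I (\<lambda>i. standard_simplex (d i))" and e: "e \<in> standard_simplex 0" for u e
  proof -
    obtain i a where ia: "u = (i, a)" "i \<in> I" "a \<in> standard_simplex (d i)" using u by auto
    have qx: "q u \<in> topspace X" using u img tops by blast
    have "((0, \<lambda>_. q u), i, \<lambda>_. a) \<in> A"
      using ia point[OF qx]
      by (auto simp: A_def d_def q_def topspace_standard_simplex split: prod.splits)
    then show ?thesis
      unfolding simplex_glue_def mem_Collect_eq ia(1)[symmetric]
      using ia(1) e by (intro exI[of _ "(0, \<lambda>_. q u)"] exI[of _ i] exI[of _ "\<lambda>_. a"] exI[of _ e]) (simp add: d_def)
  qed
  have complete: "(u, v) \<in> (?R \<union> ?R\<inverse>)\<^sup>*"
    if u: "u \<in> Sigma I (\<lambda>i. standard_simplex (d i))"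
      and v: "v \<in> Sigma I (\<lambda>i. standard_simplex (d i))" and eq: "q u = q v" for u v
  proof -
    obtain e where e: "e \<in> standard_simplex 0" using nonempty_standard_simplex by blast
    have "(u, ((0, \<lambda>_. q u), e)) \<in> ?R \<union> ?R\<inverse>" using to_point[OF u e] by simp
    moreover have "(((0, \<lambda>_. q u), e), v) \<in> ?R \<union> ?R\<inverse>" using to_point[OF v e] eq by simp
    ultimately show ?thesis by (meson converse_rtrancl_into_rtrancl r_into_rtrancl)
  qed
  have "is_simplex_colimit I d A X q"
    unfolding is_simplex_colimit_def
  proof (intro conjI ballI)
    fix w assume "w \<in> A"
    then show "case w of (i, j, \<phi>) \<Rightarrow> i \<in> I \<and> j \<in> I \<and>
        continuous_map (simplex_topology (d i)) (simplex_topology (d j)) \<phi>"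
      unfolding A_def by blast
  next
    fix u v
    assume "u \<in> Sigma I (\<lambda>i. standard_simplex (d i))" "v \<in> Sigma I (\<lambda>i. standard_simplex (d i))"
    then show "q u = q v \<longleftrightarrow> (u, v) \<in> (?R \<union> ?R\<inverse>)\<^sup>*"
      using sound complete by blast
  qed (rule quot)
  then show ?thesis unfolding delta_generated_def by blast
qed

lemma simplex_colimit_imp_delta_generated: "is_simplex_colimit I d A X q \<Longrightarrow> delta_generated X"
  by (simp add: delta_kelley_imp_delta_generated simplex_colimit_imp_delta_kelley)

lemma delta_generated_iff: "delta_generated X \<longleftrightarrow> delta_kelley X = X"
  unfolding delta_generated_def
  by (metis delta_generated_def delta_kelley_imp_delta_generated simplex_colimit_imp_delta_kelley)

lemma delta_generated_delta_kelley: "delta_generated (delta_kelley X)"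
proof -
  have same: "continuous_map (simplex_topology n) (delta_kelley X) \<sigma>"
    if \<sigma>: "continuous_map (simplex_topology n) X \<sigma>" for n \<sigma>
    using \<sigma> by (auto simp: continuous_map_def openin_delta_kelley topspace_standard_simplex)
  have "openin (delta_kelley (delta_kelley X)) U \<longleftrightarrow> openin (delta_kelley X) U" for U
  proof
    assume L: "openin (delta_kelley (delta_kelley X)) U"
    show "openin (delta_kelley X) U"
      unfolding openin_delta_kelley[of X U]
    proof (intro conjI allI impI)
      show "U \<subseteq> topspace X" using openin_subset[OF L] by simp
      fix n \<sigma> assume "continuous_map (simplex_topology n) X \<sigma>"
      from same[OF this] L
      show "openin (simplex_topology n) {a \<in> standard_simplex n. \<sigma> a \<in> U}"
        unfolding openin_delta_kelley[of "delta_kelley X" U] by blast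
    qed
  qed (rule openin_imp_openin_delta_kelley)
  then show ?thesis by (simp add: delta_generated_iff topology_eq)
qed

text \<open>The binary product in the category of Delta-generated spaces.\<close>

definition delta_prod :: "'a topology \<Rightarrow> 'b topology \<Rightarrow> ('a \<times> 'b) topology" where
  "delta_prod X Y = delta_kelley (prod_topology X Y)"


section \<open>Weak homotopy equivalences\<close>

definition cube :: "nat \<Rightarrow> (nat \<Rightarrow> real) topology" where
  "cube n = product_topology (\<lambda>_. top_of_set {0..1}) {..<n}"

definition cube_boundary :: "nat \<Rightarrow> (nat \<Rightarrow> real) set" where
  "cube_boundary n = {t \<in> topspace (cube n). \<exists>i<n. t i = 0 \<or> t i = 1}"

definition cube_maps :: "nat \<Rightarrow> 'a topology \<Rightarrow> 'a \<Rightarrow> ((nat \<Rightarrow> real) \<Rightarrow> 'a) set" where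
  "cube_maps n X x = {g. continuous_map (cube n) X g \<and> g ` cube_boundary n \<subseteq> {x}}"

definition cube_homotopy ::
  "nat \<Rightarrow> 'a topology \<Rightarrow> 'a \<Rightarrow> (((nat \<Rightarrow> real) \<Rightarrow> 'a) \<times> ((nat \<Rightarrow> real) \<Rightarrow> 'a)) set" where
  "cube_homotopy n X x =
     {(g, h). homotopic_with (\<lambda>k. k ` cube_boundary n \<subseteq> {x}) (cube n) X g h}"

definition homotopy_classes :: "nat \<Rightarrow> 'a topology \<Rightarrow> 'a \<Rightarrow> ((nat \<Rightarrow> real) \<Rightarrow> 'a) set set" where
  "homotopy_classes n X x = cube_maps n X x // cube_homotopy n X x"

definition induced_on_classes ::
  "nat \<Rightarrow> 'b topology \<Rightarrow> ('a \<Rightarrow> 'b) \<Rightarrow> 'a \<Rightarrow> ((nat \<Rightarrow> real) \<Rightarrow> 'a) set \<Rightarrow> ((nat \<Rightarrow> real) \<Rightarrow> 'b) set" where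
  "induced_on_classes n Y f x C = cube_homotopy n Y (f x) `` ((\<circ>) f ` C)"

text \<open>
  For \<open>n > 0\<close> these are the homotopy groups; the induced map is always a homomorphism, so
  it is an isomorphism iff it is bijective. For \<open>n = 0\<close> the cube is a point with empty boundary,
  \<open>x\<close> plays no role, and one gets the set of path components; this case is
  required without a base point, so that a space weakly equivalent to the empty space is empty.
\<close>

definition weak_homotopy_equivalence :: "'a topology \<Rightarrow> 'b topology \<Rightarrow> ('a \<Rightarrow> 'b) \<Rightarrow> bool" where
  "weak_homotopy_equivalence X Y f \<longleftrightarrow>
     continuous_map X Y f \<and>
     (\<forall>n x. n = 0 \<or> x \<in> topspace X \<longrightarrow>
        bij_betw (induced_on_classes n Y f x) (homotopy_classes n X x) (homotopy_classes n Y (f x)))"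


section \<open>The m-model structure on spaces\<close>

definition top_lifting ::
  "'a topology \<Rightarrow> 'b topology \<Rightarrow> ('a \<Rightarrow> 'b) \<Rightarrow> 'c topology \<Rightarrow> 'd topology \<Rightarrow> ('c \<Rightarrow> 'd) \<Rightarrow> bool" where
  "top_lifting A B i Y X p \<longleftrightarrow>
     (\<forall>u v. continuous_map A Y u \<and> continuous_map B X v \<and> (\<forall>a \<in> topspace A. p (u a) = v (i a)) \<longrightarrow>
        (\<exists>h. continuous_map B Y h \<and> (\<forall>a \<in> topspace A. h (i a) = u a) \<and>
             (\<forall>b \<in> topspace B. p (h b) = v b)))"

definition h_fibration :: "'u topology \<Rightarrow> 'u topology \<Rightarrow> ('u \<Rightarrow> 'u) \<Rightarrow> bool" where
  "h_fibration Y X p \<longleftrightarrow>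
     continuous_map Y X p \<and>
     (\<forall>Z :: 'u topology. delta_generated Z \<longrightarrow>
        top_lifting (subtopology (delta_prod Z (top_of_set {0..1::real})) (topspace Z \<times> {0}))
          (delta_prod Z (top_of_set {0..1})) id Y X p)"

text \<open>
  The cofibrations of a model structure are the maps with the left lifting property with respect to
  the fibrations that are weak equivalences. The type argument \<open>'u\<close> is the universe whose
  spaces serve as domains and codomains of the latter.
\<close>

definition m_cofibration_top ::
  "'u itself \<Rightarrow> 'a topology \<Rightarrow> 'b topology \<Rightarrow> ('a \<Rightarrow> 'b) \<Rightarrow> bool" where
  "m_cofibration_top _ A B i \<longleftrightarrow>
     continuous_map A B i \<and>
     (\<forall>(Y :: 'u topology) (X :: 'u topology) p.
        delta_generated Y \<and> delta_generated X \<and> h_fibration Y X p \<and> weak_homotopy_equivalence Y X p \<longrightarrow>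
        top_lifting A B i Y X p)"

definition m_cofibrant_top :: "'u itself \<Rightarrow> 'a topology \<Rightarrow> bool" where
  "m_cofibrant_top U B \<longleftrightarrow>
     delta_generated B \<and> m_cofibration_top U (discrete_topology ({} :: 'a set)) B id"


section \<open>Flows\<close>

record 'a flow =
  states :: "'a set"
  paths :: "'a topology"
  src :: "'a \<Rightarrow> 'a"
  tgt :: "'a \<Rightarrow> 'a"
  pcomp :: "'a \<Rightarrow> 'a \<Rightarrow> 'a"

definition composable :: "'a flow \<Rightarrow> ('a \<times> 'a) set" where
  "composable X = {(x, y) \<in> topspace (paths X) \<times> topspace (paths X). tgt X x = src X y}"

text \<open>
  The set of composable pairs is clopen in \<open>PX \<times> PX\<close>, because the set of states is discrete;
  hence the subspace topology is Delta-generated. The same applies to \<open>path_space\<close>.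
\<close>

definition is_flow :: "'a flow \<Rightarrow> bool" where
  "is_flow X \<longleftrightarrow>
     delta_generated (paths X) \<and>
     continuous_map (paths X) (discrete_topology (states X)) (src X) \<and>
     continuous_map (paths X) (discrete_topology (states X)) (tgt X) \<and>
     continuous_map (subtopology (delta_prod (paths X) (paths X)) (composable X)) (paths X)
       (\<lambda>(x, y). pcomp X x y) \<and>
     (\<forall>(x, y) \<in> composable X. src X (pcomp X x y) = src X x \<and> tgt X (pcomp X x y) = tgt X y) \<and>
     (\<forall>x y z. (x, y) \<in> composable X \<and> (y, z) \<in> composable X \<longrightarrow>
        pcomp X (pcomp X x y) z = pcomp X x (pcomp X y z))"

definition path_space :: "'a flow \<Rightarrow> 'a \<Rightarrow> 'a \<Rightarrow> 'a topology" where
  "path_space X \<alpha> \<beta> =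
     subtopology (paths X) {x \<in> topspace (paths X). src X x = \<alpha> \<and> tgt X x = \<beta>}"

record ('a, 'b) flow_map =
  on_states :: "'a \<Rightarrow> 'b"
  on_paths :: "'a \<Rightarrow> 'b"

definition is_flow_map :: "'a flow \<Rightarrow> 'b flow \<Rightarrow> ('a, 'b) flow_map \<Rightarrow> bool" where
  "is_flow_map X Y f \<longleftrightarrow>
     on_states f \<in> states X \<rightarrow> states Y \<and>
     continuous_map (paths X) (paths Y) (on_paths f) \<and>
     (\<forall>x \<in> topspace (paths X).
        src Y (on_paths f x) = on_states f (src X x) \<and>
        tgt Y (on_paths f x) = on_states f (tgt X x)) \<and>
     (\<forall>(x, y) \<in> composable X.
        on_paths f (pcomp X x y) = pcomp Y (on_paths f x) (on_paths f y))"

definition flow_map_comp :: "('b, 'c) flow_map \<Rightarrow> ('a, 'b) flow_map \<Rightarrow> ('a, 'c) flow_map" where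
  "flow_map_comp g f =
     \<lparr>on_states = on_states g \<circ> on_states f, on_paths = on_paths g \<circ> on_paths f\<rparr>"

text \<open>Equality of maps out of \<open>X\<close>: values outside the carriers are irrelevant.\<close>

definition flow_map_eq :: "'a flow \<Rightarrow> ('a, 'b) flow_map \<Rightarrow> ('a, 'b) flow_map \<Rightarrow> bool" where
  "flow_map_eq X f g \<longleftrightarrow>
     (\<forall>\<alpha> \<in> states X. on_states f \<alpha> = on_states g \<alpha>) \<and>
     (\<forall>x \<in> topspace (paths X). on_paths f x = on_paths g x)"


section \<open>The m-model structure on flows\<close>

definition flow_lifting ::
  "'a flow \<Rightarrow> 'b flow \<Rightarrow> ('a, 'b) flow_map \<Rightarrow> 'c flow \<Rightarrow> 'd flow \<Rightarrow> ('c, 'd) flow_map \<Rightarrow> bool" where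
  "flow_lifting A B i Y X p \<longleftrightarrow>
     (\<forall>u v. is_flow_map A Y u \<and> is_flow_map B X v \<and>
            flow_map_eq A (flow_map_comp p u) (flow_map_comp v i) \<longrightarrow>
        (\<exists>h. is_flow_map B Y h \<and> flow_map_eq A (flow_map_comp h i) u \<and>
             flow_map_eq B (flow_map_comp p h) v))"

definition flow_weak_equivalence :: "'a flow \<Rightarrow> 'b flow \<Rightarrow> ('a, 'b) flow_map \<Rightarrow> bool" where
  "flow_weak_equivalence X Y f \<longleftrightarrow>
     is_flow_map X Y f \<and>
     bij_betw (on_states f) (states X) (states Y) \<and>
     (\<forall>\<alpha> \<in> states X. \<forall>\<beta> \<in> states X.
        weak_homotopy_equivalence (path_space X \<alpha> \<beta>)
          (path_space Y (on_states f \<alpha>) (on_states f \<beta>)) (on_paths f))"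

definition flow_m_fibration :: "'u flow \<Rightarrow> 'u flow \<Rightarrow> ('u, 'u) flow_map \<Rightarrow> bool" where
  "flow_m_fibration X Y f \<longleftrightarrow>
     is_flow_map X Y f \<and>
     (\<forall>\<alpha> \<in> states X. \<forall>\<beta> \<in> states X.
        h_fibration (path_space X \<alpha> \<beta>)
          (path_space Y (on_states f \<alpha>) (on_states f \<beta>)) (on_paths f))"

definition m_cofibration_flow ::
  "'u itself \<Rightarrow> 'a flow \<Rightarrow> 'b flow \<Rightarrow> ('a, 'b) flow_map \<Rightarrow> bool" where
  "m_cofibration_flow _ A B i \<longleftrightarrow>
     is_flow_map A B i \<and>
     (\<forall>(Y :: 'u flow) (X :: 'u flow) p.
        is_flow Y \<and> is_flow X \<and> flow_m_fibration Y X p \<and> flow_weak_equivalence Y X p \<longrightarrow>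
        flow_lifting A B i Y X p)"

definition empty_flow :: "'a flow" where
  "empty_flow = \<lparr>states = {}, paths = discrete_topology {}, src = id, tgt = id, pcomp = (\<lambda>x y. x)\<rparr>"

definition m_cofibrant_flow :: "'u itself \<Rightarrow> 'a flow \<Rightarrow> bool" where
  "m_cofibrant_flow U B \<longleftrightarrow>
     is_flow B \<and> m_cofibration_flow U (empty_flow :: 'a flow) B \<lparr>on_states = id, on_paths = id\<rparr>"

end

theory Submission
  imports Defs "HOL-Analysis.Analysis"
begin

text \<open>
  Every m-cofibrant flow \<open>U\<close> is a retract of any flow \<open>V\<close> with a trivial m-fibration to \<open>U\<close>, so it
  suffices to find one such \<open>V\<close> for which maps from the path space of \<open>V\<close> lift against all trivial
  h-fibrations. Let \<open>Q\<close> be the cell complex over the path space \<open>P\<close> of \<open>U\<close> in which every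
  map from the boundary of a cube, with an extension of its image in \<open>P\<close> to the cube, is
  filled by a cell. The product of two cells of \<open>Q\<close> lying over composable cubes of \<open>P\<close> is
  again a cell, so \<open>Q\<close> inherits a strictly associative composition. The path space of \<open>V\<close> consists
  of the points \<open>q\<close> of \<open>Q\<close> with a path in \<open>P\<close> from the value of \<open>q\<close>, composed pointwise; mapping
  such a pair to the end of the path is an h-fibration, and a weak equivalence because
  boundaries of cubes can be filled. Given a trivial h-fibration to \<open>X\<close> and a map from \<open>P\<close> to \<open>X\<close>,
  lift it on \<open>Q\<close> cell by cell, compose with the section \<open>P \<rightarrow> V \<rightarrow> Q\<close>, and correct the
  result by homotopy lifting along the paths.

  The only input on trivial h-fibrations is that they have the right lifting property
  against boundaries of cubes, and conversely that this property implies a weak equivalence.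
\<close>


section \<open>Cubes and Delta-generated spaces\<close>


text \<open>Two obstacles shape the construction. A composition on \<open>Q\<close> chosen by
  lifting would be associative only up to homotopy. So fillers are not chosen: a cell is named by
  its attaching map and the cube of \<open>P\<close> that it covers, and every consistent name is
  attached. The product of two cells then has a name computed from the names of the factors, and
  both bracketings of a triple product give the same name. The second obstacle is that
  \<open>Q\<close> over \<open>P\<close> lifts only against boundaries of cubes, whereas an
  m-fibration must lift homotopies out of every space. The path coordinate of \<open>V\<close>
  repairs this, at the price that \<open>P\<close> is a retract of \<open>Q\<close> only up to
  homotopy; the paths are that homotopy.

  Delta-generated topologies enter through singular cubes. Cubes are compact Hausdorff and closed
  under products, so ordinary products suffice when the multiplication is treated one variable at a
  time. \<open>U\<close> is tested against flows on its own type, its path space against spaces on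
  another, so auxiliary spaces are coded into whichever type the lifting property speaks of.\<close>

abbreviation unit_interval :: "real topology" where
  "unit_interval \<equiv> top_of_set {0..1}"

abbreviation cylinder :: "'a topology \<Rightarrow> ('a \<times> real) topology" where
  "cylinder X \<equiv> prod_topology X unit_interval"

lemma topspace_cube: "topspace (cube n) = {..<n} \<rightarrow>\<^sub>E {0..1}"
  by (simp add: cube_def)

lemma in_topspace_cube:
  "x \<in> topspace (cube n) \<longleftrightarrow> (\<forall>i<n. 0 \<le> x i \<and> x i \<le> 1) \<and> (\<forall>i\<ge>n. x i = undefined)"
  by (simp add: topspace_cube PiE_iff extensional_def Ball_def not_less)

lemma continuous_map_into_cube:
  "continuous_map X (cube n) f \<longleftrightarrow>
     f \<in> topspace X \<rightarrow> topspace (cube n) \<and> (\<forall>i<n. continuous_map X euclideanreal (\<lambda>x. f x i))"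
  unfolding cube_def continuous_map_componentwise
  by (fastforce simp: PiE_def Pi_def continuous_map_in_subtopology image_subset_iff)

lemma continuous_map_cube_coordinate [continuous_intros]:
  "i < n \<Longrightarrow> continuous_map (cube n) euclideanreal (\<lambda>x. x i)"
  using continuous_map_into_cube[of "cube n" n id] by simp

lemma compact_space_cube: "compact_space (cube n)"
  by (simp add: cube_def compact_space_product_topology compact_space_subtopology compactin_euclidean_iff)

lemma Hausdorff_space_cube: "Hausdorff_space (cube n)"
  by (simp add: cube_def Hausdorff_space_product_topology Hausdorff_space_subtopology)

lemma connected_space_cube: "connected_space (cube n)"
  by (simp add: cube_def connected_space_product_topology connected_space_subtopology is_interval_1)

lemma connected_space_unit_interval: "connected_space unit_interval"
  by (simp add: connected_space_subtopology is_interval_1)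

lemma continuous_map_discrete_constant:
  assumes Z: "connected_space Z" and f: "continuous_map Z (discrete_topology S) f"
    and "x \<in> topspace Z" "y \<in> topspace Z"
  shows "f x = f y"
proof -
  have "connectedin (discrete_topology S) (f ` topspace Z)"
    using f Z connectedin_continuous_map_image connectedin_topspace by blast
  then obtain a where "f ` topspace Z \<subseteq> {a}"
    unfolding connectedin_discrete_topology by blast
  then show ?thesis using assms by blast
qed

lemma continuous_map_snoc:
  "continuous_map (cylinder (cube n)) (cube (Suc n)) (\<lambda>(x, t). x(n := t))"
  unfolding continuous_map_into_cube
proof (intro conjI allI impI)
  show "(\<lambda>(x, t). x(n := t)) \<in> topspace (cylinder (cube n)) \<rightarrow> topspace (cube (Suc n))"
    by (fastforce simp: topspace_cube PiE_def Pi_def extensional_def less_Suc_eq)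
  fix i assume "i < Suc n"
  then consider "i = n" | "i < n" by linarith
  then show "continuous_map (cylinder (cube n)) euclideanreal
      (\<lambda>x. (case x of (x, t) \<Rightarrow> x(n := t)) i)"
  proof cases
    case 1
    then show ?thesis
      using continuous_map_into_fulltopology[OF continuous_map_snd[of "cube n" "unit_interval"]]
      by (simp add: case_prod_unfold)
  next
    case 2
    then show ?thesis
      using continuous_map_compose[OF continuous_map_fst continuous_map_cube_coordinate[OF 2]]
      by (simp add: case_prod_unfold o_def)
  qed
qed

lemma continuous_map_unsnoc:
  "continuous_map (cube (Suc n)) (cylinder (cube n)) (\<lambda>y. (restrict y {..<n}, y n))"
proof -
  have "continuous_map (cube (Suc n)) (cube n) (\<lambda>y. restrict y {..<n})"
    unfolding continuous_map_into_cube
    by (simp add: in_topspace_cube continuous_map_cube_coordinate)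
  moreover have "continuous_map (cube (Suc n)) unit_interval (\<lambda>y. y n)"
    by (auto simp: continuous_map_in_subtopology continuous_map_cube_coordinate topspace_cube)
  ultimately show ?thesis by (simp add: continuous_map_paired)
qed

lemma continuous_map_init: "continuous_map (cube (Suc n)) (cube n) (\<lambda>y. restrict y {..<n})"
  and continuous_map_last: "continuous_map (cube (Suc n)) unit_interval (\<lambda>y. y n)"
  using continuous_map_compose[OF continuous_map_unsnoc continuous_map_fst]
    continuous_map_compose[OF continuous_map_unsnoc continuous_map_snd] by (simp_all add: o_def)

lemma continuous_map_snoc_const:
  assumes "t \<in> {0..1}"
  shows "continuous_map (cube n) (cube (Suc n)) (\<lambda>x. x(n := t))"
proof -
  have "continuous_map (cube n) (cylinder (cube n)) (\<lambda>x. (x, t))"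
    using assms by (intro continuous_map_pairedI) auto
  from continuous_map_compose[OF this continuous_map_snoc] show ?thesis by (simp add: o_def)
qed

lemma continuous_map_swap: "continuous_map (prod_topology X Y) (prod_topology Y X) (\<lambda>(x, y). (y, x))"
  by (simp add: case_prod_unfold continuous_map_paired continuous_map_fst continuous_map_snd)

lemma continuous_map_flip: "continuous_map unit_interval unit_interval (\<lambda>t. 1 - t)"
  by (auto simp: continuous_map_in_subtopology intro!: continuous_intros)

lemma unsnoc_snoc: "x \<in> topspace (cube n) \<Longrightarrow> restrict (x(n := t)) {..<n} = x"
  by (auto simp: topspace_cube PiE_def extensional_def)

lemma snoc_unsnoc: "y \<in> topspace (cube (Suc n)) \<Longrightarrow> (restrict y {..<n})(n := y n) = y"
  by (auto simp: topspace_cube PiE_def extensional_def)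

lemma continuous_map_cube_interval:
  "continuous_map (cylinder (cube n)) Y f \<longleftrightarrow>
   continuous_map (cube (Suc n)) Y (\<lambda>y. f (restrict y {..<n}, y n))"
proof
  assume "continuous_map (cylinder (cube n)) Y f"
  from continuous_map_compose[OF continuous_map_unsnoc this]
  show "continuous_map (cube (Suc n)) Y (\<lambda>y. f (restrict y {..<n}, y n))" by (simp add: o_def)
next
  assume "continuous_map (cube (Suc n)) Y (\<lambda>y. f (restrict y {..<n}, y n))"
  from continuous_map_compose[OF continuous_map_snoc this]
  show "continuous_map (cylinder (cube n)) Y f"
    by (rule continuous_map_eq) (auto simp: unsnoc_snoc simp del: restrict_fupd)
qed

section \<open>Simplices and cubes as quotients of each other\<close>

definition simplex_to_cube :: "nat \<Rightarrow> (nat \<Rightarrow> real) \<Rightarrow> nat \<Rightarrow> real" where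
  "simplex_to_cube n x = (\<lambda>i\<in>{..<n}. min 1 (real n * x i))"

text \<open>The cube of dimension \<open>n + 1\<close> has room for the \<open>n + 1\<close>
  barycentric coordinates. Dividing by the sum when it exceeds 1, and otherwise adding the missing
  weight to coordinate 0, leaves the points whose sum is already 1 where they are; hence the map is
  onto.\<close>

definition cube_to_simplex :: "nat \<Rightarrow> (nat \<Rightarrow> real) \<Rightarrow> nat \<Rightarrow> real" where
  "cube_to_simplex n y = (\<lambda>i. if i \<le> n
      then y i / max 1 (\<Sum>j\<le>n. y j) + (if i = 0 then 1 - (\<Sum>j\<le>n. y j) / max 1 (\<Sum>j\<le>n. y j) else 0)
      else 0)"

lemma compact_space_simplex: "compact_space (simplex_topology n)"
  by (simp add: compact_space_subtopology compactin_standard_simplex)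

lemma Hausdorff_space_simplex: "Hausdorff_space (simplex_topology n)"
  by (simp add: Hausdorff_space_subtopology Hausdorff_space_product_topology)

lemma continuous_map_simplex_coordinate [continuous_intros]:
  "continuous_map (simplex_topology n) euclideanreal (\<lambda>x. x i)"
  by (intro continuous_map_from_subtopology continuous_map_product_projection) simp

lemma quotient_map_simplex_to_cube: "quotient_map (simplex_topology n) (cube n) (simplex_to_cube n)"
proof (rule continuous_imp_quotient_map[OF _ compact_space_simplex Hausdorff_space_cube])
  show cont: "continuous_map (simplex_topology n) (cube n) (simplex_to_cube n)"
    unfolding continuous_map_into_cube
  proof (intro conjI allI impI)
    fix i assume "i < n"
    then show "continuous_map (simplex_topology n) euclideanreal (\<lambda>x. simplex_to_cube n x i)"
      by (simp add: simplex_to_cube_def) (intro continuous_intros)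
  qed (auto simp: topspace_cube simplex_to_cube_def standard_simplex_def)
  show "simplex_to_cube n ` topspace (simplex_topology n) = topspace (cube n)"
  proof
    show "simplex_to_cube n ` topspace (simplex_topology n) \<subseteq> topspace (cube n)"
      using cont continuous_map_image_subset_topspace by blast
    show "topspace (cube n) \<subseteq> simplex_to_cube n ` topspace (simplex_topology n)"
    proof
      fix y assume y: "y \<in> topspace (cube n)"
      then have y01: "0 \<le> y i" "y i \<le> 1" if "i < n" for i using that by (simp_all add: in_topspace_cube)
      define s where "s = (\<Sum>i<n. y i / real n)"
      have s0: "0 \<le> s" unfolding s_def by (intro sum_nonneg) (auto simp: y01)
      have "s \<le> (\<Sum>i<n. 1 / real n)" unfolding s_def by (intro sum_mono) (auto simp: y01 divide_right_mono)
      then have s1: "s \<le> 1" by (cases "n = 0") auto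
      \<comment> \<open>The factor \<open>n\<close> in \<open>simplex_to_cube\<close> is chosen so
        that the coordinates \<open>y i / n\<close> have sum at most 1; the vertex of index
        \<open>n\<close> takes the remaining weight.\<close>
      define x where "x = (\<lambda>i. if i < n then y i / real n else if i = n then 1 - s else 0)"
      have "(\<Sum>i\<le>n. x i) = (\<Sum>i<n. x i) + x n"
        by (simp add: lessThan_Suc_atMost[symmetric])
      also have "\<dots> = s + (1 - s)" by (simp add: x_def s_def)
      finally have "(\<Sum>i\<le>n. x i) = 1" by simp
      moreover have "0 \<le> x i \<and> x i \<le> 1" for i
        using y01[of i] s0 s1 by (auto simp: x_def divide_simps)
      ultimately have x: "x \<in> standard_simplex n" by (auto simp: standard_simplex_def x_def)
      have "simplex_to_cube n x = y"
        using y by (auto simp: simplex_to_cube_def x_def in_topspace_cube fun_eq_iff)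
      then show "y \<in> simplex_to_cube n ` topspace (simplex_topology n)" using x by force
    qed
  qed
qed

lemma quotient_map_cube_to_simplex:
  "quotient_map (cube (Suc n)) (simplex_topology n) (cube_to_simplex n)"
proof (rule continuous_imp_quotient_map[OF _ compact_space_cube Hausdorff_space_simplex])
  have into: "cube_to_simplex n y \<in> standard_simplex n" if y: "y \<in> topspace (cube (Suc n))" for y
  proof -
    define S where "S = (\<Sum>j\<le>n. y j)"
    define m where "m = max 1 S"
    have y0: "0 \<le> y i" if "i \<le> n" for i using that y by (simp add: in_topspace_cube)
    have m: "m \<ge> 1" "S \<le> m" by (auto simp: m_def)
    have sum1: "(\<Sum>i\<le>n. cube_to_simplex n y i) = 1"
    proof -
      have "(\<Sum>i\<le>n. cube_to_simplex n y i) = (\<Sum>i\<le>n. y i / m + (if i = 0 then 1 - S / m else 0))"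
        by (intro sum.cong) (auto simp: cube_to_simplex_def S_def m_def)
      also have "\<dots> = S / m + (1 - S / m)"
        by (simp add: sum.distrib S_def sum_divide_distrib[symmetric])
      finally show ?thesis by simp
    qed
    have "S / m \<le> 1" using m by (simp add: divide_simps)
    then have nn: "0 \<le> cube_to_simplex n y i" for i
      using y0[of i] m by (auto simp: cube_to_simplex_def S_def[symmetric] m_def[symmetric])
    have "cube_to_simplex n y i \<le> 1" for i
    proof (cases "i \<le> n")
      case True
      then have "cube_to_simplex n y i \<le> (\<Sum>i\<le>n. cube_to_simplex n y i)"
        by (intro member_le_sum) (auto simp: nn)
      then show ?thesis by (simp add: sum1)
    qed (simp add: cube_to_simplex_def)
    then show ?thesis using nn sum1 by (simp add: standard_simplex_def cube_to_simplex_def)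
  qed
  show cont: "continuous_map (cube (Suc n)) (simplex_topology n) (cube_to_simplex n)"
    unfolding continuous_map_in_subtopology continuous_map_componentwise_UNIV
  proof (intro conjI allI)
    fix i
    show "continuous_map (cube (Suc n)) euclideanreal (\<lambda>y. cube_to_simplex n y i)"
      unfolding cube_to_simplex_def by (intro continuous_intros) auto
  qed (use into in auto)
  show "cube_to_simplex n ` topspace (cube (Suc n)) = topspace (simplex_topology n)"
  proof
    show "topspace (simplex_topology n) \<subseteq> cube_to_simplex n ` topspace (cube (Suc n))"
    proof
      fix x assume x: "x \<in> topspace (simplex_topology n)"
      have "cube_to_simplex n (restrict x {..n}) = x"
        using x by (auto simp: cube_to_simplex_def standard_simplex_def fun_eq_iff)
      moreover have "restrict x {..n} \<in> topspace (cube (Suc n))"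
        using x by (auto simp: topspace_cube standard_simplex_def lessThan_Suc_atMost)
      ultimately show "x \<in> cube_to_simplex n ` topspace (cube (Suc n))" by force
    qed
  qed (use into in auto)
qed

lemma openin_quotient_map:
  "quotient_map X Y q \<Longrightarrow> U \<subseteq> topspace Y \<Longrightarrow> openin X {x \<in> topspace X. q x \<in> U} \<Longrightarrow> openin Y U"
  by (simp add: quotient_map_def)

section \<open>Final topologies for families of singular cubes\<close>

definition probe_topology :: "'a set \<Rightarrow> (nat \<times> ((nat \<Rightarrow> real) \<Rightarrow> 'a)) set \<Rightarrow> 'a topology" where
  "probe_topology S P = topology (\<lambda>U. U \<subseteq> S \<and>
     (\<forall>(n, \<sigma>) \<in> P. openin (cube n) {a \<in> topspace (cube n). \<sigma> a \<in> U}))"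

definition probes :: "'a set \<Rightarrow> (nat \<times> ((nat \<Rightarrow> real) \<Rightarrow> 'a)) set \<Rightarrow> bool" where
  "probes S P \<longleftrightarrow> (\<forall>n \<sigma>. (n, \<sigma>) \<in> P \<longrightarrow> \<sigma> ` topspace (cube n) \<subseteq> S)"

lemma openin_probe_topology:
  "openin (probe_topology S P) U \<longleftrightarrow> U \<subseteq> S \<and>
     (\<forall>n \<sigma>. (n, \<sigma>) \<in> P \<longrightarrow> openin (cube n) {a \<in> topspace (cube n). \<sigma> a \<in> U})"
proof -
  let ?P = "\<lambda>U. U \<subseteq> S \<and> (\<forall>(n, \<sigma>) \<in> P. openin (cube n) {a \<in> topspace (cube n). \<sigma> a \<in> U})"
  have "istopology ?P"
    unfolding istopology_def
  proof (intro conjI allI impI)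
    fix A B assume A: "?P A" and B: "?P B"
    show "A \<inter> B \<subseteq> S" using A by blast
    show "\<forall>(n, \<sigma>) \<in> P. openin (cube n) {a \<in> topspace (cube n). \<sigma> a \<in> A \<inter> B}"
    proof clarify
      fix n \<sigma> assume "(n, \<sigma>) \<in> P"
      then have "openin (cube n) ({a \<in> topspace (cube n). \<sigma> a \<in> A} \<inter> {a \<in> topspace (cube n). \<sigma> a \<in> B})"
        using A B by (intro openin_Int) auto
      also have "\<dots> = {a \<in> topspace (cube n). \<sigma> a \<in> A \<inter> B}" by blast
      finally show "openin (cube n) {a \<in> topspace (cube n). \<sigma> a \<in> A \<inter> B}" .
    qed
  next
    fix \<K> assume K: "\<forall>K\<in>\<K>. ?P K"
    then show "\<Union>\<K> \<subseteq> S" by blast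
    show "\<forall>(n, \<sigma>) \<in> P. openin (cube n) {a \<in> topspace (cube n). \<sigma> a \<in> \<Union>\<K>}"
    proof clarify
      fix n \<sigma> assume "(n, \<sigma>) \<in> P"
      then have "openin (cube n) (\<Union>K\<in>\<K>. {a \<in> topspace (cube n). \<sigma> a \<in> K})"
        using K by (intro openin_Union) blast
      also have "(\<Union>K\<in>\<K>. {a \<in> topspace (cube n). \<sigma> a \<in> K}) = {a \<in> topspace (cube n). \<sigma> a \<in> \<Union>\<K>}" by blast
      finally show "openin (cube n) {a \<in> topspace (cube n). \<sigma> a \<in> \<Union>\<K>}" .
    qed
  qed
  then show ?thesis unfolding probe_topology_def by (auto simp: topology_inverse')
qed

lemma topspace_probe_topology:
  assumes "probes S P"
  shows "topspace (probe_topology S P) = S"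
proof
  show "topspace (probe_topology S P) \<subseteq> S"
    using openin_topspace[of "probe_topology S P"] unfolding openin_probe_topology by blast
  have "{a \<in> topspace (cube n). \<sigma> a \<in> S} = topspace (cube n)" if "(n, \<sigma>) \<in> P" for n \<sigma>
    using assms that unfolding probes_def by blast
  then have "openin (probe_topology S P) S" unfolding openin_probe_topology by simp
  then show "S \<subseteq> topspace (probe_topology S P)" by (rule openin_subset)
qed

lemma continuous_map_probe:
  assumes "probes S P" "(n, \<sigma>) \<in> P"
  shows "continuous_map (cube n) (probe_topology S P) \<sigma>"
  unfolding continuous_map_def topspace_probe_topology[OF assms(1)]
  using assms unfolding probes_def by (auto simp: openin_probe_topology)

lemma continuous_map_from_probe_topology:
  assumes P: "probes S P" and f: "f \<in> S \<rightarrow> topspace Y"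
    and c: "\<And>n \<sigma>. (n, \<sigma>) \<in> P \<Longrightarrow> continuous_map (cube n) Y (f \<circ> \<sigma>)"
  shows "continuous_map (probe_topology S P) Y f"
  unfolding continuous_map_def topspace_probe_topology[OF P]
proof (intro conjI allI impI f)
  fix U assume U: "openin Y U"
  show "openin (probe_topology S P) {x \<in> S. f x \<in> U}"
    unfolding openin_probe_topology
  proof (intro conjI allI impI)
    fix n \<sigma> assume s: "(n, \<sigma>) \<in> P"
    have "openin (cube n) {a \<in> topspace (cube n). (f \<circ> \<sigma>) a \<in> U}"
      using c[OF s] U by (simp add: continuous_map_def)
    also have "{a \<in> topspace (cube n). (f \<circ> \<sigma>) a \<in> U} = {a \<in> topspace (cube n). \<sigma> a \<in> {x \<in> S. f x \<in> U}}"
      using P s unfolding probes_def by auto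
    finally show "openin (cube n) {a \<in> topspace (cube n). \<sigma> a \<in> {x \<in> S. f x \<in> U}}" .
  qed auto
qed

text \<open>Precomposition with the two quotient maps exchanges test maps on simplices and test maps
  on cubes. From here on only cubes occur: unlike simplices they are closed under products, which
  homotopies and products of cells require.\<close>

lemma openin_delta_kelley_cube:
  "openin (delta_kelley X) U \<longleftrightarrow> U \<subseteq> topspace X \<and>
     (\<forall>n \<sigma>. continuous_map (cube n) X \<sigma> \<longrightarrow> openin (cube n) {a \<in> topspace (cube n). \<sigma> a \<in> U})"
  (is "_ \<longleftrightarrow> _ \<and> ?R")
proof -
  have "openin (cube n) {a \<in> topspace (cube n). \<sigma> a \<in> U}"
    if L: "openin (delta_kelley X) U" and \<sigma>: "continuous_map (cube n) X \<sigma>" for n \<sigma>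
  proof -
    let ?q = "simplex_to_cube n"
    note q = quotient_map_simplex_to_cube[of n]
    have "openin (simplex_topology n) {a \<in> standard_simplex n. (\<sigma> \<circ> ?q) a \<in> U}"
      using L continuous_map_compose[OF quotient_imp_continuous_map[OF q] \<sigma>]
      unfolding openin_delta_kelley by blast
    moreover have "{a \<in> standard_simplex n. (\<sigma> \<circ> ?q) a \<in> U} =
        {a \<in> topspace (simplex_topology n). ?q a \<in> {a \<in> topspace (cube n). \<sigma> a \<in> U}}"
      using quotient_imp_surjective_map[OF q] by auto
    moreover have "{a \<in> topspace (cube n). \<sigma> a \<in> U} \<subseteq> topspace (cube n)" by blast
    ultimately show ?thesis
      by (intro openin_quotient_map[OF q]) simp_all
  qed
  moreover have "openin (delta_kelley X) U" if sub: "U \<subseteq> topspace X" and R: ?R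
    unfolding openin_delta_kelley
  proof (intro conjI allI impI sub)
    fix n \<sigma> assume \<sigma>: "continuous_map (simplex_topology n) X \<sigma>"
    let ?q = "cube_to_simplex n"
    note q = quotient_map_cube_to_simplex[of n]
    have "openin (cube (Suc n)) {a \<in> topspace (cube (Suc n)). (\<sigma> \<circ> ?q) a \<in> U}"
      using R continuous_map_compose[OF quotient_imp_continuous_map[OF q] \<sigma>] by blast
    moreover have "{a \<in> topspace (cube (Suc n)). (\<sigma> \<circ> ?q) a \<in> U} =
        {a \<in> topspace (cube (Suc n)). ?q a \<in> {a \<in> standard_simplex n. \<sigma> a \<in> U}}"
      using quotient_imp_surjective_map[OF q] by auto
    moreover have "{a \<in> standard_simplex n. \<sigma> a \<in> U} \<subseteq> topspace (simplex_topology n)" by auto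
    ultimately show "openin (simplex_topology n) {a \<in> standard_simplex n. \<sigma> a \<in> U}"
      by (intro openin_quotient_map[OF q]) simp_all
  qed
  ultimately show ?thesis using openin_subset[of "delta_kelley X" U] by auto
qed

text \<open>This is the largest family of probes. Mapping path spaces and cell complexes use
  families of their own, and the same continuity criteria apply to all three.\<close>

lemma delta_kelley_eq_probe_topology:
  "delta_kelley X = probe_topology (topspace X) {(n, \<sigma>). continuous_map (cube n) X \<sigma>}"
  by (simp add: topology_eq openin_delta_kelley_cube openin_probe_topology)

lemma probes_continuous_maps: "probes (topspace X) {(n, \<sigma>). continuous_map (cube n) X \<sigma>}"
  by (auto simp: probes_def continuous_map_def)

lemma continuous_map_cube_delta_kelley:
  "continuous_map (cube n) (delta_kelley X) f \<longleftrightarrow> continuous_map (cube n) X f"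
proof
  assume "continuous_map (cube n) (delta_kelley X) f"
  then show "continuous_map (cube n) X f"
    by (auto simp: continuous_map_def openin_imp_openin_delta_kelley)
next
  assume "continuous_map (cube n) X f"
  then show "continuous_map (cube n) (delta_kelley X) f"
    unfolding delta_kelley_eq_probe_topology by (intro continuous_map_probe[OF probes_continuous_maps]) simp
qed

lemma continuous_map_delta_kelley:
  assumes "\<And>n \<sigma>. continuous_map (cube n) X \<sigma> \<Longrightarrow> continuous_map (cube n) Y (f \<circ> \<sigma>)"
  shows "continuous_map (delta_kelley X) Y f"
proof -
  have "f x \<in> topspace Y" if "x \<in> topspace X" for x
  proof -
    \<comment> \<open>The 0-cube is a point, so testing constant cubes already shows that
      \<open>f\<close> maps into \<open>Y\<close>.\<close>
    have "continuous_map (cube 0) X (\<lambda>_. x)" using that by simp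
    from continuous_map_funspace[OF assms[OF this]] show ?thesis by (auto simp: topspace_cube)
  qed
  then show ?thesis
    unfolding delta_kelley_eq_probe_topology
    by (intro continuous_map_from_probe_topology[OF probes_continuous_maps] assms) auto
qed

lemma continuous_map_delta_generated:
  assumes "delta_generated X" "\<And>n \<sigma>. continuous_map (cube n) X \<sigma> \<Longrightarrow> continuous_map (cube n) Y (f \<circ> \<sigma>)"
  shows "continuous_map X Y f"
  using continuous_map_delta_kelley[of X Y f] assms by (simp add: delta_generated_iff)

lemma delta_generated_cube: "delta_generated (cube n)"
  unfolding delta_generated_iff topology_eq
proof
  fix U
  have "openin (cube n) U" if "openin (delta_kelley (cube n)) U"
  proof -
    have "openin (cube n) {a \<in> topspace (cube n). id a \<in> U}"
      using that unfolding openin_delta_kelley_cube by (metis continuous_map_id)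
    moreover have "{a \<in> topspace (cube n). id a \<in> U} = U" using openin_subset[OF that] by auto
    ultimately show ?thesis by simp
  qed
  then show "openin (delta_kelley (cube n)) U \<longleftrightarrow> openin (cube n) U"
    using openin_imp_openin_delta_kelley by blast
qed

text \<open>A cube sees no difference between a topology and its coreflection, so the
  Delta-generated product behaves like the ordinary one.\<close>

lemma continuous_map_cube_delta_prod:
  "continuous_map (cube n) (delta_prod X Y) f \<longleftrightarrow>
   continuous_map (cube n) X (fst \<circ> f) \<and> continuous_map (cube n) Y (snd \<circ> f)"
  by (simp add: delta_prod_def continuous_map_cube_delta_kelley continuous_map_pairwise)

lemma topspace_delta_prod [simp]: "topspace (delta_prod X Y) = topspace X \<times> topspace Y"
  by (simp add: delta_prod_def)


lemma delta_generated_probe_topology: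
  assumes "probes S P"
  shows "delta_generated (probe_topology S P)"
proof -
  let ?T = "probe_topology S P"
  have "openin ?T U" if U: "openin (delta_kelley ?T) U" for U
    unfolding openin_probe_topology
  proof (intro conjI allI impI)
    show "U \<subseteq> S" using openin_subset[OF U] topspace_probe_topology[OF assms] by simp
    fix n \<sigma> assume "(n, \<sigma>) \<in> P"
    from continuous_map_probe[OF assms this] U
    show "openin (cube n) {a \<in> topspace (cube n). \<sigma> a \<in> U}" unfolding openin_delta_kelley_cube by blast
  qed
  then show ?thesis
    unfolding delta_generated_iff topology_eq using openin_imp_openin_delta_kelley by blast
qed

text \<open>This replaces cartesian closedness of the category of Delta-generated spaces; the proof is a
  tube lemma argument.\<close>

lemma continuous_map_prod_probe_topology:
  assumes K: "compact_space K" "Hausdorff_space K" and P: "probes S P"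
    and cover: "\<And>s. s \<in> S \<Longrightarrow> \<exists>n \<sigma> a. (n, \<sigma>) \<in> P \<and> a \<in> topspace (cube n) \<and> \<sigma> a = s"
    and c: "\<And>n \<sigma>. (n, \<sigma>) \<in> P \<Longrightarrow> continuous_map (prod_topology K (cube n)) Y (\<lambda>(k, a). f (k, \<sigma> a))"
  shows "continuous_map (prod_topology K (probe_topology S P)) Y f"
  unfolding continuous_map_def
proof (intro conjI allI impI)
  note top = topspace_probe_topology[OF P]
  show "f \<in> topspace (prod_topology K (probe_topology S P)) \<rightarrow> topspace Y"
  proof
    fix z assume "z \<in> topspace (prod_topology K (probe_topology S P))"
    then obtain k s where z: "z = (k, s)" "k \<in> topspace K" "s \<in> S" using top by auto
    from cover[OF z(3)] obtain n \<sigma> a where s: "(n, \<sigma>) \<in> P" "a \<in> topspace (cube n)" "\<sigma> a = s" by blast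
    from funcset_mem[OF continuous_map_funspace[OF c[OF s(1)]], of "(k, a)"] s z
    show "f z \<in> topspace Y" by simp
  qed
  fix U assume U: "openin Y U"
  define W where "W = {x \<in> topspace (prod_topology K (probe_topology S P)). f x \<in> U}"
  have open_W: "openin (prod_topology K (cube n)) {(k, a). k \<in> topspace K \<and> a \<in> topspace (cube n) \<and> f (k, \<sigma> a) \<in> U}"
    (is "openin _ ?A") if "(n, \<sigma>) \<in> P" for n \<sigma>
  proof -
    have "?A = {z \<in> topspace (prod_topology K (cube n)). (\<lambda>(k, a). f (k, \<sigma> a)) z \<in> U}" by auto
    then show ?thesis using c[OF that] U by (simp add: continuous_map_def)
  qed
  show "openin (prod_topology K (probe_topology S P)) {x \<in> topspace (prod_topology K (probe_topology S P)). f x \<in> U}"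
    unfolding W_def[symmetric] openin_prod_topology_alt
  proof (intro allI impI)
    fix k0 s0 assume "(k0, s0) \<in> W"
    then have k0: "k0 \<in> topspace K" and s0: "s0 \<in> S" and f0: "f (k0, s0) \<in> U"
      by (auto simp: W_def top)
    from cover[OF s0] obtain n0 \<sigma>0 a0
      where s: "(n0, \<sigma>0) \<in> P" "a0 \<in> topspace (cube n0)" "\<sigma>0 a0 = s0" by blast
    have "(k0, a0) \<in> {(k, a). k \<in> topspace K \<and> a \<in> topspace (cube n0) \<and> f (k, \<sigma>0 a) \<in> U}"
      using k0 s f0 by simp
    with open_W[OF s(1)] obtain N N' where N: "openin K N" "k0 \<in> N" "a0 \<in> N'"
      "N \<times> N' \<subseteq> {(k, a). k \<in> topspace K \<and> a \<in> topspace (cube n0) \<and> f (k, \<sigma>0 a) \<in> U}"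
      unfolding openin_prod_topology_alt by meson
    have "neighbourhood_base_of (closedin K) K"
      using compact_Hausdorff_imp_regular_space[OF K] by (simp add: neighbourhood_base_of_closedin)
    then obtain V C where V: "openin K V" "closedin K C" "k0 \<in> V" "V \<subseteq> C" "C \<subseteq> N"
      using N unfolding neighbourhood_base_of by meson
    have C: "compactin K C" using V(2) K(1) closedin_compact_space by blast
    \<comment> \<open>The closed neighbourhood \<open>C\<close> of \<open>k0\<close> is compact, so
      the tube lemma can be applied along it over every probe. This makes \<open>G\<close>
      open.\<close>
    define G where "G = {s \<in> S. \<forall>k\<in>C. f (k, s) \<in> U}"
    have "openin (probe_topology S P) G"
      unfolding openin_probe_topology
    proof (intro conjI allI impI)
      fix n \<sigma> assume ns: "(n, \<sigma>) \<in> P"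
      show "openin (cube n) {a \<in> topspace (cube n). \<sigma> a \<in> G}"
      proof (subst openin_subopen, intro ballI)
        fix a assume a: "a \<in> {a \<in> topspace (cube n). \<sigma> a \<in> G}"
        have "C \<times> {a} \<subseteq> {(k, a). k \<in> topspace K \<and> a \<in> topspace (cube n) \<and> f (k, \<sigma> a) \<in> U}"
          using a compactin_subset_topspace[OF C] by (auto simp: G_def)
        from tube_lemma_left[OF open_W[OF ns] C _ this] a
        obtain A B where AB: "openin (cube n) B" "C \<subseteq> A" "a \<in> B"
          "A \<times> B \<subseteq> {(k, a). k \<in> topspace K \<and> a \<in> topspace (cube n) \<and> f (k, \<sigma> a) \<in> U}" by auto
        have "B \<subseteq> {a \<in> topspace (cube n). \<sigma> a \<in> G}"
        proof
          fix b assume b: "b \<in> B"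
          have "b \<in> topspace (cube n)" using b AB(1) openin_subset by blast
          then show "b \<in> {a \<in> topspace (cube n). \<sigma> a \<in> G}"
            using b AB ns P unfolding G_def probes_def by fastforce
        qed
        then show "\<exists>T. openin (cube n) T \<and> a \<in> T \<and> T \<subseteq> {a \<in> topspace (cube n). \<sigma> a \<in> G}"
          using AB by blast
      qed
    qed (auto simp: G_def)
    moreover have "s0 \<in> G"
      using V N s s0 by (auto simp: G_def)
    moreover have "V \<times> G \<subseteq> W"
      using V N openin_subset[OF V(1)] by (auto simp: W_def top G_def)
    ultimately show "\<exists>A B. openin K A \<and> openin (probe_topology S P) B \<and> k0 \<in> A \<and> s0 \<in> B \<and> A \<times> B \<subseteq> W"
      using V by blast
  qed
qed

lemma compact_space_unit_interval: "compact_space unit_interval"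
  by (simp add: compact_space_subtopology)

lemma Hausdorff_space_unit_interval: "Hausdorff_space unit_interval"
  by (simp add: Hausdorff_space_subtopology)


section \<open>Mapping path spaces\<close>

text \<open>Extensionality makes paths that agree on the interval equal as functions, so later
  constructions can return to a given path strictly.\<close>

definition mpath_carrier :: "'a topology \<Rightarrow> 'b topology \<Rightarrow> ('a \<Rightarrow> 'b) \<Rightarrow> ('a \<times> (real \<Rightarrow> 'b)) set" where
  "mpath_carrier A B f = {(x, \<gamma>). x \<in> topspace A \<and> \<gamma> \<in> extensional {0..1} \<and>
     continuous_map unit_interval B \<gamma> \<and> \<gamma> 0 = f x}"

definition mpath_probes :: "'a topology \<Rightarrow> 'b topology \<Rightarrow> ('a \<Rightarrow> 'b) \<Rightarrow>
    (nat \<times> ((nat \<Rightarrow> real) \<Rightarrow> 'a \<times> (real \<Rightarrow> 'b))) set" where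
  "mpath_probes A B f = {(n, \<sigma>). \<sigma> ` topspace (cube n) \<subseteq> mpath_carrier A B f \<and>
     continuous_map (cube n) A (fst \<circ> \<sigma>) \<and>
     continuous_map (cylinder (cube n)) B (\<lambda>(a, t). snd (\<sigma> a) t)}"

definition mpath :: "'a topology \<Rightarrow> 'b topology \<Rightarrow> ('a \<Rightarrow> 'b) \<Rightarrow> ('a \<times> (real \<Rightarrow> 'b)) topology" where
  "mpath A B f = probe_topology (mpath_carrier A B f) (mpath_probes A B f)"

lemma probes_mpath: "probes (mpath_carrier A B f) (mpath_probes A B f)"
  by (auto simp: probes_def mpath_probes_def)

lemma topspace_mpath [simp]: "topspace (mpath A B f) = mpath_carrier A B f"
  by (simp add: mpath_def topspace_probe_topology probes_mpath)

lemma delta_generated_mpath: "delta_generated (mpath A B f)"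
  by (simp add: mpath_def delta_generated_probe_topology probes_mpath)

lemma continuous_map_fst_mpath: "continuous_map (mpath A B f) A fst"
  unfolding mpath_def
proof (rule continuous_map_from_probe_topology[OF probes_mpath])
  show "fst \<in> mpath_carrier A B f \<rightarrow> topspace A" by (auto simp: mpath_carrier_def)
qed (simp add: mpath_probes_def)

lemma constant_in_mpath_probes: "s \<in> mpath_carrier A B f \<Longrightarrow> (n, \<lambda>_. s) \<in> mpath_probes A B f"
proof -
  assume s: "s \<in> mpath_carrier A B f"
  then have "continuous_map (cylinder (cube n)) B (snd s \<circ> snd)"
    by (intro continuous_map_compose[OF continuous_map_snd]) (auto simp: mpath_carrier_def)
  then show "(n, \<lambda>_. s) \<in> mpath_probes A B f"
    using s by (auto simp: mpath_probes_def mpath_carrier_def case_prod_unfold o_def)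
qed

text \<open>The interval is compact Hausdorff, so continuity on the product can be tested on probes,
  where it is the defining condition.\<close>

lemma continuous_map_mpath_eval:
  "continuous_map (prod_topology unit_interval (mpath A B f)) B (\<lambda>(t, m). snd m t)"
  unfolding mpath_def
proof (rule continuous_map_prod_probe_topology
    [OF compact_space_unit_interval Hausdorff_space_unit_interval probes_mpath])
  fix s assume s: "s \<in> mpath_carrier A B f"
  moreover have "(\<lambda>_. undefined) \<in> topspace (cube 0)" by (simp add: topspace_cube)
  ultimately show "\<exists>n \<sigma> a. (n, \<sigma>) \<in> mpath_probes A B f \<and> a \<in> topspace (cube n) \<and> \<sigma> a = s"
    using constant_in_mpath_probes by blast
next
  fix n \<sigma> assume "(n, \<sigma>) \<in> mpath_probes A B f"
  then have "continuous_map (cylinder (cube n)) B (\<lambda>(a, t). snd (\<sigma> a) t)"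
    by (simp add: mpath_probes_def)
  from continuous_map_compose[OF _ this, of "prod_topology unit_interval (cube n)" "\<lambda>(t, a). (a, t)"]
  show "continuous_map (prod_topology unit_interval (cube n)) B (\<lambda>(k, a). (\<lambda>(t, m). snd m t) (k, \<sigma> a))"
    by (simp add: case_prod_unfold o_def continuous_map_paired continuous_map_fst continuous_map_snd)
qed

lemma continuous_map_mpath_app:
  assumes "continuous_map X (mpath A B f) g" "continuous_map X unit_interval t"
  shows "continuous_map X B (\<lambda>x. snd (g x) (t x))"
  using continuous_map_compose[OF continuous_map_pairedI[OF assms(2,1)] continuous_map_mpath_eval]
  by (simp add: o_def)

text \<open>By joint continuity of evaluation, every singular cube satisfies the condition imposed
  on probes; passing to the final topology adds no new cubes.\<close>

lemma continuous_map_cube_mpath: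
  "continuous_map (cube n) (mpath A B f) \<sigma> \<longleftrightarrow> (n, \<sigma>) \<in> mpath_probes A B f"
proof
  assume L: "continuous_map (cube n) (mpath A B f) \<sigma>"
  have "continuous_map (cylinder (cube n)) B (\<lambda>z. snd ((\<sigma> \<circ> fst) z) (snd z))"
    by (rule continuous_map_mpath_app[OF continuous_map_compose[OF continuous_map_fst L] continuous_map_snd])
  moreover have "\<sigma> ` topspace (cube n) \<subseteq> mpath_carrier A B f"
    using continuous_map_image_subset_topspace[OF L] by simp
  ultimately show "(n, \<sigma>) \<in> mpath_probes A B f"
    using continuous_map_compose[OF L continuous_map_fst_mpath]
    by (simp add: mpath_probes_def case_prod_unfold)
next
  assume "(n, \<sigma>) \<in> mpath_probes A B f"
  then show "continuous_map (cube n) (mpath A B f) \<sigma>"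
    unfolding mpath_def by (rule continuous_map_probe[OF probes_mpath])
qed

lemma continuous_map_cube_into_mpath:
  assumes g: "continuous_map (cube n) A g"
    and w: "continuous_map (cylinder (cube n)) B w"
    and s: "\<And>a. a \<in> topspace (cube n) \<Longrightarrow> w (a, 0) = f (g a)"
  shows "continuous_map (cube n) (mpath A B f) (\<lambda>a. (g a, \<lambda>t\<in>{0..1}. w (a, t)))"
  unfolding continuous_map_cube_mpath mpath_probes_def
proof clarify
  have "continuous_map (cylinder (cube n)) B
      (\<lambda>(a, t). snd (g a, \<lambda>t\<in>{0..1}. w (a, t)) t)"
    by (rule continuous_map_eq[OF w]) auto
  moreover have "(\<lambda>a. (g a, \<lambda>t\<in>{0..1}. w (a, t))) ` topspace (cube n) \<subseteq> mpath_carrier A B f"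
  proof clarify
    fix a assume a: "a \<in> topspace (cube n)"
    have "continuous_map unit_interval B (w \<circ> Pair a)"
      by (rule continuous_map_o_Pair[OF w a])
    then have "continuous_map unit_interval B (\<lambda>t\<in>{0..1}. w (a, t))"
      by (rule continuous_map_eq) auto
    then show "(g a, \<lambda>t\<in>{0..1}. w (a, t)) \<in> mpath_carrier A B f"
      using a s continuous_map_funspace[OF g] by (auto simp: mpath_carrier_def)
  qed
  ultimately show "(\<lambda>a. (g a, \<lambda>t\<in>{0..1}. w (a, t))) ` topspace (cube n) \<subseteq> mpath_carrier A B f \<and>
      continuous_map (cube n) A (fst \<circ> (\<lambda>a. (g a, \<lambda>t\<in>{0..1}. w (a, t)))) \<and>
      continuous_map (cylinder (cube n)) B
        (\<lambda>(a, t). snd (g a, \<lambda>t\<in>{0..1}. w (a, t)) t)"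
    using g by (simp add: o_def)
qed

section \<open>Copies of spaces inside the universe\<close>

definition encode_topology :: "('a \<Rightarrow> 'b) \<Rightarrow> 'a topology \<Rightarrow> 'b topology" where
  "encode_topology e X = pullback_topology (e ` topspace X) (inv_into UNIV e) X"

context
  fixes e :: "'a \<Rightarrow> 'b" and X :: "'a topology"
  assumes inj: "inj e"
begin

lemma topspace_encode_topology: "topspace (encode_topology e X) = e ` topspace X"
  by (auto simp: encode_topology_def topspace_pullback_topology inv_f_f[OF inj])

lemma continuous_map_encode: "continuous_map X (encode_topology e X) e"
  unfolding continuous_map_def topspace_encode_topology
proof (intro conjI allI impI)
  fix U assume "openin (encode_topology e X) U"
  then obtain W where W: "openin X W" "U = inv_into UNIV e -` W \<inter> e ` topspace X"
    by (auto simp: encode_topology_def openin_pullback_topology)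
  then have "{x \<in> topspace X. e x \<in> U} = W"
    using openin_subset by (auto simp: inv_f_f[OF inj])
  then show "openin X {x \<in> topspace X. e x \<in> U}" using W by simp
qed auto

lemma continuous_map_decode: "continuous_map (encode_topology e X) X (inv_into UNIV e)"
  unfolding continuous_map_def topspace_encode_topology
proof (intro conjI allI impI)
  fix U assume U: "openin X U"
  have "{x \<in> e ` topspace X. inv_into UNIV e x \<in> U} = inv_into UNIV e -` U \<inter> e ` topspace X" by auto
  then show "openin (encode_topology e X) {x \<in> e ` topspace X. inv_into UNIV e x \<in> U}"
    using U by (auto simp: encode_topology_def openin_pullback_topology)
qed (auto simp: inv_f_f[OF inj])

lemma delta_generated_encode_topology:
  assumes "delta_generated X"
  shows "delta_generated (encode_topology e X)"
proof -
  let ?E = "encode_topology e X"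
  have "continuous_map X (delta_kelley ?E) e"
    by (rule continuous_map_delta_generated[OF assms])
      (simp add: continuous_map_cube_delta_kelley continuous_map_compose[OF _ continuous_map_encode])
  from continuous_map_compose[OF continuous_map_decode this]
  have "continuous_map ?E (delta_kelley ?E) id"
    by (rule continuous_map_eq) (auto simp: topspace_encode_topology inv_f_f[OF inj])
  then have "openin ?E {x \<in> topspace ?E. id x \<in> U}" if "openin (delta_kelley ?E) U" for U
    using that by (simp add: continuous_map_def)
  moreover have "{x \<in> topspace ?E. id x \<in> U} = U" if "openin (delta_kelley ?E) U" for U
    using openin_subset[OF that] by auto
  ultimately show ?thesis
    unfolding delta_generated_iff topology_eq using openin_imp_openin_delta_kelley by metis
qed

end

lemma universe_pair:
  assumes "universe TYPE('u)"
  shows "\<exists>e::'u \<times> 'u \<Rightarrow> 'u. inj e"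
proof -
  from assms obtain e :: "(real \<Rightarrow> 'u) \<Rightarrow> 'u" where e: "inj e" unfolding universe_def by blast
  \<comment> \<open>A pair is coded as the function with value \<open>x\<close> at 0 and
    \<open>y\<close> elsewhere; the arguments 0 and 1 recover it.\<close>
  have "inj (\<lambda>(x, y). e (\<lambda>r. if r = 0 then x else y))"
  proof (rule injI, clarify)
    fix x y x' y' :: 'u
    assume "e (\<lambda>r. if r = 0 then x else y) = e (\<lambda>r. if r = 0 then x' else y')"
    then have "(\<lambda>r::real. if r = 0 then x else y) = (\<lambda>r. if r = 0 then x' else y')"
      using e by (simp add: inj_eq)
    from fun_cong[OF this, of 0] fun_cong[OF this, of 1] show "x = x' \<and> y = y'" by simp
  qed
  then show ?thesis by blast
qed

lemma universe_pair_path: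
  assumes "universe TYPE('u)" "inj (c :: 'a \<Rightarrow> 'u)"
  shows "\<exists>e::'a \<times> (real \<Rightarrow> 'u) \<Rightarrow> 'u. inj e"
proof -
  from assms(1) obtain e :: "(real \<Rightarrow> 'u) \<Rightarrow> 'u" where e: "inj e" unfolding universe_def by blast
  from universe_pair[OF assms(1)] obtain q :: "'u \<times> 'u \<Rightarrow> 'u" where q: "inj q" by blast
  have "inj (\<lambda>(x, \<gamma>). q (c x, e \<gamma>))"
    by (rule injI) (use e q assms(2) in \<open>auto simp: inj_eq\<close>)
  then show ?thesis by blast
qed

section \<open>Homotopy lifting for spaces on arbitrary types\<close>

lemma continuous_map_delta_prod_fst: "continuous_map (delta_prod X Y) X fst"
  and continuous_map_delta_prod_snd: "continuous_map (delta_prod X Y) Y snd"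
  unfolding delta_prod_def
  by (rule continuous_map_delta_kelley, simp add: continuous_map_pairwise)+

lemma delta_generated_delta_prod: "delta_generated (delta_prod X Y)"
  by (simp add: delta_prod_def delta_generated_delta_kelley)

lemma continuous_map_into_delta_prod:
  assumes "delta_generated Z" "continuous_map Z X f" "continuous_map Z Y g"
  shows "continuous_map Z (delta_prod X Y) (\<lambda>z. (f z, g z))"
  by (rule continuous_map_delta_generated[OF assms(1)])
    (simp add: continuous_map_cube_delta_prod o_def continuous_map_compose[OF _ assms(2), unfolded o_def]
      continuous_map_compose[OF _ assms(3), unfolded o_def])

text \<open>The mapping path space of \<open>p\<close> is the universal test object, and it fits into the universe.\<close>

lemma h_fibration_lifting:
  fixes Y X :: "'v topology" and Z :: "'w topology"
  assumes univ: "universe TYPE('v)" and hfib: "h_fibration Y X p" and Z: "delta_generated Z"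
    and u: "continuous_map Z Y u" and v: "continuous_map (delta_prod Z unit_interval) X v"
    and uv: "\<And>z. z \<in> topspace Z \<Longrightarrow> p (u z) = v (z, 0)"
  obtains h where "continuous_map (delta_prod Z unit_interval) Y h"
    "\<And>z. z \<in> topspace Z \<Longrightarrow> h (z, 0) = u z"
    "\<And>z t. z \<in> topspace Z \<Longrightarrow> t \<in> {0..1} \<Longrightarrow> p (h (z, t)) = v (z, t)"
proof -
  obtain e :: "'v \<times> (real \<Rightarrow> 'v) \<Rightarrow> 'v" where e: "inj e"
    using universe_pair_path[OF univ inj_on_id] by blast
  let ?M = "mpath Y X p"
  let ?Z = "encode_topology e ?M"
  have Z0: "delta_generated ?Z" using delta_generated_encode_topology[OF e delta_generated_mpath] .
  note dec = continuous_map_decode[OF e, of ?M]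
  define u0 where "u0 = (\<lambda>(z, t::real). fst (inv_into UNIV e z))"
  define v0 where "v0 = (\<lambda>(z, t). snd (inv_into UNIV e z) t)"
  have fst_dec: "continuous_map (delta_prod ?Z unit_interval) ?M (inv_into UNIV e \<circ> fst)"
    by (rule continuous_map_compose[OF continuous_map_delta_prod_fst dec])
  have "continuous_map (delta_prod ?Z unit_interval) Y (fst \<circ> (inv_into UNIV e \<circ> fst))"
    by (rule continuous_map_compose[OF fst_dec continuous_map_fst_mpath])
  then have u0: "continuous_map (subtopology (delta_prod ?Z unit_interval) (topspace ?Z \<times> {0})) Y u0"
    by (intro continuous_map_from_subtopology) (simp add: u0_def case_prod_unfold o_def)
  have v0: "continuous_map (delta_prod ?Z unit_interval) X v0"
    using continuous_map_mpath_app[OF fst_dec continuous_map_delta_prod_snd]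
    by (simp add: v0_def case_prod_unfold o_def)
  have "top_lifting (subtopology (delta_prod ?Z unit_interval) (topspace ?Z \<times> {0}))
      (delta_prod ?Z unit_interval) id Y X p"
    using hfib Z0 unfolding h_fibration_def by blast
  moreover have "p (u0 a) = v0 (id a)"
    if "a \<in> topspace (subtopology (delta_prod ?Z unit_interval) (topspace ?Z \<times> {0}))" for a
    using that e by (auto simp: u0_def v0_def topspace_encode_topology[OF e] mpath_carrier_def)
  ultimately obtain h0 where h0: "continuous_map (delta_prod ?Z unit_interval) Y h0"
    "\<And>a. a \<in> topspace (subtopology (delta_prod ?Z unit_interval) (topspace ?Z \<times> {0})) \<Longrightarrow> h0 (id a) = u0 a"
    "\<And>b. b \<in> topspace (delta_prod ?Z unit_interval) \<Longrightarrow> p (h0 b) = v0 b"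
    using u0 v0 unfolding top_lifting_def by blast
  \<comment> \<open>The classifying map: a point goes to its initial value in \<open>Y\<close>
    together with its path in \<open>X\<close>, so the given problem is the pullback of the
    universal one along \<open>e \<circ> j\<close>.\<close>
  define j where "j = (\<lambda>z. (u z, \<lambda>t\<in>{0..1}. v (z, t)))"
  have j: "continuous_map Z ?M j"
  proof (rule continuous_map_delta_generated[OF Z])
    fix n \<kappa> assume k: "continuous_map (cube n) Z \<kappa>"
    have "continuous_map (cube n) ?M (\<lambda>a. ((u \<circ> \<kappa>) a, \<lambda>t\<in>{0..1}. (\<lambda>(a, t). v (\<kappa> a, t)) (a, t)))"
    proof (rule continuous_map_cube_into_mpath)
      show "continuous_map (cube n) Y (u \<circ> \<kappa>)" by (rule continuous_map_compose[OF k u])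
      have "continuous_map (cube (Suc n)) (delta_prod Z unit_interval) (\<lambda>y. (\<kappa> (restrict y {..<n}), y n))"
        using continuous_map_compose[OF continuous_map_init k] continuous_map_last
        by (simp add: continuous_map_cube_delta_prod o_def)
      from continuous_map_compose[OF this v]
      show "continuous_map (cylinder (cube n)) X (\<lambda>(a, t). v (\<kappa> a, t))"
        by (simp add: continuous_map_cube_interval o_def)
      fix a assume "a \<in> topspace (cube n)"
      then show "(\<lambda>(a, t). v (\<kappa> a, t)) (a, 0) = p ((u \<circ> \<kappa>) a)"
        using uv continuous_map_funspace[OF k] by (auto simp: Pi_iff)
    qed
    then show "continuous_map (cube n) ?M (j \<circ> \<kappa>)" by (simp add: j_def o_def)
  qed
  then have ej: "continuous_map Z ?Z (e \<circ> j)"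
    by (rule continuous_map_compose[OF _ continuous_map_encode[OF e]])
  have "continuous_map (delta_prod Z unit_interval) (delta_prod ?Z unit_interval) (\<lambda>z. ((e \<circ> j \<circ> fst) z, snd z))"
    by (intro continuous_map_into_delta_prod delta_generated_delta_prod
        continuous_map_compose[OF continuous_map_delta_prod_fst ej] continuous_map_delta_prod_snd)
  from continuous_map_compose[OF this h0(1)]
  have c: "continuous_map (delta_prod Z unit_interval) Y (\<lambda>(z, t). h0 (e (j z), t))"
    by (simp add: o_def case_prod_unfold)
  have ejZ: "e (j z) \<in> topspace ?Z" if "z \<in> topspace Z" for z
    using continuous_map_funspace[OF ej] that by auto
  show ?thesis
  proof (rule that[OF c])
    fix z assume z: "z \<in> topspace Z"
    show "(\<lambda>(z, t). h0 (e (j z), t)) (z, 0) = u z"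
      using h0(2)[of "(e (j z), 0)"] ejZ[OF z] e by (simp add: u0_def j_def)
    fix t :: real assume t: "t \<in> {0..1}"
    show "p ((\<lambda>(z, t). h0 (e (j z), t)) (z, t)) = v (z, t)"
      using h0(3)[of "(e (j z), t)"] ejZ[OF z] e t by (simp add: v0_def j_def)
  qed
qed



section \<open>Lifting against boundaries of cubes\<close>

lemma continuous_map_two_closed:
  assumes "closedin X A" "closedin X B" "topspace X \<subseteq> A \<union> B"
    and f: "continuous_map (subtopology X A) Y f" and g: "continuous_map (subtopology X B) Y g"
    and fg: "\<And>x. x \<in> A \<Longrightarrow> x \<in> B \<Longrightarrow> f x = g x"
  shows "continuous_map X Y (\<lambda>x. if x \<in> A then f x else g x)"
proof (rule pasting_lemma_closed[of "UNIV :: bool set" X "\<lambda>b. if b then A else B" Y "\<lambda>b. if b then f else g"])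
  show "\<And>i j x. x \<in> topspace X \<inter> (if i then A else B) \<inter> (if j then A else B) \<Longrightarrow>
      (if i then f else g) x = (if j then f else g) x"
    using fg by (auto split: if_splits)
  fix x assume "x \<in> topspace X"
  then show "\<exists>j. j \<in> UNIV \<and> x \<in> (if j then A else B) \<and> (if x \<in> A then f x else g x) = (if j then f else g) x"
    using assms(3) by (intro exI[of _ "x \<in> A"]) auto
qed (use assms in auto)

lemma closedin_level_set:
  "continuous_map X euclideanreal f \<Longrightarrow> closedin X {x \<in> topspace X. f x = c}"
  using closedin_continuous_map_preimage[of X euclideanreal f "{c}"] by simp

lemma closedin_cube_boundary: "closedin (cube n) (cube_boundary n)"
proof -
  have "cube_boundary n = (\<Union>i<n. {x \<in> topspace (cube n). x i = 0} \<union> {x \<in> topspace (cube n). x i = 1})"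
    by (auto simp: cube_boundary_def)
  also have "closedin (cube n) \<dots>"
    by (intro closedin_Union closedin_Un) (auto intro!: closedin_Un closedin_level_set continuous_map_cube_coordinate)
  finally show ?thesis .
qed

section \<open>The open box in a cube and its radial retraction\<close>

definition cube_box :: "nat \<Rightarrow> (nat \<Rightarrow> real) set" where
  "cube_box n = {y \<in> topspace (cube (Suc n)). y n = 0 \<or> restrict y {..<n} \<in> cube_boundary n}"

lemma restrict_in_cube: "y \<in> topspace (cube (Suc n)) \<Longrightarrow> restrict y {..<n} \<in> topspace (cube n)"
  by (simp add: in_topspace_cube)

lemma restrict_in_boundary_iff:
  "y \<in> topspace (cube (Suc n)) \<Longrightarrow> restrict y {..<n} \<in> cube_boundary n \<longleftrightarrow> (\<exists>i<n. y i = 0 \<or> y i = 1)"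
  by (auto simp: cube_boundary_def restrict_in_cube)

lemma snoc_in_cube: "x \<in> topspace (cube n) \<Longrightarrow> t \<in> {0..1} \<Longrightarrow> x(n := t) \<in> topspace (cube (Suc n))"
  by (auto simp: in_topspace_cube less_Suc_eq)

lemma cube_boundary_Suc:
  "cube_boundary (Suc n) = cube_box n \<union> {y \<in> topspace (cube (Suc n)). y n = 1}"
  by (auto simp: cube_boundary_def cube_box_def restrict_in_cube less_Suc_eq)

lemma snoc_bottom_in_box: "x \<in> topspace (cube n) \<Longrightarrow> x(n := 0) \<in> cube_box n"
  by (simp add: cube_box_def snoc_in_cube)

lemma snoc_top_in_boundary: "x \<in> topspace (cube n) \<Longrightarrow> x(n := 1) \<in> cube_boundary (Suc n)"
  by (simp add: cube_boundary_Suc snoc_in_cube)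

lemma cube_boundary_subset: "cube_boundary n \<subseteq> topspace (cube n)"
  by (auto simp: cube_boundary_def)

lemma snoc_side_in_box:
  assumes "x \<in> cube_boundary n" "t \<in> {0..1}"
  shows "x(n := t) \<in> cube_box n"
proof -
  have x: "x \<in> topspace (cube n)" using assms(1) cube_boundary_subset by blast
  then show ?thesis
    using assms unsnoc_snoc[OF x] by (simp add: cube_box_def snoc_in_cube del: restrict_fupd)
qed

text \<open>The maximum norm after rescaling the unit cube to coordinates between -1 and 1. A point
  of the cube lies on the boundary exactly when the value is 1.\<close>

primrec centered_norm :: "nat \<Rightarrow> (nat \<Rightarrow> real) \<Rightarrow> real" where
  "centered_norm 0 y = 0"
| "centered_norm (Suc n) y = max (centered_norm n y) \<bar>2 * y n - 1\<bar>"

lemma centered_norm_ge: "i < n \<Longrightarrow> \<bar>2 * y i - 1\<bar> \<le> centered_norm n y"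
  by (induction n) (auto simp: less_Suc_eq le_max_iff_disj)

lemma centered_norm_attained: "centered_norm n y = 0 \<or> (\<exists>i<n. centered_norm n y = \<bar>2 * y i - 1\<bar>)"
  by (induction n) (auto simp: less_Suc_eq max_def)

lemma centered_norm_le: "(\<And>i. i < n \<Longrightarrow> 0 \<le> y i \<and> y i \<le> 1) \<Longrightarrow> centered_norm n y \<le> 1"
  by (induction n) (auto simp: abs_le_iff)

lemma continuous_map_centered_norm:
  "n \<le> m \<Longrightarrow> continuous_map (cube m) euclideanreal (centered_norm n)"
proof (induction n)
  case (Suc n)
  have "continuous_map (cube m) euclideanreal (\<lambda>y. max (centered_norm n y) \<bar>2 * y n - 1\<bar>)"
    using Suc by (intro continuous_intros) auto
  then show ?case by simp
next
  case 0
  have "centered_norm 0 = (\<lambda>_. 0)" by auto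
  then show ?case by simp
qed

text \<open>Seen from the point at height 2 above the center, the ray through \<open>y\<close> meets
  a side after division by \<open>centered_norm n y\<close> and the bottom after division by
  \<open>1 - y n / 2\<close>. The larger divisor belongs to the first exit.\<close>

definition box_scale :: "nat \<Rightarrow> (nat \<Rightarrow> real) \<Rightarrow> real" where
  "box_scale n y = max (centered_norm n y) (1 - y n / 2)"

text \<open>Radial projection from the point at height 2 above the center of the cube.\<close>

definition box_retraction :: "nat \<Rightarrow> (nat \<Rightarrow> real) \<Rightarrow> nat \<Rightarrow> real" where
  "box_retraction n y = (\<lambda>i\<in>{..n}.
     if i = n then 2 - (2 - y n) / box_scale n y else (1 + (2 * y i - 1) / box_scale n y) / 2)"

lemma box_scale_bounds:
  assumes y: "y \<in> topspace (cube (Suc n))"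
  shows "1 / 2 \<le> box_scale n y" "box_scale n y \<le> 1"
proof -
  have "0 \<le> y n" "y n \<le> 1" using y by (auto simp: in_topspace_cube)
  moreover have "centered_norm n y \<le> 1"
    using y by (intro centered_norm_le) (simp add: in_topspace_cube)
  ultimately show "1 / 2 \<le> box_scale n y" "box_scale n y \<le> 1" by (auto simp: box_scale_def max_def)
qed

lemma box_retraction_in_box:
  assumes y: "y \<in> topspace (cube (Suc n))"
  shows "box_retraction n y \<in> cube_box n"
proof -
  let ?l = "box_scale n y" and ?r = "box_retraction n y"
  have l: "0 < ?l" "?l \<le> 1" using box_scale_bounds[OF y] by auto
  have yn: "0 \<le> y n" "y n \<le> 1" using y by (auto simp: in_topspace_cube)
  have "?r \<in> topspace (cube (Suc n))"
    unfolding in_topspace_cube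
  proof (intro conjI allI impI)
    fix i assume i: "i < Suc n"
    have "\<bar>2 * y i - 1\<bar> \<le> ?l" if "i < n"
      using centered_norm_ge[OF that, of y] by (auto simp: box_scale_def)
    then have "\<bar>(2 * y i - 1) / ?l\<bar> \<le> 1" if "i < n"
      using that l by (simp add: abs_divide)
    then have "- 1 \<le> (2 * y i - 1) / ?l" "(2 * y i - 1) / ?l \<le> 1" if "i < n"
      using that unfolding abs_le_iff by auto
    moreover have "1 - y n / 2 \<le> ?l" by (simp add: box_scale_def)
    then have "(2 - y n) / ?l \<le> 2" "1 \<le> (2 - y n) / ?l" using l yn by (auto simp: divide_simps)
    ultimately show "0 \<le> ?r i" "?r i \<le> 1"
      using i by (auto simp: box_retraction_def less_Suc_eq)
  qed (simp add: box_retraction_def)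
  \<comment> \<open>According to which term attains the maximum, the point lands on the bottom or on
    the side of a coordinate that attains \<open>centered_norm\<close>.\<close>
  moreover have "?r n = 0 \<or> (\<exists>i<n. ?r i = 0 \<or> ?r i = 1)"
  proof (cases "?l = 1 - y n / 2")
    case True
    then have "2 - y n = 2 * ?l" by simp
    then have "(2 - y n) / ?l = 2" using l by (simp add: nonzero_divide_eq_eq)
    then show ?thesis by (simp add: box_retraction_def)
  next
    case False
    then have c: "?l = centered_norm n y" by (auto simp: box_scale_def max_def split: if_splits)
    with l centered_norm_attained[of n y] obtain i where i: "i < n" "?l = \<bar>2 * y i - 1\<bar>" by auto
    then have "2 * y i - 1 = ?l \<or> 2 * y i - 1 = - ?l" by linarith
    then have "(2 * y i - 1) / ?l = 1 \<or> (2 * y i - 1) / ?l = -1" using l by auto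
    then show ?thesis using i by (auto simp: box_retraction_def intro!: exI[of _ i])
  qed
  ultimately show ?thesis by (auto simp: cube_box_def restrict_in_boundary_iff)
qed

lemma box_retraction_id:
  assumes "y \<in> cube_box n"
  shows "box_retraction n y = y"
proof -
  have y: "y \<in> topspace (cube (Suc n))" and "y n = 0 \<or> (\<exists>i<n. y i = 0 \<or> y i = 1)"
    using assms by (auto simp: cube_box_def restrict_in_boundary_iff)
  then have "1 \<le> box_scale n y"
    using centered_norm_ge[of _ n y] by (fastforce simp: box_scale_def le_max_iff_disj)
  then have "box_scale n y = 1" using box_scale_bounds[OF y] by simp
  then show ?thesis
    using y by (auto simp: box_retraction_def in_topspace_cube fun_eq_iff)
qed

lemma continuous_map_box_retraction: "continuous_map (cube (Suc n)) (cube (Suc n)) (box_retraction n)"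
  unfolding continuous_map_into_cube
proof (intro conjI allI impI)
  show "box_retraction n \<in> topspace (cube (Suc n)) \<rightarrow> topspace (cube (Suc n))"
    using box_retraction_in_box by (auto simp: cube_box_def)
  fix i assume i: "i < Suc n"
  have nz: "box_scale n y \<noteq> 0" if "y \<in> topspace (cube (Suc n))" for y
    using box_scale_bounds[OF that] by auto
  have "continuous_map (cube (Suc n)) euclideanreal (\<lambda>y. max (centered_norm n y) (1 - y n / 2))"
    by (intro continuous_intros continuous_map_centered_norm) auto
  then have scale: "continuous_map (cube (Suc n)) euclideanreal (box_scale n)"
    by (rule continuous_map_eq) (simp add: box_scale_def)
  show "continuous_map (cube (Suc n)) euclideanreal (\<lambda>y. box_retraction n y i)"
  proof (cases "i = n")
    case True
    have "continuous_map (cube (Suc n)) euclideanreal (\<lambda>y. 2 - (2 - y n) / box_scale n y)"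
      by (intro continuous_intros scale nz) auto
    then show ?thesis using True by (simp add: box_retraction_def)
  next
    case False
    have "continuous_map (cube (Suc n)) euclideanreal (\<lambda>y. (1 + (2 * y i - 1) / box_scale n y) / 2)"
      using i by (intro continuous_intros scale nz) auto
    then show ?thesis using False i by (simp add: box_retraction_def)
  qed
qed

text \<open>The lift at \<open>x\<close> is read off at the time \<open>u x\<close> at which the path from \<open>r x\<close> to \<open>x\<close>, whose
  coordinates move with unit speed and then stop, has arrived.\<close>

lemma h_fibration_lift_retract:
  fixes Y X :: "'v topology"
  assumes univ: "universe TYPE('v)" and hfib: "h_fibration Y X p"
    and r: "continuous_map (cube m) (cube m) r" "\<And>x. x \<in> topspace (cube m) \<Longrightarrow> r x \<in> A" "\<And>x. x \<in> A \<Longrightarrow> r x = x"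
    and A: "A \<subseteq> topspace (cube m)"
    and k: "continuous_map (subtopology (cube m) A) Y k" and w: "continuous_map (cube m) X w"
    and kw: "\<And>x. x \<in> A \<Longrightarrow> p (k x) = w x"
  obtains h where "continuous_map (cube m) Y h" "\<And>x. x \<in> A \<Longrightarrow> h x = k x"
    "\<And>x. x \<in> topspace (cube m) \<Longrightarrow> p (h x) = w x"
proof -
  define D where "D = (\<lambda>(x, t). \<lambda>i\<in>{..<m}. r x i + max (- t) (min t (x i - r x i)))"
  \<comment> \<open>At time \<open>u x\<close> every coordinate has arrived, since the sum dominates
    each difference. Where \<open>r x = x\<close> the time is 0, so on \<open>A\<close> the lift is
    still its initial value \<open>k x\<close>.\<close>
  define u where "u = (\<lambda>x. min 1 (\<Sum>i<m. \<bar>x i - r x i\<bar>))"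
  have r_i: "continuous_map (cube m) euclideanreal (\<lambda>x. r x i)" if "i < m" for i
    using r(1) that by (simp add: continuous_map_into_cube)
  have rc: "r x \<in> topspace (cube m)" if "x \<in> topspace (cube m)" for x using r(2) A that by blast
  have D: "continuous_map (delta_prod (cube m) unit_interval) (cube m) D"
    unfolding continuous_map_into_cube
  proof (intro conjI allI impI)
    have "0 \<le> r x i + max (- t) (min t (x i - r x i)) \<and> r x i + max (- t) (min t (x i - r x i)) \<le> 1"
      if "x \<in> topspace (cube m)" "i < m" "0 \<le> t" for x i t
      using that rc[OF that(1)] by (auto simp: in_topspace_cube max_def min_def)
    then show "D \<in> topspace (delta_prod (cube m) unit_interval) \<rightarrow> topspace (cube m)"
      by (auto simp: D_def in_topspace_cube)
    fix i assume i: "i < m"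
    have x: "continuous_map (delta_prod (cube m) unit_interval) euclideanreal (\<lambda>z. fst z i)"
      "continuous_map (delta_prod (cube m) unit_interval) euclideanreal (\<lambda>z. r (fst z) i)"
      using continuous_map_compose[OF continuous_map_delta_prod_fst continuous_map_cube_coordinate[OF i]]
        continuous_map_compose[OF continuous_map_delta_prod_fst r_i[OF i]] by (simp_all add: o_def)
    have t: "continuous_map (delta_prod (cube m) unit_interval) euclideanreal snd"
      using continuous_map_delta_prod_snd continuous_map_into_fulltopology by blast
    have "continuous_map (delta_prod (cube m) unit_interval) euclideanreal
        (\<lambda>z. r (fst z) i + max (- snd z) (min (snd z) (fst z i - r (fst z) i)))"
      by (intro continuous_intros x t)
    then show "continuous_map (delta_prod (cube m) unit_interval) euclideanreal (\<lambda>z. D z i)"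
      using i by (simp add: D_def case_prod_unfold)
  qed
  have kr: "continuous_map (cube m) Y (k \<circ> r)"
    by (rule continuous_map_compose[OF _ k]) (use r in \<open>auto simp: continuous_map_in_subtopology\<close>)
  have D0: "D (x, 0) = r x" if "x \<in> topspace (cube m)" for x
    using rc[OF that] by (auto simp: D_def in_topspace_cube fun_eq_iff)
  obtain H where H: "continuous_map (delta_prod (cube m) unit_interval) Y H"
    "\<And>x. x \<in> topspace (cube m) \<Longrightarrow> H (x, 0) = (k \<circ> r) x"
    "\<And>x t. x \<in> topspace (cube m) \<Longrightarrow> t \<in> {0..1} \<Longrightarrow> p (H (x, t)) = (w \<circ> D) (x, t)"
    by (rule h_fibration_lifting[OF univ hfib delta_generated_cube kr continuous_map_compose[OF D w]])
      (use D0 kw r in auto)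
  have uc: "continuous_map (cube m) euclideanreal u"
    unfolding u_def by (intro continuous_intros) (auto intro: r_i)
  have u01: "u x \<in> {0..1}" for x by (auto simp: u_def sum_nonneg)
  have uI: "continuous_map (cube m) unit_interval u"
    using uc u01 by (auto simp: continuous_map_in_subtopology)
  have Du: "D (x, u x) = x" if x: "x \<in> topspace (cube m)" for x
  proof
    fix i
    show "D (x, u x) i = x i"
    proof (cases "i < m")
      case True
      have "\<bar>x i - r x i\<bar> \<le> (\<Sum>j<m. \<bar>x j - r x j\<bar>)"
        using True by (intro member_le_sum) auto
      moreover have "\<bar>x i - r x i\<bar> \<le> 1"
        using x rc[OF x] True by (auto simp: in_topspace_cube abs_le_iff) (smt (verit))+
      ultimately have "\<bar>x i - r x i\<bar> \<le> u x" by (simp add: u_def)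
      then show ?thesis using True by (auto simp: D_def)
    next
      case False
      then show ?thesis using x by (simp add: D_def in_topspace_cube)
    qed
  qed
  show ?thesis
  proof (rule that)
    show "continuous_map (cube m) Y (H \<circ> (\<lambda>x. (x, u x)))"
      by (intro continuous_map_compose[OF _ H(1)] continuous_map_into_delta_prod delta_generated_cube uI) simp
    show "(H \<circ> (\<lambda>x. (x, u x))) x = k x" if "x \<in> A" for x
      using that r A H(2)[of x] by (auto simp: u_def)
    show "p ((H \<circ> (\<lambda>x. (x, u x))) x) = w x" if "x \<in> topspace (cube m)" for x
      using H(3)[OF that u01] Du[OF that] by simp
  qed
qed

abbreviation boundary_space :: "nat \<Rightarrow> (nat \<Rightarrow> real) topology" where
  "boundary_space n \<equiv> subtopology (cube n) (cube_boundary n)"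

lemma topspace_boundary_space: "topspace (boundary_space n) = cube_boundary n"
  by (auto simp: cube_boundary_def)

lemma glue_on_box:
  assumes f: "continuous_map (cube n) Y f"
    and \<phi>: "continuous_map (cylinder (boundary_space n)) Y \<phi>"
    and eq: "\<And>x. x \<in> cube_boundary n \<Longrightarrow> \<phi> (x, 0) = f x"
  shows "continuous_map (subtopology (cube (Suc n)) (cube_box n)) Y
    (\<lambda>y. if y n = 0 then f (restrict y {..<n}) else \<phi> (restrict y {..<n}, y n))"
proof -
  let ?X = "subtopology (cube (Suc n)) (cube_box n)"
  let ?A = "{y \<in> topspace ?X. y n = 0}" and ?B = "{y \<in> topspace ?X. restrict y {..<n} \<in> cube_boundary n}"
  have rest: "continuous_map (subtopology ?X C) (cube n) (\<lambda>y. restrict y {..<n})" for C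
    by (simp add: continuous_map_from_subtopology continuous_map_init)
  have last: "continuous_map (subtopology ?X C) unit_interval (\<lambda>y. y n)" for C
    by (simp add: continuous_map_from_subtopology continuous_map_last)
  have "continuous_map ?X Y (\<lambda>y. if y \<in> ?A then f (restrict y {..<n}) else \<phi> (restrict y {..<n}, y n))"
  proof (rule continuous_map_two_closed)
    show "closedin ?X ?A"
      by (intro closedin_level_set continuous_map_from_subtopology continuous_map_cube_coordinate) simp
    have "continuous_map ?X (cube n) (\<lambda>y. restrict y {..<n})" using rest[of UNIV] by simp
    from closedin_continuous_map_preimage[OF this closedin_cube_boundary] show "closedin ?X ?B" .
    show "topspace ?X \<subseteq> ?A \<union> ?B" by (auto simp: cube_box_def)
    show "continuous_map (subtopology ?X ?A) Y (\<lambda>y. f (restrict y {..<n}))"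
      using continuous_map_compose[OF rest f] by (simp add: o_def)
    have "continuous_map (subtopology ?X ?B) (boundary_space n) (\<lambda>y. restrict y {..<n})"
      using rest by (auto simp: continuous_map_in_subtopology)
    from continuous_map_compose[OF continuous_map_pairedI[OF this last] \<phi>]
    show "continuous_map (subtopology ?X ?B) Y (\<lambda>y. \<phi> (restrict y {..<n}, y n))" by (simp add: o_def)
    show "f (restrict y {..<n}) = \<phi> (restrict y {..<n}, y n)" if "y \<in> ?A" "y \<in> ?B" for y
      using that eq by auto
  qed
  then show ?thesis by (rule continuous_map_eq) auto
qed

text \<open>Start and sides form a map on the open box; composition with
  \<open>box_retraction\<close> extends it over the whole cylinder.\<close>

lemma cube_homotopy_extension:
  assumes f: "continuous_map (cube n) Y f"
    and \<phi>: "continuous_map (cylinder (boundary_space n)) Y \<phi>"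
    and eq: "\<And>x. x \<in> cube_boundary n \<Longrightarrow> \<phi> (x, 0) = f x"
  obtains F where "continuous_map (cylinder (cube n)) Y F"
    "\<And>x. x \<in> topspace (cube n) \<Longrightarrow> F (x, 0) = f x"
    "\<And>x t. x \<in> cube_boundary n \<Longrightarrow> t \<in> {0..1} \<Longrightarrow> F (x, t) = \<phi> (x, t)"
proof -
  let ?k = "\<lambda>y. if y n = 0 then f (restrict y {..<n}) else \<phi> (restrict y {..<n}, y n)"
  define F where "F = (\<lambda>(x, t). ?k (box_retraction n (x(n := t))))"
  have "continuous_map (cube (Suc n)) (subtopology (cube (Suc n)) (cube_box n)) (box_retraction n)"
    using continuous_map_box_retraction box_retraction_in_box by (auto simp: continuous_map_in_subtopology)
  from continuous_map_compose[OF continuous_map_compose[OF continuous_map_snoc this] glue_on_box[OF f \<phi> eq]]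
  have c: "continuous_map (cylinder (cube n)) Y F"
    by (simp add: F_def o_def case_prod_unfold)
  show ?thesis
  proof (rule that[OF c])
    fix x assume x: "x \<in> topspace (cube n)"
    then show "F (x, 0) = f x"
      using unsnoc_snoc[OF x] by (simp add: F_def box_retraction_id snoc_bottom_in_box del: restrict_fupd)
  next
    fix x :: "nat \<Rightarrow> real" and t :: real
    assume x: "x \<in> cube_boundary n" and t: "t \<in> {0..1}"
    have x': "x \<in> topspace (cube n)" using x cube_boundary_subset by blast
    from box_retraction_id[OF snoc_side_in_box[OF x t]] show "F (x, t) = \<phi> (x, t)"
      using unsnoc_snoc[OF x'] eq x by (cases "t = 0") (simp_all add: F_def del: restrict_fupd)
  qed
qed

section \<open>Boundary lifting problems and their deformation\<close>

definition boundary_lift :: "'a topology \<Rightarrow> 'b topology \<Rightarrow> ('a \<Rightarrow> 'b) \<Rightarrow> nat \<Rightarrow>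
    ((nat \<Rightarrow> real) \<Rightarrow> 'a) \<Rightarrow> ((nat \<Rightarrow> real) \<Rightarrow> 'b) \<Rightarrow> bool" where
  "boundary_lift Y X p n a w \<longleftrightarrow> (\<exists>h. continuous_map (cube n) Y h \<and>
     (\<forall>x \<in> cube_boundary n. h x = a x) \<and> (\<forall>x \<in> topspace (cube n). p (h x) = w x))"

text \<open>With time reversed, the lift at time 1 becomes the bottom of an open box and
  \<open>\<alpha>\<close> its sides. The box is a retract of the cube, so the fibration lifts
  \<open>W\<close> relative to it, and the lid is the lift wanted at time 0.\<close>

lemma boundary_lift_homotopy:
  fixes Y X :: "'v topology"
  assumes univ: "universe TYPE('v)" and hfib: "h_fibration Y X p"
    and W: "continuous_map (cylinder (cube n)) X W"
    and \<alpha>: "continuous_map (cylinder (boundary_space n)) Y \<alpha>"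
    and eq: "\<And>x t. x \<in> cube_boundary n \<Longrightarrow> t \<in> {0..1} \<Longrightarrow> p (\<alpha> (x, t)) = W (x, t)"
    and lift: "boundary_lift Y X p n (\<lambda>x. \<alpha> (x, 1)) (\<lambda>x. W (x, 1))"
  shows "boundary_lift Y X p n (\<lambda>x. \<alpha> (x, 0)) (\<lambda>x. W (x, 0))"
proof -
  from lift obtain h where h: "continuous_map (cube n) Y h"
    "\<And>x. x \<in> cube_boundary n \<Longrightarrow> h x = \<alpha> (x, 1)" "\<And>x. x \<in> topspace (cube n) \<Longrightarrow> p (h x) = W (x, 1)"
    unfolding boundary_lift_def by blast
  have flip': "continuous_map (cylinder Z) (cylinder Z) (\<lambda>(x, t). (x, 1 - t))" for Z :: "'z topology"
    using continuous_map_compose[OF continuous_map_snd continuous_map_flip]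
    by (auto simp: case_prod_unfold o_def intro!: continuous_map_pairedI continuous_map_fst)
  have \<phi>: "continuous_map (cylinder (boundary_space n)) Y (\<alpha> \<circ> (\<lambda>(x, t). (x, 1 - t)))"
    by (rule continuous_map_compose[OF flip' \<alpha>])
  have w: "continuous_map (cube (Suc n)) X (\<lambda>y. W (restrict y {..<n}, 1 - y n))"
    using continuous_map_compose[OF flip' W] by (simp add: continuous_map_cube_interval o_def)
  let ?k = "\<lambda>y. if y n = 0 then h (restrict y {..<n}) else (\<alpha> \<circ> (\<lambda>(x, t). (x, 1 - t))) (restrict y {..<n}, y n)"
  have k: "continuous_map (subtopology (cube (Suc n)) (cube_box n)) Y ?k"
    by (rule glue_on_box[OF h(1) \<phi>]) (simp add: h(2))
  have box: "cube_box n \<subseteq> topspace (cube (Suc n))" by (auto simp: cube_box_def)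
  have kw: "p (?k y) = W (restrict y {..<n}, 1 - y n)" if y: "y \<in> cube_box n" for y
  proof (cases "y n = 0")
    case True
    then show ?thesis using h(3)[OF restrict_in_cube] y box by auto
  next
    case False
    then have "restrict y {..<n} \<in> cube_boundary n" using y by (simp add: cube_box_def)
    moreover have "0 \<le> y n" "y n \<le> 1" using y box by (auto simp: in_topspace_cube)
    ultimately show ?thesis using False eq by simp
  qed
  obtain H where H: "continuous_map (cube (Suc n)) Y H" "\<And>y. y \<in> cube_box n \<Longrightarrow> H y = ?k y"
    "\<And>y. y \<in> topspace (cube (Suc n)) \<Longrightarrow> p (H y) = W (restrict y {..<n}, 1 - y n)"
    by (rule h_fibration_lift_retract[OF univ hfib continuous_map_box_retraction box_retraction_in_box
          box_retraction_id box k w kw]) blast+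
  have c: "continuous_map (cube n) Y (\<lambda>x. H (x(n := 1)))"
    using continuous_map_compose[OF continuous_map_snoc_const[of 1] H(1)] by (simp add: o_def)
  show ?thesis
    unfolding boundary_lift_def
  proof (intro exI conjI ballI)
    show "continuous_map (cube n) Y (\<lambda>x. H (x(n := 1)))" by (rule c)
    fix x assume x: "x \<in> topspace (cube n)"
    show "p (H (x(n := 1))) = W (x, 0)"
      using H(3)[OF snoc_in_cube[OF x]] unsnoc_snoc[OF x] by (simp del: restrict_fupd)
  next
    fix x assume x: "x \<in> cube_boundary n"
    then have x': "x \<in> topspace (cube n)" using cube_boundary_subset by blast
    show "H (x(n := 1)) = \<alpha> (x, 0)"
      using H(2)[OF snoc_side_in_box[OF x, of 1]] unsnoc_snoc[OF x'] by (simp del: restrict_fupd)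
  qed
qed

definition boundary_lifts :: "'a topology \<Rightarrow> 'b topology \<Rightarrow> ('a \<Rightarrow> 'b) \<Rightarrow> nat \<Rightarrow> ((nat \<Rightarrow> real) \<Rightarrow> 'a) \<Rightarrow> bool" where
  "boundary_lifts Y X p n a \<longleftrightarrow> (\<forall>w. continuous_map (cube n) X w \<longrightarrow>
     (\<forall>x \<in> cube_boundary n. p (a x) = w x) \<longrightarrow> boundary_lift Y X p n a w)"

text \<open>Only the boundary map is deformed. The cube \<open>w\<close> in \<open>X\<close> follows
  by homotopy extension along \<open>p \<circ> \<alpha>\<close>, which turns a lifting problem at
  time 0 into one at time 1.\<close>

lemma boundary_lifts_homotopy:
  fixes Y X :: "'v topology"
  assumes univ: "universe TYPE('v)" and hfib: "h_fibration Y X p"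
    and \<alpha>: "continuous_map (cylinder (boundary_space n)) Y \<alpha>"
    and lifts: "boundary_lifts Y X p n (\<lambda>x. \<alpha> (x, 1))"
  shows "boundary_lifts Y X p n (\<lambda>x. \<alpha> (x, 0))"
  unfolding boundary_lifts_def
proof (intro allI impI)
  fix w assume w: "continuous_map (cube n) X w" and eq: "\<forall>x \<in> cube_boundary n. p (\<alpha> (x, 0)) = w x"
  have p: "continuous_map Y X p" using hfib by (simp add: h_fibration_def)
  obtain W where W: "continuous_map (cylinder (cube n)) X W"
    "\<And>x. x \<in> topspace (cube n) \<Longrightarrow> W (x, 0) = w x"
    "\<And>x t. x \<in> cube_boundary n \<Longrightarrow> t \<in> {0..1} \<Longrightarrow> W (x, t) = (p \<circ> \<alpha>) (x, t)"
    by (rule cube_homotopy_extension[OF w continuous_map_compose[OF \<alpha> p]]) (use eq in auto)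
  have "continuous_map (cube n) X (W \<circ> (\<lambda>x. (x, 1)))"
    by (intro continuous_map_compose[OF _ W(1)] continuous_map_pairedI) auto
  then have "boundary_lift Y X p n (\<lambda>x. \<alpha> (x, 1)) (\<lambda>x. W (x, 1))"
    using lifts W(3) unfolding boundary_lifts_def by (auto simp: o_def)
  from boundary_lift_homotopy[OF univ hfib W(1) \<alpha> _ this] W(3)
  have "boundary_lift Y X p n (\<lambda>x. \<alpha> (x, 0)) (\<lambda>x. W (x, 0))" by simp
  then show "boundary_lift Y X p n (\<lambda>x. \<alpha> (x, 0)) w"
    using W(2) unfolding boundary_lift_def by simp
qed


section \<open>Homotopy classes of cube maps\<close>

lemma cube_homotopy_refl: "g \<in> cube_maps n X x \<Longrightarrow> (g, g) \<in> cube_homotopy n X x"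
  by (simp add: cube_homotopy_def cube_maps_def)

lemma cube_homotopy_sym: "(g, h) \<in> cube_homotopy n X x \<Longrightarrow> (h, g) \<in> cube_homotopy n X x"
  by (simp add: cube_homotopy_def homotopic_with_sym)

lemma cube_homotopy_trans:
  "(f, g) \<in> cube_homotopy n X x \<Longrightarrow> (g, h) \<in> cube_homotopy n X x \<Longrightarrow> (f, h) \<in> cube_homotopy n X x"
  unfolding cube_homotopy_def using homotopic_with_trans by fastforce

lemma cube_homotopy_iff:
  "(f, g) \<in> cube_homotopy n X x \<longleftrightarrow>
     (\<exists>h. continuous_map (prod_topology unit_interval (cube n)) X h \<and>
       (\<forall>y \<in> topspace (cube n). h (0, y) = f y) \<and> (\<forall>y \<in> topspace (cube n). h (1, y) = g y) \<and>
       (\<forall>t \<in> {0..1}. \<forall>y \<in> cube_boundary n. h (t, y) = x))"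
proof -
  have "h ` cube_boundary n \<subseteq> {x} \<longleftrightarrow> k ` cube_boundary n \<subseteq> {x}"
    if "\<And>y. y \<in> topspace (cube n) \<Longrightarrow> h y = k y" for h k
    using that cube_boundary_subset[of n] by (force simp: image_subset_iff)
  from homotopic_with[where P = "\<lambda>k. k ` cube_boundary n \<subseteq> {x}", OF this]
  show ?thesis by (simp add: cube_homotopy_def image_subset_iff)
qed

lemma cube_homotopy_compose:
  assumes "(g, h) \<in> cube_homotopy n Y y" "continuous_map Y X p"
  shows "(p \<circ> g, p \<circ> h) \<in> cube_homotopy n X (p y)"
proof -
  from assms(1) obtain k where k: "continuous_map (prod_topology unit_interval (cube n)) Y k"
    "\<forall>y \<in> topspace (cube n). k (0, y) = g y" "\<forall>y \<in> topspace (cube n). k (1, y) = h y"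
    "\<forall>t \<in> {0..1}. \<forall>z \<in> cube_boundary n. k (t, z) = y" unfolding cube_homotopy_iff by blast
  then show ?thesis
    unfolding cube_homotopy_iff
    by (intro exI[of _ "p \<circ> k"]) (auto intro: continuous_map_compose[OF _ assms(2)])
qed

lemma cube_maps_compose:
  "g \<in> cube_maps n Y y \<Longrightarrow> continuous_map Y X p \<Longrightarrow> p \<circ> g \<in> cube_maps n X (p y)"
  by (auto simp: cube_maps_def intro: continuous_map_compose)

text \<open>\<open>induced_on_classes\<close> collects everything homotopic to an image of a member
  of the class; transitivity reduces this to the image of one representative.\<close>

lemma induced_on_class:
  assumes "g \<in> cube_maps n Y y" "continuous_map Y X p"
  shows "induced_on_classes n X p y (cube_homotopy n Y y `` {g}) = cube_homotopy n X (p y) `` {p \<circ> g}"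
proof
  show "induced_on_classes n X p y (cube_homotopy n Y y `` {g}) \<subseteq> cube_homotopy n X (p y) `` {p \<circ> g}"
    unfolding induced_on_classes_def
  proof
    fix k assume "k \<in> cube_homotopy n X (p y) `` ((\<circ>) p ` (cube_homotopy n Y y `` {g}))"
    then obtain h where "(g, h) \<in> cube_homotopy n Y y" "(p \<circ> h, k) \<in> cube_homotopy n X (p y)" by blast
    then have "(p \<circ> g, k) \<in> cube_homotopy n X (p y)"
      by (rule cube_homotopy_trans[OF cube_homotopy_compose[OF _ assms(2)]])
    then show "k \<in> cube_homotopy n X (p y) `` {p \<circ> g}" by blast
  qed
  show "cube_homotopy n X (p y) `` {p \<circ> g} \<subseteq> induced_on_classes n X p y (cube_homotopy n Y y `` {g})"
    unfolding induced_on_classes_def using cube_homotopy_refl[OF assms(1)] by blast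
qed

lemma cube_homotopy_class_eq_iff:
  assumes "h \<in> cube_maps n X x"
  shows "cube_homotopy n X x `` {g} = cube_homotopy n X x `` {h} \<longleftrightarrow> (g, h) \<in> cube_homotopy n X x"
proof
  assume "cube_homotopy n X x `` {g} = cube_homotopy n X x `` {h}"
  then show "(g, h) \<in> cube_homotopy n X x" using cube_homotopy_refl[OF assms] by blast
next
  assume gh: "(g, h) \<in> cube_homotopy n X x"
  have "(g, k) \<in> cube_homotopy n X x \<longleftrightarrow> (h, k) \<in> cube_homotopy n X x" for k
    using cube_homotopy_trans[OF gh] cube_homotopy_trans[OF cube_homotopy_sym[OF gh]] by metis
  then show "cube_homotopy n X x `` {g} = cube_homotopy n X x `` {h}" by auto
qed

lemma weak_homotopy_equivalence_surj:
  assumes whe: "weak_homotopy_equivalence Y X p" and y: "n = 0 \<or> y \<in> topspace Y"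
    and D: "D \<in> cube_maps n X (p y)"
  obtains l where "l \<in> cube_maps n Y y" "(D, p \<circ> l) \<in> cube_homotopy n X (p y)"
proof -
  have p: "continuous_map Y X p" and bij: "bij_betw (induced_on_classes n X p y) (homotopy_classes n Y y) (homotopy_classes n X (p y))"
    using whe y unfolding weak_homotopy_equivalence_def by auto
  have "cube_homotopy n X (p y) `` {D} \<in> homotopy_classes n X (p y)"
    using D by (auto simp: homotopy_classes_def quotient_def)
  then obtain C where C: "C \<in> homotopy_classes n Y y"
    "induced_on_classes n X p y C = cube_homotopy n X (p y) `` {D}"
    using bij by (metis bij_betw_imp_surj_on imageE)
  then obtain l where l: "l \<in> cube_maps n Y y" "C = cube_homotopy n Y y `` {l}"
    by (auto simp: homotopy_classes_def quotient_def)
  then have "cube_homotopy n X (p y) `` {D} = cube_homotopy n X (p y) `` {p \<circ> l}"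
    using C(2) induced_on_class[OF l(1) p] by simp
  then show ?thesis
    using that[OF l(1)] cube_homotopy_class_eq_iff[OF cube_maps_compose[OF l(1) p]] by blast
qed

lemma weak_homotopy_equivalence_inj:
  assumes whe: "weak_homotopy_equivalence Y X p" and y: "n = 0 \<or> y \<in> topspace Y"
    and g: "g \<in> cube_maps n Y y" "h \<in> cube_maps n Y y" "(p \<circ> g, p \<circ> h) \<in> cube_homotopy n X (p y)"
  shows "(g, h) \<in> cube_homotopy n Y y"
proof -
  have p: "continuous_map Y X p" and bij: "bij_betw (induced_on_classes n X p y) (homotopy_classes n Y y) (homotopy_classes n X (p y))"
    using whe y unfolding weak_homotopy_equivalence_def by auto
  have "cube_homotopy n Y y `` {g} \<in> homotopy_classes n Y y" "cube_homotopy n Y y `` {h} \<in> homotopy_classes n Y y"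
    using g by (auto simp: homotopy_classes_def quotient_def)
  moreover have "induced_on_classes n X p y (cube_homotopy n Y y `` {g}) =
      induced_on_classes n X p y (cube_homotopy n Y y `` {h})"
    using g(3) cube_homotopy_class_eq_iff[OF cube_maps_compose[OF g(2) p]]
    by (simp add: induced_on_class[OF g(1) p] induced_on_class[OF g(2) p])
  ultimately have "cube_homotopy n Y y `` {g} = cube_homotopy n Y y `` {h}"
    using bij by (meson bij_betw_imp_inj_on inj_onD)
  then show ?thesis by (simp add: cube_homotopy_class_eq_iff[OF g(2)])
qed

section \<open>Lifting against boundaries and weak equivalences\<close>

lemma continuous_map_boundary_const:
  assumes "n = 0 \<or> y \<in> topspace Y"
  shows "continuous_map (boundary_space n) Y (\<lambda>_. y)"
    and "continuous_map (cylinder (boundary_space n)) Y (\<lambda>_. y)"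
proof -
  \<comment> \<open>A 0-cube has empty boundary, so in dimension 0 the value \<open>y\<close> may
    lie outside \<open>Y\<close>; this matches the base point convention of weak
    equivalences.\<close>
  have "topspace (boundary_space 0) = {}" by (auto simp: cube_boundary_def)
  then have "boundary_space 0 = trivial_topology" by (simp only: null_topspace_iff_trivial)
  then show "continuous_map (boundary_space n) Y (\<lambda>_. y)"
    "continuous_map (cylinder (boundary_space n)) Y (\<lambda>_. y)"
    using assms by auto
qed

text \<open>Surjectivity on homotopy classes makes \<open>w\<close> homotopic, relative to the
  boundary, to some \<open>p \<circ> l\<close>; deforming backwards replaces \<open>l\<close> by a
  strict lift of \<open>w\<close>.\<close>

lemma boundary_lifts_constant:
  fixes Y X :: "'v topology"
  assumes univ: "universe TYPE('v)" and hfib: "h_fibration Y X p"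
    and whe: "weak_homotopy_equivalence Y X p" and y: "n = 0 \<or> y \<in> topspace Y"
  shows "boundary_lifts Y X p n (\<lambda>_. y)"
  unfolding boundary_lifts_def
proof (intro allI impI)
  fix w assume w: "continuous_map (cube n) X w" and eq: "\<forall>x \<in> cube_boundary n. p y = w x"
  have "w \<in> cube_maps n X (p y)" using w eq by (auto simp: cube_maps_def)
  then obtain l where l: "l \<in> cube_maps n Y y" and hom: "(w, p \<circ> l) \<in> cube_homotopy n X (p y)"
    by (rule weak_homotopy_equivalence_surj[OF whe y])
  from hom obtain k where k: "continuous_map (prod_topology unit_interval (cube n)) X k"
    "\<forall>x \<in> topspace (cube n). k (0, x) = w x" "\<forall>x \<in> topspace (cube n). k (1, x) = p (l x)"
    "\<forall>t \<in> {0..1}. \<forall>x \<in> cube_boundary n. k (t, x) = p y" unfolding cube_homotopy_iff by auto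
  have W: "continuous_map (cylinder (cube n)) X (k \<circ> (\<lambda>(x, t). (t, x)))"
    by (rule continuous_map_compose[OF continuous_map_swap k(1)])
  have \<alpha>: "continuous_map (cylinder (boundary_space n)) Y (\<lambda>_. y)"
    by (rule continuous_map_boundary_const[OF y])
  have "boundary_lift Y X p n (\<lambda>_. y) (\<lambda>x. (k \<circ> (\<lambda>(x, t). (t, x))) (x, 1))"
    using l k(3) by (auto simp: boundary_lift_def cube_maps_def intro!: exI[of _ l])
  from boundary_lift_homotopy[OF univ hfib W \<alpha> _ this] k(4)
  have "boundary_lift Y X p n (\<lambda>_. y) (\<lambda>x. k (0, x))" by simp
  then show "boundary_lift Y X p n (\<lambda>_. y) w" using k(2) by (simp add: boundary_lift_def)
qed

lemma cube_box_subset: "cube_box n \<subseteq> cube_boundary (Suc n)"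
  by (auto simp: cube_boundary_Suc)

lemma closedin_cube_box: "closedin (cube (Suc n)) (cube_box n)"
proof -
  from closedin_continuous_map_preimage[OF continuous_map_init closedin_cube_boundary]
  have "closedin (cube (Suc n)) ({y \<in> topspace (cube (Suc n)). y n = 0} \<union>
      {y \<in> topspace (cube (Suc n)). restrict y {..<n} \<in> cube_boundary n})"
    by (intro closedin_Un closedin_level_set continuous_map_cube_coordinate) auto
  also have "{y \<in> topspace (cube (Suc n)). y n = 0} \<union>
      {y \<in> topspace (cube (Suc n)). restrict y {..<n} \<in> cube_boundary n} = cube_box n"
    by (auto simp: cube_box_def)
  finally show ?thesis .
qed

text \<open>The boundary of the cube is the open box together with the lid; they meet in the rim of
  the lid, where \<open>eq\<close> makes the two maps agree.\<close>

lemma glue_box_top: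
  assumes \<beta>: "continuous_map (cylinder (subtopology (cube (Suc n)) (cube_box n))) Y \<beta>"
    and F: "continuous_map (cylinder (cube n)) Y F"
    and eq: "\<And>x t. x \<in> cube_boundary n \<Longrightarrow> t \<in> {0..1} \<Longrightarrow> F (x, t) = \<beta> (x(n := 1), t)"
  shows "continuous_map (cylinder (boundary_space (Suc n))) Y
    (\<lambda>(y, t). if y \<in> cube_box n then \<beta> (y, t) else F (restrict y {..<n}, t))"
proof -
  let ?X = "cylinder (boundary_space (Suc n))"
  have top: "topspace ?X = cube_boundary (Suc n) \<times> {0..1}" by (simp add: cube_boundary_def) blast
  let ?A = "{z \<in> topspace ?X. fst z \<in> cube_box n}" and ?B = "{z \<in> topspace ?X. fst z n = 1}"
  have fst: "continuous_map ?X (cube (Suc n)) fst"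
    using continuous_map_fst continuous_map_into_fulltopology by blast
  have "continuous_map ?X Y (\<lambda>z. if z \<in> ?A then \<beta> z else F (restrict (fst z) {..<n}, snd z))"
  proof (rule continuous_map_two_closed)
    show "closedin ?X ?A" by (rule closedin_continuous_map_preimage[OF fst closedin_cube_box])
    show "closedin ?X ?B"
      using continuous_map_compose[OF fst continuous_map_cube_coordinate[of n "Suc n"]]
      by (intro closedin_level_set) (simp add: o_def)
    show "topspace ?X \<subseteq> ?A \<union> ?B" unfolding top by (auto simp: cube_boundary_Suc)
    have "continuous_map (subtopology ?X ?A) (subtopology (cube (Suc n)) (cube_box n)) fst"
      using fst by (auto simp: continuous_map_in_subtopology continuous_map_from_subtopology)
    moreover have "continuous_map (subtopology ?X ?A) unit_interval snd"
      by (intro continuous_map_from_subtopology continuous_map_snd)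
    ultimately have "continuous_map (subtopology ?X ?A)
        (cylinder (subtopology (cube (Suc n)) (cube_box n))) (\<lambda>z. (fst z, snd z))"
      by (rule continuous_map_pairedI)
    from continuous_map_compose[OF this \<beta>] show "continuous_map (subtopology ?X ?A) Y \<beta>" by (simp add: o_def)
    have "continuous_map (subtopology ?X ?B) (cylinder (cube n)) (\<lambda>z. (restrict (fst z) {..<n}, snd z))"
      using continuous_map_compose[OF fst continuous_map_init]
      by (intro continuous_map_pairedI continuous_map_from_subtopology continuous_map_snd) (simp add: o_def)
    from continuous_map_compose[OF this F]
    show "continuous_map (subtopology ?X ?B) Y (\<lambda>z. F (restrict (fst z) {..<n}, snd z))" by (simp add: o_def)
    fix z assume z: "z \<in> ?A" "z \<in> ?B"
    then have y: "fst z \<in> topspace (cube (Suc n))" "restrict (fst z) {..<n} \<in> cube_boundary n" "snd z \<in> {0..1}"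
      by (auto simp: cube_box_def)
    have z1: "fst z n = 1" using z by simp
    have "fst z = (restrict (fst z) {..<n})(n := 1)" using snoc_unsnoc[OF y(1)] z1 by metis
    then have "\<beta> (fst z, snd z) = F (restrict (fst z) {..<n}, snd z)" using eq[OF y(2,3)] by metis
    then show "\<beta> z = F (restrict (fst z) {..<n}, snd z)" by simp
  qed
  then show ?thesis by (rule continuous_map_eq) (auto simp: top)
qed

text \<open>The restriction of \<open>a\<close> to the lid represents a homotopy class in
  \<open>Y\<close>, and \<open>w\<close>, read with its last coordinate as time, is a null homotopy
  of its image. Injectivity deforms \<open>a\<close> to a constant map, and the constant case in
  dimension \<open>n + 1\<close> uses surjectivity.\<close>

lemma boundary_lifts_box_constant:
  fixes Y X :: "'v topology"
  assumes univ: "universe TYPE('v)" and hfib: "h_fibration Y X p"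
    and whe: "weak_homotopy_equivalence Y X p"
    and a: "continuous_map (boundary_space (Suc n)) Y a" and box: "\<And>x. x \<in> cube_box n \<Longrightarrow> a x = y"
  shows "boundary_lifts Y X p (Suc n) a"
  unfolding boundary_lifts_def
proof (intro allI impI)
  fix w assume w: "continuous_map (cube (Suc n)) X w" and eq: "\<forall>x \<in> cube_boundary (Suc n). p (a x) = w x"
  \<comment> \<open>Any point of the bottom would do: the box is nonempty, hence its value
    \<open>y\<close> lies in \<open>Y\<close>.\<close>
  define c where "c = (\<lambda>i\<in>{..<n}. 0 :: real)"
  have c: "c \<in> topspace (cube n)" by (simp add: c_def in_topspace_cube)
  have y: "y \<in> topspace Y"
    using snoc_bottom_in_box[OF c] box continuous_map_funspace[OF a] cube_box_subset cube_boundary_subset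
    by (fastforce simp: Pi_iff)
  define g where "g = (\<lambda>x. a (x(n := 1)))"
  have "continuous_map (cube n) (boundary_space (Suc n)) (\<lambda>x. x(n := 1))"
    using continuous_map_snoc_const snoc_top_in_boundary by (auto simp: continuous_map_in_subtopology)
  from continuous_map_compose[OF this a] have "continuous_map (cube n) Y g" by (simp add: g_def o_def)
  then have g: "g \<in> cube_maps n Y y" using snoc_side_in_box box by (auto simp: cube_maps_def g_def)
  have const: "(\<lambda>_. y) \<in> cube_maps n Y y" using y by (auto simp: cube_maps_def)
  have "(p \<circ> (\<lambda>_. y), p \<circ> g) \<in> cube_homotopy n X (p y)"
    unfolding cube_homotopy_iff
  proof (intro exI conjI ballI)
    from continuous_map_compose[OF continuous_map_compose[OF continuous_map_swap continuous_map_snoc] w]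
    show "continuous_map (prod_topology unit_interval (cube n)) X (\<lambda>(t, x). w (x(n := t)))"
      by (simp add: o_def case_prod_unfold)
    have eq': "w z = p (a z)" if "z \<in> cube_boundary (Suc n)" for z using eq that by simp
    show "(\<lambda>(t, x). w (x(n := t))) (0, x) = (p \<circ> (\<lambda>_. y)) x" if "x \<in> topspace (cube n)" for x
      using snoc_bottom_in_box[OF that] eq' box cube_box_subset by auto
    show "(\<lambda>(t, x). w (x(n := t))) (1, x) = (p \<circ> g) x" if "x \<in> topspace (cube n)" for x
      using eq'[OF snoc_top_in_boundary[OF that]] by (simp add: g_def)
    show "(\<lambda>(t, x). w (x(n := t))) (t, x) = p y" if "t \<in> {0..1}" "x \<in> cube_boundary n" for t x
      using snoc_side_in_box[OF that(2,1)] eq' box cube_box_subset by auto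
  qed
  from weak_homotopy_equivalence_inj[OF whe _ const g this] y
  have "(\<lambda>_. y, g) \<in> cube_homotopy n Y y" by simp
  from cube_homotopy_sym[OF this] obtain H where H:
    "continuous_map (prod_topology unit_interval (cube n)) Y H"
    "\<forall>x \<in> topspace (cube n). H (0, x) = g x" "\<forall>x \<in> topspace (cube n). H (1, x) = y"
    "\<forall>t \<in> {0..1}. \<forall>x \<in> cube_boundary n. H (t, x) = y" unfolding cube_homotopy_iff by blast
  \<comment> \<open>The null homotopy acts on the lid only; it is constant on the rim, so it fits
    the constant value on the box.\<close>
  let ?\<alpha> = "\<lambda>(x, t). if x \<in> cube_box n then y else H (t, restrict x {..<n})"
  have "continuous_map (cylinder (cube n)) Y (H \<circ> (\<lambda>(x, t). (t, x)))"
    by (rule continuous_map_compose[OF continuous_map_swap H(1)])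
  from glue_box_top[of n Y "\<lambda>_. y", OF _ this]
  have \<alpha>: "continuous_map (cylinder (boundary_space (Suc n))) Y ?\<alpha>"
    using y H(4) by (simp add: o_def case_prod_unfold cong: if_cong)
  have 0: "?\<alpha> (x, 0) = a x" if "x \<in> cube_boundary (Suc n)" for x
  proof (cases "x \<in> cube_box n")
    case False
    with that have x: "x \<in> topspace (cube (Suc n))" "x n = 1" by (auto simp: cube_boundary_Suc)
    then have "H (0, restrict x {..<n}) = a ((restrict x {..<n})(n := 1))"
      using H(2) restrict_in_cube by (simp add: g_def)
    then show ?thesis using snoc_unsnoc[OF x(1)] x(2) False by simp
  qed (simp add: box)
  have 1: "?\<alpha> (x, 1) = y" if "x \<in> cube_boundary (Suc n)" for x
    using H(3) restrict_in_cube[of x n] subsetD[OF cube_boundary_subset that] by simp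
  have "boundary_lifts Y X p (Suc n) (\<lambda>_. y)"
    by (rule boundary_lifts_constant[OF univ hfib whe]) (simp add: y)
  then have "boundary_lifts Y X p (Suc n) (\<lambda>x. ?\<alpha> (x, 1))"
    using 1 by (simp add: boundary_lifts_def boundary_lift_def)
  from boundary_lifts_homotopy[OF univ hfib \<alpha> this]
  show "boundary_lift Y X p (Suc n) a w"
    using 0 w eq by (simp add: boundary_lifts_def boundary_lift_def)
qed

text \<open>The open box is contractible: a convex contraction of the cube is followed by the retraction.
  This reduces the lifting problem to the case where the boundary map is constant on the box, that
  is, an element of a homotopy group.\<close>

lemma boundary_lifts_trivial_fibration:
  fixes Y X :: "'v topology"
  assumes univ: "universe TYPE('v)" and hfib: "h_fibration Y X p"
    and whe: "weak_homotopy_equivalence Y X p"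
    and a: "continuous_map (boundary_space n) Y a"
  shows "boundary_lifts Y X p n a"
proof (cases n)
  case 0
  then have "boundary_lifts Y X p n (\<lambda>_. y)" for y
    by (intro boundary_lifts_constant[OF univ hfib whe]) simp
  then show ?thesis using 0 by (simp add: boundary_lifts_def boundary_lift_def cube_boundary_def)
next
  case (Suc k)
  let ?r = "box_retraction k"
  define c where "c = (\<lambda>(x, t). \<lambda>i\<in>{..k}. (1 - t) * x i :: real)"
  define d where "d = (\<lambda>z. ?r (c z))"
  have c: "continuous_map (cylinder (cube (Suc k))) (cube (Suc k)) c"
    unfolding continuous_map_into_cube
  proof (intro conjI allI impI)
    have "0 \<le> (1 - t) * x i \<and> (1 - t) * x i \<le> 1"
      if "x \<in> topspace (cube (Suc k))" "0 \<le> t" "t \<le> 1" "i \<le> k" for x t i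
      using that by (auto simp: in_topspace_cube mult_le_one)
    then show "c \<in> topspace (cylinder (cube (Suc k))) \<rightarrow> topspace (cube (Suc k))"
      by (auto simp: c_def in_topspace_cube[of "\<lambda>i\<in>{..k}. _ i"])
    fix i assume i: "i < Suc k"
    have "continuous_map (cylinder (cube (Suc k))) euclideanreal (\<lambda>z. (1 - snd z) * fst z i)"
      using i continuous_map_compose[OF continuous_map_fst continuous_map_cube_coordinate[OF i], of unit_interval]
        continuous_map_into_fulltopology[OF continuous_map_snd[of "cube (Suc k)" unit_interval]]
      by (intro continuous_intros) (auto simp: o_def)
    then show "continuous_map (cylinder (cube (Suc k))) euclideanreal (\<lambda>z. c z i)"
      using i by (simp add: c_def case_prod_unfold)
  qed
  have d: "continuous_map (cylinder (cube (Suc k))) (boundary_space (Suc k)) d"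
    unfolding continuous_map_in_subtopology
  proof
    show "continuous_map (cylinder (cube (Suc k))) (cube (Suc k)) d"
      using continuous_map_compose[OF c continuous_map_box_retraction] by (simp add: d_def o_def)
    show "d \<in> topspace (cylinder (cube (Suc k))) \<rightarrow> cube_boundary (Suc k)"
      unfolding d_def using funcset_mem[OF continuous_map_funspace[OF c]] box_retraction_in_box cube_box_subset
      by blast
  qed
  have d0: "d (x, 0) = x" if x: "x \<in> cube_box k" for x
  proof -
    have "x \<in> topspace (cube (Suc k))" using x by (simp add: cube_box_def)
    then have "c (x, 0) = x" by (auto simp: c_def in_topspace_cube fun_eq_iff)
    then show ?thesis using box_retraction_id[OF x] by (simp add: d_def)
  qed
  have a': "continuous_map (boundary_space (Suc k)) Y a" using a Suc by simp
  have \<beta>: "continuous_map (cylinder (cube (Suc k))) Y (a \<circ> d)"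
    by (rule continuous_map_compose[OF d a'])
  have top: "continuous_map (cylinder (cube k)) (cylinder (cube (Suc k)))
      (\<lambda>(x, t). (x(k := 1), t))"
  proof -
    from continuous_map_compose[OF continuous_map_fst continuous_map_snoc_const[of 1]] show ?thesis
      by (simp add: case_prod_unfold o_def continuous_map_paired continuous_map_snd)
  qed
  have "continuous_map (cube k) (boundary_space (Suc k)) (\<lambda>x. x(k := 1))"
    using continuous_map_snoc_const snoc_top_in_boundary by (auto simp: continuous_map_in_subtopology)
  from continuous_map_compose[OF this a'] have g: "continuous_map (cube k) Y (\<lambda>x. a (x(k := 1)))" by (simp add: o_def)
  have "continuous_map (cylinder (boundary_space k)) (cylinder (cube k)) (\<lambda>z. (fst z, snd z))"
    using continuous_map_fst continuous_map_into_fulltopology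
    by (intro continuous_map_pairedI continuous_map_snd) blast
  from continuous_map_compose[OF continuous_map_compose[OF this top] \<beta>]
  have \<phi>: "continuous_map (cylinder (boundary_space k)) Y (\<lambda>(x, t). a (d (x(k := 1), t)))"
    by (simp add: o_def case_prod_unfold)
  \<comment> \<open>The contraction of the box moves the rim of the lid. Homotopy extension,
    starting from \<open>a\<close> on the lid, carries the interior of the lid along.\<close>
  obtain F where F: "continuous_map (cylinder (cube k)) Y F"
    "\<And>x. x \<in> topspace (cube k) \<Longrightarrow> F (x, 0) = a (x(k := 1))"
    "\<And>x t. x \<in> cube_boundary k \<Longrightarrow> t \<in> {0..1} \<Longrightarrow> F (x, t) = (\<lambda>(x, t). a (d (x(k := 1), t))) (x, t)"
    by (rule cube_homotopy_extension[OF g \<phi>]) (use d0 snoc_side_in_box in auto)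
  let ?\<alpha> = "\<lambda>(y, t). if y \<in> cube_box k then (a \<circ> d) (y, t) else F (restrict y {..<k}, t)"
  have "continuous_map (cylinder (subtopology (cube (Suc k)) (cube_box k))) Y (a \<circ> d)"
    using continuous_map_from_subtopology[OF \<beta>] by (simp only: prod_topology_subtopology(1))
  then have \<alpha>: "continuous_map (cylinder (boundary_space (Suc k))) Y ?\<alpha>"
    by (rule glue_box_top[OF _ F(1)]) (simp add: F(3))
  have 0: "?\<alpha> (x, 0) = a x" if "x \<in> cube_boundary (Suc k)" for x
  proof (cases "x \<in> cube_box k")
    case False
    with that have x: "x \<in> topspace (cube (Suc k))" "x k = 1" by (auto simp: cube_boundary_Suc)
    then have "F (restrict x {..<k}, 0) = a ((restrict x {..<k})(k := 1))"
      using F(2) restrict_in_cube by simp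
    then show ?thesis using snoc_unsnoc[OF x(1)] x(2) False by simp
  qed (simp add: d0)
  have 1: "?\<alpha> (x, 1) = a (?r (\<lambda>i\<in>{..k}. 0))" if "x \<in> cube_box k" for x
    using that by (simp add: d_def c_def)
  have "boundary_lifts Y X p (Suc k) (\<lambda>x. ?\<alpha> (x, 1))"
  proof (rule boundary_lifts_box_constant[OF univ hfib whe])
    have "continuous_map (boundary_space (Suc k)) (cylinder (boundary_space (Suc k))) (\<lambda>x. (x, 1))"
      by (intro continuous_map_pairedI) auto
    from continuous_map_compose[OF this \<alpha>]
    show "continuous_map (boundary_space (Suc k)) Y (\<lambda>x. ?\<alpha> (x, 1))" by (simp add: o_def)
  qed (rule 1)
  from boundary_lifts_homotopy[OF univ hfib \<alpha> this] show ?thesis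
    using 0 Suc by (simp add: boundary_lifts_def boundary_lift_def)
qed

text \<open>For injectivity, two cubes with homotopic images are the bottom and the lid of a
  boundary map in one dimension more, and the homotopy in \<open>X\<close> fills its image. For
  surjectivity the boundary map is constant and the cube in \<open>X\<close> is the representative
  to be lifted.\<close>

lemma weak_homotopy_equivalence_if_boundary_lifts:
  assumes p: "continuous_map Y X p"
    and lifts: "\<And>n a. continuous_map (boundary_space n) Y a \<Longrightarrow> boundary_lifts Y X p n a"
  shows "weak_homotopy_equivalence Y X p"
  unfolding weak_homotopy_equivalence_def
proof (intro conjI allI impI p)
  fix n :: nat and y assume y: "n = 0 \<or> y \<in> topspace Y"
  have inj: "(f, g) \<in> cube_homotopy n Y y"
    if f: "f \<in> cube_maps n Y y" and g: "g \<in> cube_maps n Y y"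
      and hom: "(p \<circ> f, p \<circ> g) \<in> cube_homotopy n X (p y)" for f g
  proof -
    from hom obtain k where k: "continuous_map (prod_topology unit_interval (cube n)) X k"
      "\<forall>x \<in> topspace (cube n). k (0, x) = p (f x)" "\<forall>x \<in> topspace (cube n). k (1, x) = p (g x)"
      "\<forall>t \<in> {0..1}. \<forall>x \<in> cube_boundary n. k (t, x) = p y" unfolding cube_homotopy_iff by auto
    have const: "continuous_map (cylinder (boundary_space n)) Y (\<lambda>_. y)"
      by (rule continuous_map_boundary_const[OF y])
    have fy: "f x = y" "g x = y" if "x \<in> cube_boundary n" for x using f g that by (auto simp: cube_maps_def)
    let ?b = "\<lambda>x. if x n = 0 then f (restrict x {..<n}) else y"
    let ?a = "\<lambda>x. if x \<in> cube_box n then ?b x else g (restrict x {..<n})"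
    have b: "continuous_map (subtopology (cube (Suc n)) (cube_box n)) Y ?b"
      using glue_on_box[OF _ const, of f] f fy by (simp add: cube_maps_def)
    have "continuous_map (cylinder (subtopology (cube (Suc n)) (cube_box n))) Y (?b \<circ> fst)"
      by (rule continuous_map_compose[OF continuous_map_fst b])
    moreover have "continuous_map (cylinder (cube n)) Y (g \<circ> fst)"
      using g by (intro continuous_map_compose[OF continuous_map_fst]) (simp add: cube_maps_def)
    ultimately have c: "continuous_map (cylinder (boundary_space (Suc n))) Y
        (\<lambda>(x, t). if x \<in> cube_box n then (?b \<circ> fst) (x, t) else (g \<circ> fst) (restrict x {..<n}, t))"
      by (rule glue_box_top) (simp add: fy)
    have "continuous_map (boundary_space (Suc n)) (cylinder (boundary_space (Suc n))) (\<lambda>x. (x, 0))"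
      by (intro continuous_map_pairedI) auto
    from continuous_map_compose[OF this c] have a: "continuous_map (boundary_space (Suc n)) Y ?a"
      by (simp add: o_def cong: if_cong)
    let ?w = "\<lambda>x. k (x n, restrict x {..<n})"
    have "continuous_map (cylinder (cube n)) X (k \<circ> (\<lambda>(x, t). (t, x)))"
      by (rule continuous_map_compose[OF continuous_map_swap k(1)])
    then have w: "continuous_map (cube (Suc n)) X ?w" by (simp add: continuous_map_cube_interval)
    have "p (?a x) = ?w x" if x: "x \<in> cube_boundary (Suc n)" for x
    proof -
      have x': "x \<in> topspace (cube (Suc n))" using x cube_boundary_subset by blast
      then have "0 \<le> x n" "x n \<le> 1" by (auto simp: in_topspace_cube)
      then show ?thesis
        using k(2,3,4) restrict_in_cube[OF x'] x by (auto simp: cube_boundary_Suc cube_box_def)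
    qed
    then have "boundary_lift Y X p (Suc n) ?a ?w"
      using lifts[OF a] w unfolding boundary_lifts_def by blast
    then obtain h where h: "continuous_map (cube (Suc n)) Y h" "\<And>x. x \<in> cube_boundary (Suc n) \<Longrightarrow> h x = ?a x"
      unfolding boundary_lift_def by blast
    show ?thesis
      unfolding cube_homotopy_iff
    proof (intro exI conjI ballI)
      from continuous_map_compose[OF continuous_map_compose[OF continuous_map_swap continuous_map_snoc] h(1)]
      show "continuous_map (prod_topology unit_interval (cube n)) Y (\<lambda>(t, x). h (x(n := t)))"
        by (simp add: o_def case_prod_unfold)
      fix x assume x: "x \<in> topspace (cube n)"
      show "(\<lambda>(t, x). h (x(n := t))) (0, x) = f x"
        using h(2)[OF subsetD[OF cube_box_subset snoc_bottom_in_box[OF x]]] snoc_bottom_in_box[OF x]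
          unsnoc_snoc[OF x] by (simp del: restrict_fupd)
      have "x(n := 1) \<in> cube_box n \<Longrightarrow> x \<in> cube_boundary n"
        using unsnoc_snoc[OF x, of 1] by (simp add: cube_box_def del: restrict_fupd)
      then show "(\<lambda>(t, x). h (x(n := t))) (1, x) = g x"
        using h(2)[OF snoc_top_in_boundary[OF x]] unsnoc_snoc[OF x] fy by (auto simp del: restrict_fupd)
    next
      fix t :: real and x assume t: "t \<in> {0..1}" and x: "x \<in> cube_boundary n"
      have x': "x \<in> topspace (cube n)" using x cube_boundary_subset by blast
      show "(\<lambda>(t, x). h (x(n := t))) (t, x) = y"
        using h(2)[OF subsetD[OF cube_box_subset]] snoc_side_in_box[OF x t] unsnoc_snoc[OF x'] fy x by (simp del: restrict_fupd)
    qed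
  qed
  have surj: "\<exists>l \<in> cube_maps n Y y. \<forall>x \<in> topspace (cube n). p (l x) = D x"
    if D: "D \<in> cube_maps n X (p y)" for D
  proof -
    have "continuous_map (boundary_space n) Y (\<lambda>_. y)"
      by (rule continuous_map_boundary_const[OF y])
    from lifts[OF this] have "boundary_lift Y X p n (\<lambda>_. y) D"
      using D unfolding boundary_lifts_def cube_maps_def by fastforce
    then show ?thesis unfolding boundary_lift_def cube_maps_def by (simp add: image_subset_iff)
  qed
  show "bij_betw (induced_on_classes n X p y) (homotopy_classes n Y y) (homotopy_classes n X (p y))"
    unfolding bij_betw_def
  proof
    show "inj_on (induced_on_classes n X p y) (homotopy_classes n Y y)"
    proof (rule inj_onI)
      fix C C' assume C: "C \<in> homotopy_classes n Y y" "C' \<in> homotopy_classes n Y y"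
        "induced_on_classes n X p y C = induced_on_classes n X p y C'"
      then obtain f g where fg: "f \<in> cube_maps n Y y" "C = cube_homotopy n Y y `` {f}"
        "g \<in> cube_maps n Y y" "C' = cube_homotopy n Y y `` {g}"
        by (auto simp: homotopy_classes_def quotient_def)
      then have "(p \<circ> f, p \<circ> g) \<in> cube_homotopy n X (p y)"
        using C(3) by (simp add: induced_on_class p cube_homotopy_class_eq_iff cube_maps_compose[OF _ p])
      then show "C = C'" using inj fg by (simp add: cube_homotopy_class_eq_iff)
    qed
    show "induced_on_classes n X p y ` homotopy_classes n Y y = homotopy_classes n X (p y)"
    proof
      show "induced_on_classes n X p y ` homotopy_classes n Y y \<subseteq> homotopy_classes n X (p y)"
        using cube_maps_compose[OF _ p] by (fastforce simp: homotopy_classes_def quotient_def induced_on_class p)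
      show "homotopy_classes n X (p y) \<subseteq> induced_on_classes n X p y ` homotopy_classes n Y y"
      proof
        fix C assume "C \<in> homotopy_classes n X (p y)"
        then obtain D where D: "D \<in> cube_maps n X (p y)" "C = cube_homotopy n X (p y) `` {D}"
          by (auto simp: homotopy_classes_def quotient_def)
        from surj[OF D(1)] obtain l where l: "l \<in> cube_maps n Y y" "\<forall>x \<in> topspace (cube n). p (l x) = D x"
          by blast
        have "(D, p \<circ> l) \<in> cube_homotopy n X (p y)"
          unfolding cube_homotopy_iff
        proof (intro exI conjI ballI)
          show "continuous_map (prod_topology unit_interval (cube n)) X (D \<circ> snd)"
            using D by (intro continuous_map_compose[OF continuous_map_snd]) (simp add: cube_maps_def)
        qed (use l D in \<open>auto simp: cube_maps_def\<close>)
        then have "C = induced_on_classes n X p y (cube_homotopy n Y y `` {l})"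
          using D by (simp add: induced_on_class[OF l(1) p] cube_homotopy_class_eq_iff cube_maps_compose[OF l(1) p])
        moreover have "cube_homotopy n Y y `` {l} \<in> homotopy_classes n Y y"
          using l(1) by (auto simp: homotopy_classes_def quotient_def)
        ultimately show "C \<in> induced_on_classes n X p y ` homotopy_classes n Y y" by blast
      qed
    qed
  qed
qed



section \<open>A cellular resolution\<close>

definition cube_append :: "nat \<Rightarrow> (nat \<Rightarrow> real) \<Rightarrow> (nat \<Rightarrow> real) \<Rightarrow> nat \<Rightarrow> real" where
  "cube_append n s t = (\<lambda>i. if i < n then s i else t (i - n))"

definition cube_left :: "nat \<Rightarrow> (nat \<Rightarrow> real) \<Rightarrow> nat \<Rightarrow> real" where
  "cube_left n r = restrict r {..<n}"

definition cube_right :: "nat \<Rightarrow> nat \<Rightarrow> (nat \<Rightarrow> real) \<Rightarrow> nat \<Rightarrow> real" where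
  "cube_right n m r = (\<lambda>i\<in>{..<m}. r (i + n))"

text \<open>This is an equality of functions without any reparametrisation; strict associativity of
  products of cells rests on it.\<close>

lemma cube_append_assoc:
  "cube_append (n + m) (cube_append n s t) u = cube_append n s (cube_append m t u)"
  by (auto simp: cube_append_def fun_eq_iff diff_diff_left)

lemma cube_append_in: "s \<in> topspace (cube n) \<Longrightarrow> t \<in> topspace (cube m) \<Longrightarrow> cube_append n s t \<in> topspace (cube (n + m))"
  by (auto simp: in_topspace_cube cube_append_def)

lemma cube_left_in: "r \<in> topspace (cube (n + m)) \<Longrightarrow> cube_left n r \<in> topspace (cube n)"
  by (auto simp: in_topspace_cube cube_left_def)

lemma cube_right_in: "r \<in> topspace (cube (n + m)) \<Longrightarrow> cube_right n m r \<in> topspace (cube m)"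
  by (auto simp: in_topspace_cube cube_right_def)

lemma cube_left_append [simp]: "s \<in> topspace (cube n) \<Longrightarrow> cube_left n (cube_append n s t) = s"
  by (auto simp: in_topspace_cube cube_append_def cube_left_def fun_eq_iff)

lemma cube_right_append [simp]: "t \<in> topspace (cube m) \<Longrightarrow> cube_right n m (cube_append n s t) = t"
  by (auto simp: in_topspace_cube cube_append_def cube_right_def fun_eq_iff)

lemma cube_append_left_right: "r \<in> topspace (cube (n + m)) \<Longrightarrow> cube_append n (cube_left n r) (cube_right n m r) = r"
  by (auto simp: in_topspace_cube cube_append_def cube_left_def cube_right_def fun_eq_iff)

text \<open>The product rule for boundaries. It provides the two closed pieces on which the
  attaching map of a product cell is pasted.\<close>

lemma cube_boundary_append_iff:
  assumes r: "r \<in> topspace (cube (n + m))"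
  shows "r \<in> cube_boundary (n + m) \<longleftrightarrow> cube_left n r \<in> cube_boundary n \<or> cube_right n m r \<in> cube_boundary m"
proof
  assume "r \<in> cube_boundary (n + m)"
  then obtain i where i: "i < n + m" "r i = 0 \<or> r i = 1" by (auto simp: cube_boundary_def)
  show "cube_left n r \<in> cube_boundary n \<or> cube_right n m r \<in> cube_boundary m"
  proof (cases "i < n")
    case True
    then have "cube_left n r \<in> cube_boundary n"
      using i cube_left_in[OF r] by (auto simp: cube_boundary_def cube_left_def intro!: exI[of _ i])
    then show ?thesis ..
  next
    case False
    then have "cube_right n m r \<in> cube_boundary m"
      using i cube_right_in[OF r] by (auto simp: cube_boundary_def cube_right_def intro!: exI[of _ "i - n"])
    then show ?thesis ..
  qed
next
  assume "cube_left n r \<in> cube_boundary n \<or> cube_right n m r \<in> cube_boundary m"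
  then show "r \<in> cube_boundary (n + m)"
  proof
    assume "cube_left n r \<in> cube_boundary n"
    then obtain i where "i < n" "r i = 0 \<or> r i = 1" by (auto simp: cube_boundary_def cube_left_def)
    then show ?thesis using r by (auto simp: cube_boundary_def intro!: exI[of _ i])
  next
    assume "cube_right n m r \<in> cube_boundary m"
    then obtain i where "i < m" "r (i + n) = 0 \<or> r (i + n) = 1" by (auto simp: cube_boundary_def cube_right_def)
    then show ?thesis using r by (auto simp: cube_boundary_def intro!: exI[of _ "i + n"])
  qed
qed

lemma continuous_map_cube_append:
  "continuous_map (prod_topology (cube n) (cube m)) (cube (n + m)) (\<lambda>(s, t). cube_append n s t)"
  unfolding continuous_map_into_cube
proof (intro conjI allI impI)
  show "(\<lambda>(s, t). cube_append n s t) \<in> topspace (prod_topology (cube n) (cube m)) \<rightarrow> topspace (cube (n + m))"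
    by (auto simp: cube_append_in)
  fix i assume i: "i < n + m"
  show "continuous_map (prod_topology (cube n) (cube m)) euclideanreal (\<lambda>x. (case x of (s, t) \<Rightarrow> cube_append n s t) i)"
  proof (cases "i < n")
    case True
    then show ?thesis
      using continuous_map_compose[OF continuous_map_fst continuous_map_cube_coordinate[OF True]]
      by (simp add: cube_append_def case_prod_unfold o_def)
  next
    case False
    then have "i - n < m" using i by simp
    from continuous_map_compose[OF continuous_map_snd continuous_map_cube_coordinate[OF this]] False
    show ?thesis by (simp add: cube_append_def case_prod_unfold o_def)
  qed
qed

lemma continuous_map_cube_left: "continuous_map (cube (n + m)) (cube n) (cube_left n)"
  unfolding continuous_map_into_cube
  using cube_left_in by (auto simp: cube_left_def continuous_map_cube_coordinate)

lemma continuous_map_cube_right: "continuous_map (cube (n + m)) (cube m) (cube_right n m)"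
  unfolding continuous_map_into_cube
  using cube_right_in by (auto simp: cube_right_def continuous_map_cube_coordinate)

text \<open>A point \<open>Pt n a \<sigma> t\<close> lies in the open cell of dimension \<open>n\<close> with attaching map \<open>a\<close> and
  with coordinates \<open>t\<close>; the cell lies over the singular cube \<open>\<sigma>\<close>. Attaching maps take the value \<open>Void\<close>
  outside the boundary of the cube.\<close>

datatype 'u pt = Void | Pt nat "(nat \<Rightarrow> real) \<Rightarrow> 'u pt" "(nat \<Rightarrow> real) \<Rightarrow> 'u" "nat \<Rightarrow> real"

type_synonym 'u cell = "nat \<times> ((nat \<Rightarrow> real) \<Rightarrow> 'u pt) \<times> ((nat \<Rightarrow> real) \<Rightarrow> 'u)"

text \<open>In the \<open>Pt\<close> case only the folded values of the attaching map are passed on,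
  not the map itself. A lift built cell by cell has this form, and so has the coding of points in
  the universe.\<close>

primrec pt_fold :: "'b \<Rightarrow> (nat \<Rightarrow> ((nat \<Rightarrow> real) \<Rightarrow> 'b) \<Rightarrow> ((nat \<Rightarrow> real) \<Rightarrow> 'u) \<Rightarrow> (nat \<Rightarrow> real) \<Rightarrow> 'b) \<Rightarrow> 'u pt \<Rightarrow> 'b" where
  "pt_fold v N Void = v"
| "pt_fold v N (Pt n a \<sigma> t) = N n (\<lambda>r. pt_fold v N (a r)) \<sigma> t"

primrec pt_value :: "'u pt \<Rightarrow> 'u" where
  "pt_value Void = undefined"
| "pt_value (Pt n a \<sigma> t) = \<sigma> t"

text \<open>The characteristic map of a cell. Boundary points are already points of the complex and
  interior points are new terms, so gluing needs no quotient.\<close>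

definition cell_map :: "'u cell \<Rightarrow> (nat \<Rightarrow> real) \<Rightarrow> 'u pt" where
  "cell_map = (\<lambda>(n, a, \<sigma>) t. if t \<in> cube_boundary n then a t else Pt n a \<sigma> t)"

definition cell_points :: "'u cell set \<Rightarrow> 'u pt set" where
  "cell_points G = (\<Union>c\<in>G. cell_map c ` topspace (cube (fst c)))"

definition cell_probes :: "'u cell set \<Rightarrow> (nat \<times> ((nat \<Rightarrow> real) \<Rightarrow> 'u pt)) set" where
  "cell_probes G = (\<lambda>c. (fst c, cell_map c)) ` G"

definition cell_space :: "'u cell set \<Rightarrow> 'u pt topology" where
  "cell_space G = probe_topology (cell_points G) (cell_probes G)"

text \<open>The prescribed values off the boundary and off the cube make two cells of the same
  dimension equal as soon as they agree on the boundary and on the cube.\<close>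

definition attachable :: "'u topology \<Rightarrow> 'u cell set \<Rightarrow> 'u cell set" where
  "attachable P G = {(n, a, \<sigma>).
     continuous_map (boundary_space n) (cell_space G) a \<and> (\<forall>t. t \<notin> cube_boundary n \<longrightarrow> a t = Void) \<and>
     continuous_map (cube n) P \<sigma> \<and> (\<forall>t. t \<notin> topspace (cube n) \<longrightarrow> \<sigma> t = undefined) \<and>
     (\<forall>t \<in> cube_boundary n. pt_value (a t) = \<sigma> t)}"

text \<open>The least fixed point contains every cell that can be attached to it, so no argument with
  compactness or transfinite stages is needed.\<close>

definition cells :: "'u topology \<Rightarrow> 'u cell set" where
  "cells P = lfp (attachable P)"

definition resolution :: "'u topology \<Rightarrow> 'u pt topology" where
  "resolution P = cell_space (cells P)"

section \<open>Topology of cell complexes and induction over cells\<close>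

lemma probes_cells: "probes (cell_points G) (cell_probes G)"
  by (auto simp: probes_def cell_points_def cell_probes_def)

lemma topspace_cell_space: "topspace (cell_space G) = cell_points G"
  by (simp add: cell_space_def topspace_probe_topology probes_cells)

lemma cover_cells: "x \<in> cell_points G \<Longrightarrow> \<exists>n \<sigma> t. (n, \<sigma>) \<in> cell_probes G \<and> t \<in> topspace (cube n) \<and> \<sigma> t = x"
  by (auto simp: cell_points_def cell_probes_def)

lemma continuous_map_cell_map: "c \<in> G \<Longrightarrow> continuous_map (cube (fst c)) (cell_space G) (cell_map c)"
  unfolding cell_space_def by (rule continuous_map_probe[OF probes_cells]) (auto simp: cell_probes_def)

lemma continuous_map_from_cell_space:
  assumes "\<And>c. c \<in> G \<Longrightarrow> continuous_map (cube (fst c)) Y (f \<circ> cell_map c)"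
  shows "continuous_map (cell_space G) Y f"
  unfolding cell_space_def
proof (rule continuous_map_from_probe_topology[OF probes_cells])
  show "f \<in> cell_points G \<rightarrow> topspace Y"
    using assms[THEN continuous_map_funspace] by (force simp: cell_points_def)
qed (use assms in \<open>auto simp: cell_probes_def\<close>)

lemma continuous_map_prod_cell_space:
  assumes K: "compact_space K" "Hausdorff_space K"
    and c: "\<And>c. c \<in> G \<Longrightarrow> continuous_map (prod_topology K (cube (fst c))) Y (\<lambda>(k, t). f (k, cell_map c t))"
  shows "continuous_map (prod_topology K (cell_space G)) Y f"
  unfolding cell_space_def
  by (rule continuous_map_prod_probe_topology[OF K probes_cells cover_cells])
    (use c in \<open>auto simp: cell_probes_def\<close>)

lemma cell_space_mono: "G \<subseteq> H \<Longrightarrow> continuous_map (cell_space G) (cell_space H) id"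
  by (rule continuous_map_from_cell_space) (auto intro: continuous_map_cell_map)

lemma continuous_map_cell_space_mono:
  "continuous_map Z (cell_space G) f \<Longrightarrow> G \<subseteq> H \<Longrightarrow> continuous_map Z (cell_space H) f"
  using continuous_map_compose[OF _ cell_space_mono[of G H]] by fastforce

lemma mono_attachable: "mono (attachable P)"
  by (rule monoI) (auto simp: attachable_def intro: continuous_map_cell_space_mono)

lemma cells_unfold: "cells P = attachable P (cells P)"
  unfolding cells_def by (rule lfp_unfold[OF mono_attachable])

text \<open>The hypothesis on \<open>c\<close> says more than that its attaching points lie in cells
  satisfying \<open>R\<close>: the attaching map is continuous into the complex of these cells. Maps
  constructed on them therefore stay continuous after composition with it.\<close>

lemma cells_induct [consumes 1, case_names attach]:
  assumes "c \<in> cells P" "\<And>c. c \<in> attachable P (cells P \<inter> {c. R c}) \<Longrightarrow> c \<in> cells P \<Longrightarrow> R c"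
  shows "R c"
  using assms(1) unfolding cells_def
proof (rule lfp_induct_set[OF _ mono_attachable])
  fix c assume c: "c \<in> attachable P (lfp (attachable P) \<inter> {x. R x})"
  then have "c \<in> attachable P (cells P)"
    using subsetD[OF monoD[OF mono_attachable Int_lower1]] unfolding cells_def by blast
  then have "c \<in> cells P" using cells_unfold by blast
  then show "R c" using assms(2) c unfolding cells_def by blast
qed

lemma cell_map_value:
  assumes "c \<in> attachable P G" "t \<in> topspace (cube (fst c))"
  shows "pt_value (cell_map c t) = snd (snd c) t"
  using assms by (auto simp: attachable_def cell_map_def)

lemma attaching_point:
  assumes "(n, a, \<sigma>) \<in> attachable P G" "t \<in> cube_boundary n"
  obtains c t' where "c \<in> G" "t' \<in> topspace (cube (fst c))" "a t = cell_map c t'"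
proof -
  have "continuous_map (boundary_space n) (cell_space G) a" using assms(1) by (simp add: attachable_def)
  from funcset_mem[OF continuous_map_funspace[OF this], unfolded topspace_boundary_space topspace_cell_space, OF assms(2)]
  show ?thesis using that by (auto simp: cell_points_def)
qed

lemma continuous_map_pt_value: "continuous_map (resolution P) P pt_value"
  unfolding resolution_def
proof (rule continuous_map_from_cell_space)
  fix c assume "c \<in> cells P"
  then have c: "c \<in> attachable P (cells P)" using cells_unfold by blast
  then have "continuous_map (cube (fst c)) P (snd (snd c))" by (auto simp: attachable_def)
  then show "continuous_map (cube (fst c)) P (pt_value \<circ> cell_map c)"
    by (rule continuous_map_eq) (simp add: cell_map_value[OF c])
qed

text \<open>Every such problem, normalised by the prescribed default values, is itself a cell of the
  fixed point, and the characteristic map of this cell solves it.\<close>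

lemma resolution_fill:
  assumes a: "continuous_map (boundary_space n) (resolution P) a" and s: "continuous_map (cube n) P \<sigma>"
    and eq: "\<And>t. t \<in> cube_boundary n \<Longrightarrow> pt_value (a t) = \<sigma> t"
  obtains h where "continuous_map (cube n) (resolution P) h" "\<And>t. t \<in> cube_boundary n \<Longrightarrow> h t = a t"
    "\<And>t. t \<in> topspace (cube n) \<Longrightarrow> pt_value (h t) = \<sigma> t"
proof -
  define c where "c = (n, \<lambda>t. if t \<in> cube_boundary n then a t else Void, \<lambda>t\<in>topspace (cube n). \<sigma> t)"
  have "continuous_map (boundary_space n) (cell_space (cells P)) (\<lambda>t. if t \<in> cube_boundary n then a t else Void)"
    by (rule continuous_map_eq[OF a[unfolded resolution_def]]) (simp add: topspace_boundary_space)
  moreover have "continuous_map (cube n) P (\<lambda>t\<in>topspace (cube n). \<sigma> t)"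
    by (rule continuous_map_eq[OF s]) simp
  ultimately have c: "c \<in> attachable P (cells P)"
    using eq cube_boundary_subset by (auto simp: c_def attachable_def)
  show ?thesis
  proof (rule that)
    have "c \<in> cells P" using c cells_unfold by blast
    from continuous_map_cell_map[OF this] show "continuous_map (cube n) (resolution P) (cell_map c)"
      by (simp add: resolution_def c_def)
    show "cell_map c t = a t" if "t \<in> cube_boundary n" for t using that by (simp add: cell_map_def c_def)
    show "pt_value (cell_map c t) = \<sigma> t" if "t \<in> topspace (cube n)" for t
      using cell_map_value[OF c] that by (simp add: c_def)
  qed
qed

lemma resolution_lift:
  assumes g: "continuous_map P X g"
    and lifts: "\<And>n a. continuous_map (boundary_space n) Y a \<Longrightarrow> boundary_lifts Y X p n a"
  obtains k where "continuous_map (resolution P) Y k"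
    "\<And>q. q \<in> topspace (resolution P) \<Longrightarrow> p (k q) = g (pt_value q)"
proof -
  \<comment> \<open>The lift over a cell is chosen from its values on the boundary and from
    \<open>\<sigma>\<close> alone, which is the form that \<open>pt_fold\<close> requires.\<close>
  define N where "N = (\<lambda>n b \<sigma>. SOME h. continuous_map (cube n) Y h \<and>
     (\<forall>x \<in> cube_boundary n. h x = b x) \<and> (\<forall>x \<in> topspace (cube n). p (h x) = g (\<sigma> x)))"
  define k where "k = pt_fold undefined N"
  have R: "continuous_map (cube (fst c)) Y (\<lambda>t. k (cell_map c t)) \<and>
      (\<forall>t \<in> topspace (cube (fst c)). p (k (cell_map c t)) = g (snd (snd c) t))"
    if "c \<in> cells P" for c
    using that
  proof (induction rule: cells_induct)
    case (attach c)
    obtain n a \<sigma> where c: "c = (n, a, \<sigma>)" by (cases c) auto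
    let ?G = "cells P \<inter> {c. continuous_map (cube (fst c)) Y (\<lambda>t. k (cell_map c t)) \<and>
      (\<forall>t \<in> topspace (cube (fst c)). p (k (cell_map c t)) = g (snd (snd c) t))}"
    have a: "continuous_map (boundary_space n) (cell_space ?G) a" and s: "continuous_map (cube n) P \<sigma>"
      and eq: "\<And>t. t \<in> cube_boundary n \<Longrightarrow> pt_value (a t) = \<sigma> t"
      using attach(1) by (auto simp: c attachable_def)
    have "continuous_map (cell_space ?G) Y k" by (rule continuous_map_from_cell_space) (simp add: o_def)
    from continuous_map_compose[OF a this] have ka: "continuous_map (boundary_space n) Y (k \<circ> a)" .
    have pka: "p (k (a t)) = g (\<sigma> t)" if t: "t \<in> cube_boundary n" for t
    proof -
      obtain c' t' where c': "c' \<in> ?G" "t' \<in> topspace (cube (fst c'))" "a t = cell_map c' t'"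
        using attaching_point[OF attach(1)[unfolded c] t] by blast
      then have "c' \<in> attachable P (cells P)" using cells_unfold by blast
      from cell_map_value[OF this c'(2)] c' eq[OF t] show ?thesis by simp
    qed
    have "continuous_map (cube n) X (g \<circ> \<sigma>)" by (rule continuous_map_compose[OF s g])
    then have "boundary_lift Y X p n (k \<circ> a) (g \<circ> \<sigma>)"
      using lifts[OF ka] pka unfolding boundary_lifts_def by simp
    then have "\<exists>h. continuous_map (cube n) Y h \<and>
     (\<forall>x \<in> cube_boundary n. h x = (\<lambda>r. k (a r)) x) \<and> (\<forall>x \<in> topspace (cube n). p (h x) = g (\<sigma> x))"
      by (simp add: boundary_lift_def)
    from someI_ex[OF this] have N: "continuous_map (cube n) Y (N n (\<lambda>r. k (a r)) \<sigma>)"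
      "\<forall>x \<in> cube_boundary n. N n (\<lambda>r. k (a r)) \<sigma> x = k (a x)"
      "\<forall>x \<in> topspace (cube n). p (N n (\<lambda>r. k (a r)) \<sigma> x) = g (\<sigma> x)"
      unfolding N_def by simp_all
    \<comment> \<open>This also holds on the boundary, where \<open>cell_map\<close> passes to the
      attaching map, because the chosen lift extends \<open>k \<circ> a\<close>.\<close>
    have "k (cell_map c t) = N n (\<lambda>r. k (a r)) \<sigma> t" for t
      using N(2) by (auto simp: c cell_map_def k_def)
    then show ?case using N by (simp add: c)
  qed
  show ?thesis
  proof (rule that)
    show "continuous_map (resolution P) Y k"
      unfolding resolution_def using R by (intro continuous_map_from_cell_space) (simp add: o_def)
    fix q assume "q \<in> topspace (resolution P)"
    then obtain c t where c: "c \<in> cells P" "t \<in> topspace (cube (fst c))" "q = cell_map c t"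
      by (auto simp: resolution_def topspace_cell_space cell_points_def)
    then have "c \<in> attachable P (cells P)" using cells_unfold by blast
    from cell_map_value[OF this c(2)] R[OF c(1)] c show "p (k q) = g (pt_value q)" by simp
  qed
qed

section \<open>Coding points of cells in the universe\<close>

lemma inj_real_sequence_code: "\<exists>g::(nat \<Rightarrow> real) \<Rightarrow> real. inj g"
proof -
  obtain b :: "real \<Rightarrow> nat set" where b: "inj b"
    using nat_sets_eqpoll_reals by (metis bij_betw_def eqpoll_def eqpoll_sym)
  obtain d :: "nat set \<Rightarrow> real" where d: "inj d"
    using nat_sets_eqpoll_reals by (metis bij_betw_def eqpoll_def)
  \<comment> \<open>A real is coded as a set of naturals; a sequence of such sets becomes the set of
    its indexed elements, again a set of naturals after pairing.\<close>
  have "inj (\<lambda>x. d (prod_encode ` (SIGMA i:UNIV. b (x i))))"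
  proof (rule injI, rule ext)
    fix x y i
    assume "d (prod_encode ` (SIGMA i:UNIV. b (x i))) = d (prod_encode ` (SIGMA i:UNIV. b (y i)))"
    then have "(SIGMA i:UNIV. b (x i)) = (SIGMA i:UNIV. b (y i))"
      using d by (simp add: inj_eq inj_image_eq_iff[OF inj_prod_encode])
    then have "b (x i) = b (y i)" by auto
    then show "x i = y i" using b by (simp add: inj_eq)
  qed
  then show ?thesis by blast
qed

lemma universe_pt:
  assumes "universe TYPE('u)"
  shows "\<exists>e::'u pt \<Rightarrow> 'u. inj e"
proof -
  from assms obtain x y :: 'u and e :: "(real \<Rightarrow> 'u) \<Rightarrow> 'u" where xy: "x \<noteq> y" and e: "inj e"
    unfolding universe_def by blast
  from universe_pair[OF assms] obtain q :: "'u \<times> 'u \<Rightarrow> 'u" where q: "inj q" by blast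
  obtain g :: "(nat \<Rightarrow> real) \<Rightarrow> real" where g: "inj g" using inj_real_sequence_code by blast
  define F where "F = (\<lambda>f. e (\<lambda>r. f (inv_into UNIV g r) :: 'u))"
  have F: "F f = F f' \<longleftrightarrow> f = f'" for f f'
  proof
    assume "F f = F f'"
    then have "(\<lambda>r. f (inv_into UNIV g r)) = (\<lambda>r. f' (inv_into UNIV g r))"
      unfolding F_def by (rule injD[OF e])
    from fun_cong[OF this] show "f = f'"
      by (metis ext inv_into_f_f[OF g UNIV_I])
  qed simp
  \<comment> \<open>A sequence of reals is coded by the function that takes the value
    \<open>x\<close> only at its real code. The dimension is coded in the same way, as a constant
    sequence.\<close>
  define T where "T = (\<lambda>t. e (\<lambda>r. if r = g t then x else y))"
  have T: "T t = T t' \<longleftrightarrow> t = t'" for t t'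
  proof
    assume "T t = T t'"
    then have "(\<lambda>r. if r = g t then x else y) = (\<lambda>r. if r = g t' then x else y)"
      unfolding T_def by (rule injD[OF e])
    from fun_cong[OF this, of "g t"] xy have "g t = g t'" by (auto split: if_splits)
    then show "t = t'" by (rule injD[OF g])
  qed simp
  \<comment> \<open>The leading \<open>y\<close> separates these codes from \<open>q (x, x)\<close>,
    the code of \<open>Void\<close>.\<close>
  define N where "N = (\<lambda>n f (\<sigma> :: (nat \<Rightarrow> real) \<Rightarrow> 'u) t. q (y, q (T (\<lambda>_. real n), q (F f, q (F \<sigma>, T t)))))"
  have N: "N n f \<sigma> t = N n' f' \<sigma>' t' \<longleftrightarrow> n = n' \<and> f = f' \<and> \<sigma> = \<sigma>' \<and> t = t'" for n f \<sigma> t n' f' \<sigma>' t'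
    by (auto simp: N_def inj_eq[OF q] F T fun_eq_iff)
  have xN: "q (x, x) \<noteq> N n f \<sigma> t" for n f \<sigma> t using xy by (simp add: N_def inj_eq[OF q])
  have "pt_fold (q (x, x)) N u = pt_fold (q (x, x)) N v \<Longrightarrow> u = v" for u v
  proof (induction u arbitrary: v)
    case Void
    then show ?case using xN by (cases v) auto
  next
    case (Pt n a \<sigma> t)
    then obtain b where v: "v = Pt n b \<sigma> t"
      and eq: "(\<lambda>r. pt_fold (q (x, x)) N (a r)) = (\<lambda>r. pt_fold (q (x, x)) N (b r))"
      using xN[symmetric] by (cases v) (auto simp: N)
    have "a r = b r" for r using Pt.IH[of "a r" "b r"] fun_cong[OF eq, of r] by simp
    then show ?case using v by auto
  qed
  then have "inj (pt_fold (q (x, x)) N)" by (rule injI)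
  then show ?thesis by blast
qed



section \<open>Multiplication of cells\<close>

text \<open>Forgets the coordinates and keeps the open cell. In the recursion for products one
  factor may move within its cell while the other descends, so the termination order has to ignore
  coordinates.\<close>

primrec pt_key :: "'u pt \<Rightarrow> 'u pt" where
  "pt_key Void = Void"
| "pt_key (Pt n a \<sigma> t) = Pt n a \<sigma> (\<lambda>_. 0)"

definition pt_sub :: "('u pt \<times> 'u pt) set" where
  "pt_sub = {(x, y). \<exists>n a \<sigma> t r. y = Pt n a \<sigma> t \<and> x = pt_key (a r)}"

lemma wf_pt_sub: "wf (pt_sub :: ('u pt \<times> 'u pt) set)"
proof -
  \<comment> \<open>Accessibility of the key is carried along, since what lies below a point are the
    keys of its attaching points, not these points themselves.\<close>
  have "x \<in> Wellfounded.acc pt_sub \<and> pt_key x \<in> Wellfounded.acc pt_sub" for x :: "'u pt"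
  proof (induction x)
    case Void
    have "Void \<in> Wellfounded.acc pt_sub" by (rule accI) (simp add: pt_sub_def)
    then show ?case by simp
  next
    case (Pt n a \<sigma> t)
    have "Pt n a \<sigma> s \<in> Wellfounded.acc pt_sub" for s
    proof (rule accI)
      fix y assume "(y, Pt n a \<sigma> s) \<in> pt_sub"
      then obtain r where "y = pt_key (a r)" by (auto simp: pt_sub_def)
      then show "y \<in> Wellfounded.acc pt_sub" using Pt.IH[of "a r"] by simp
    qed
    then show ?case by simp
  qed
  then show ?thesis by (simp add: wf_iff_acc)
qed

text \<open>On the boundary of a product cell at least one of the two factors is replaced by a point of its
  attaching map, so the recursion terminates.\<close>

function pt_mult :: "('u \<Rightarrow> 'u \<Rightarrow> 'u) \<Rightarrow> 'u pt \<Rightarrow> 'u pt \<Rightarrow> 'u pt" where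
  "pt_mult f (Pt n a \<sigma> s) (Pt m b \<tau> t) = Pt (n + m)
     (\<lambda>r. if r \<in> cube_boundary (n + m) then
        if cube_left n r \<in> cube_boundary n then
          if cube_right n m r \<in> cube_boundary m then pt_mult f (a (cube_left n r)) (b (cube_right n m r))
          else pt_mult f (a (cube_left n r)) (Pt m b \<tau> (cube_right n m r))
        else pt_mult f (Pt n a \<sigma> (cube_left n r)) (b (cube_right n m r))
      else Void)
     (\<lambda>r\<in>topspace (cube (n + m)). f (\<sigma> (cube_left n r)) (\<tau> (cube_right n m r)))
     (cube_append n s t)"
| "pt_mult f Void q = Void"
| "pt_mult f (Pt n a \<sigma> s) Void = Void"
  by pat_completeness auto
termination
proof (relation "inv_image (pt_sub <*lex*> pt_sub) (\<lambda>(f, p, q). (pt_key p, pt_key q))")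
  show "wf (inv_image (pt_sub <*lex*> pt_sub) (\<lambda>(f, p, q). (pt_key p, pt_key q)))"
    by (simp add: wf_lex_prod wf_pt_sub)
qed (auto simp: pt_sub_def)

text \<open>The cell that \<open>pt_mult\<close> creates out of interior points, written with
  characteristic maps, which absorb the case distinction of the recursion.\<close>

definition cell_mult :: "('u \<Rightarrow> 'u \<Rightarrow> 'u) \<Rightarrow> 'u cell \<Rightarrow> 'u cell \<Rightarrow> 'u cell" where
  "cell_mult f c d = (fst c + fst d,
     (\<lambda>r. if r \<in> cube_boundary (fst c + fst d)
       then pt_mult f (cell_map c (cube_left (fst c) r)) (cell_map d (cube_right (fst c) (fst d) r)) else Void),
     (\<lambda>r\<in>topspace (cube (fst c + fst d)).
       f (snd (snd c) (cube_left (fst c) r)) (snd (snd d) (cube_right (fst c) (fst d) r))))"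

lemma fst_cell_mult [simp]: "fst (cell_mult f c d) = fst c + fst d"
  by (simp add: cell_mult_def)

lemma cell_map_boundary: "t \<in> cube_boundary (fst c) \<Longrightarrow> cell_map c t = fst (snd c) t"
  and cell_map_interior: "t \<notin> cube_boundary (fst c) \<Longrightarrow> cell_map c t = Pt (fst c) (fst (snd c)) (snd (snd c)) t"
  by (simp_all add: cell_map_def case_prod_unfold)

text \<open>On the boundary the right side is the attaching map of the product cell, which is a
  product of characteristic maps by definition; in the interior the cases of the recursion match the
  values of the two characteristic maps. Computing with \<open>pt_mult\<close> thereby becomes
  concatenation of coordinates.\<close>

lemma pt_mult_cell_map:
  assumes s: "s \<in> topspace (cube (fst c))" and t: "t \<in> topspace (cube (fst d))"
  shows "pt_mult f (cell_map c s) (cell_map d t) = cell_map (cell_mult f c d) (cube_append (fst c) s t)"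
proof (cases "s \<in> cube_boundary (fst c) \<or> t \<in> cube_boundary (fst d)")
  case True
  then have "cube_append (fst c) s t \<in> cube_boundary (fst c + fst d)"
    using cube_boundary_append_iff[OF cube_append_in[OF s t]] s t by simp
  then show ?thesis using s t by (simp add: cell_map_boundary) (simp add: cell_mult_def)
next
  case False
  then have st: "s \<notin> cube_boundary (fst c)" "t \<notin> cube_boundary (fst d)" by auto
  then have "cube_append (fst c) s t \<notin> cube_boundary (fst c + fst d)"
    using cube_boundary_append_iff[OF cube_append_in[OF s t]] s t by simp
  then have "cell_map (cell_mult f c d) (cube_append (fst c) s t) =
      Pt (fst c + fst d) (fst (snd (cell_mult f c d))) (snd (snd (cell_mult f c d))) (cube_append (fst c) s t)"
    by (simp add: cell_map_interior)
  also have "\<dots> = pt_mult f (cell_map c s) (cell_map d t)"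
  proof -
    have "cube_left (fst c) r \<in> cube_boundary (fst c) \<or> cube_right (fst c) (fst d) r \<in> cube_boundary (fst d)"
      if "r \<in> cube_boundary (fst c + fst d)" for r
      using that cube_boundary_append_iff subsetD[OF cube_boundary_subset that] by blast
    then show ?thesis
      by (auto simp: cell_map_interior[OF st(1)] cell_map_interior[OF st(2)] cell_mult_def fun_eq_iff
          cell_map_boundary cell_map_interior)
  qed
  finally show ?thesis ..
qed

text \<open>A boundary point of a cell is a point of an earlier cell; descending in this way ends in
  the interior of some cell. There \<open>cell_map\<close> is a \<open>Pt\<close> term, on which the
  recursive definitions compute.\<close>

lemma cell_point_form:
  assumes "c \<in> cells P" "t \<in> topspace (cube (fst c))"
  obtains d s where "d \<in> cells P" "s \<in> topspace (cube (fst d))" "s \<notin> cube_boundary (fst d)" "cell_map c t = cell_map d s"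
proof -
  define R where "R = (\<lambda>c. \<forall>t \<in> topspace (cube (fst c)). \<exists>d s. d \<in> cells P \<and> s \<in> topspace (cube (fst d)) \<and>
      s \<notin> cube_boundary (fst d) \<and> cell_map c t = cell_map d s)"
  have "R c"
    using assms(1)
  proof (induction rule: cells_induct)
    case (attach c)
    show ?case
      unfolding R_def
    proof
      fix t assume t: "t \<in> topspace (cube (fst c))"
      show "\<exists>d s. d \<in> cells P \<and> s \<in> topspace (cube (fst d)) \<and> s \<notin> cube_boundary (fst d) \<and> cell_map c t = cell_map d s"
      proof (cases "t \<in> cube_boundary (fst c)")
        case True
        obtain n a \<sigma> where c: "c = (n, a, \<sigma>)" by (cases c) auto
        from True have bd: "t \<in> cube_boundary n" by (simp add: c)
        obtain c' t' where "c' \<in> cells P \<inter> {c. R c}" "t' \<in> topspace (cube (fst c'))" "a t = cell_map c' t'"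
          using attaching_point[OF attach(1)[unfolded c] bd] .
        then have "R c'" "t' \<in> topspace (cube (fst c'))" "cell_map c t = cell_map c' t'"
          using bd by (simp_all add: cell_map_boundary c)
        then show ?thesis unfolding R_def by metis
      next
        case False
        then show ?thesis using attach(2) t by blast
      qed
    qed
  qed
  then show ?thesis using assms(2) that unfolding R_def by blast
qed

lemma resolution_point:
  assumes "q \<in> topspace (resolution P)"
  obtains c t where "c \<in> cells P" "t \<in> topspace (cube (fst c))" "t \<notin> cube_boundary (fst c)" "q = cell_map c t"
proof -
  obtain c t where "c \<in> cells P" "t \<in> topspace (cube (fst c))" "q = cell_map c t"
    using assms by (auto simp: resolution_def topspace_cell_space cell_points_def)
  then show ?thesis using cell_point_form that by metis
qed

text \<open>Both points are presented in the interior of cells, where \<open>pt_mult\<close> is a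
  \<open>Pt\<close> term and its value is read off the covered cube.\<close>

lemma pt_value_mult:
  assumes p: "p \<in> topspace (resolution P)" and q: "q \<in> topspace (resolution P)"
  shows "pt_value (pt_mult f p q) = f (pt_value p) (pt_value q)"
proof -
  obtain c s where c: "c \<in> cells P" "s \<in> topspace (cube (fst c))" "s \<notin> cube_boundary (fst c)" "p = cell_map c s"
    using resolution_point[OF p] .
  obtain d t where d: "d \<in> cells P" "t \<in> topspace (cube (fst d))" "t \<notin> cube_boundary (fst d)" "q = cell_map d t"
    using resolution_point[OF q] .
  show ?thesis
    using c d cube_append_in[OF c(2) d(2)] by (simp add: cell_map_interior)
qed

section \<open>Products of cells over a flow\<close>

context
  fixes X :: "'u flow"
  assumes X: "is_flow X"
begin

lemma flow_ends_constant:
  assumes "connected_space Z" "continuous_map Z (paths X) \<sigma>" "s \<in> topspace Z" "t \<in> topspace Z"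
  shows "src X (\<sigma> s) = src X (\<sigma> t)" "tgt X (\<sigma> s) = tgt X (\<sigma> t)"
proof -
  have "continuous_map (paths X) (discrete_topology (states X)) (src X)"
    "continuous_map (paths X) (discrete_topology (states X)) (tgt X)"
    using X by (simp_all add: is_flow_def)
  from this[THEN continuous_map_compose[OF assms(2)], THEN continuous_map_discrete_constant[OF assms(1)], OF assms(3,4)]
  show "src X (\<sigma> s) = src X (\<sigma> t)" "tgt X (\<sigma> s) = tgt X (\<sigma> t)" by simp_all
qed

lemma continuous_map_cube_pcomp:
  assumes f: "continuous_map (cube n) (paths X) f" and g: "continuous_map (cube n) (paths X) g"
    and fg: "\<And>x. x \<in> topspace (cube n) \<Longrightarrow> tgt X (f x) = src X (g x)"
  shows "continuous_map (cube n) (paths X) (\<lambda>x. pcomp X (f x) (g x))"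
proof -
  have "continuous_map (cube n) (subtopology (delta_prod (paths X) (paths X)) (composable X)) (\<lambda>x. (f x, g x))"
    using f g fg continuous_map_funspace[OF f] continuous_map_funspace[OF g]
    by (auto simp: continuous_map_in_subtopology continuous_map_cube_delta_prod o_def composable_def)
  moreover have "continuous_map (subtopology (delta_prod (paths X) (paths X)) (composable X)) (paths X)
       (\<lambda>(x, y). pcomp X x y)" using X by (simp add: is_flow_def)
  ultimately show ?thesis using continuous_map_compose by (fastforce simp: o_def)
qed

definition cells_composable :: "'u cell \<Rightarrow> 'u cell \<Rightarrow> bool" where
  "cells_composable c d \<longleftrightarrow> (\<forall>s \<in> topspace (cube (fst c)). \<forall>t \<in> topspace (cube (fst d)).
     tgt X (pt_value (cell_map c s)) = src X (pt_value (cell_map d t)))"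

lemma cell_continuous: "c \<in> cells P \<Longrightarrow> continuous_map (cube (fst c)) P (\<lambda>s. pt_value (cell_map c s))"
  using continuous_map_compose[OF continuous_map_cell_map continuous_map_pt_value[unfolded resolution_def]]
  by (simp add: o_def)

text \<open>States are discrete and cubes are connected, so one composable pair of points decides
  for all pairs.\<close>

lemma cells_composable_if:
  assumes c: "c \<in> cells (paths X)" and d: "d \<in> cells (paths X)"
    and st: "s \<in> topspace (cube (fst c))" "t \<in> topspace (cube (fst d))"
    and eq: "tgt X (pt_value (cell_map c s)) = src X (pt_value (cell_map d t))"
  shows "cells_composable c d"
  unfolding cells_composable_def
proof (intro ballI)
  fix s' t' assume s': "s' \<in> topspace (cube (fst c))" and t': "t' \<in> topspace (cube (fst d))"
  show "tgt X (pt_value (cell_map c s')) = src X (pt_value (cell_map d t'))"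
    using flow_ends_constant(2)[OF connected_space_cube cell_continuous[OF c] s' st(1)]
      flow_ends_constant(1)[OF connected_space_cube cell_continuous[OF d] t' st(2)] eq by simp
qed

text \<open>Extending the multiplication by the first projection to pairs that are not composable gives a
  map that is defined everywhere, hence can be tested on pairs of cells.\<close>

definition pt_mult_total :: "'u pt \<Rightarrow> 'u pt \<Rightarrow> 'u pt" where
  "pt_mult_total p q = (if tgt X (pt_value p) = src X (pt_value q) then pt_mult (pcomp X) p q else p)"

abbreviation "Res \<equiv> resolution (paths X)"

text \<open>Two cells are composable everywhere or nowhere. In the first case the map is the
  characteristic map of the product cell, in the second a projection followed by that of
  \<open>c\<close>. Membership of the product is an assumption because the lemma serves inside the
  induction that proves it.\<close>

lemma continuous_map_pt_mult_total_cells: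
  assumes c: "c \<in> cells (paths X)" and d: "d \<in> cells (paths X)"
    and prod: "cells_composable c d \<Longrightarrow> cell_mult (pcomp X) c d \<in> cells (paths X)"
  shows "continuous_map (prod_topology (cube (fst c)) (cube (fst d))) Res
    (\<lambda>(s, t). pt_mult_total (cell_map c s) (cell_map d t))"
proof (cases "cells_composable c d")
  case True
  from continuous_map_compose[OF continuous_map_cube_append, of "fst c" "fst d" Res "cell_map (cell_mult (pcomp X) c d)"]
    continuous_map_cell_map[OF prod[OF True]]
  have "continuous_map (prod_topology (cube (fst c)) (cube (fst d))) Res
      (\<lambda>(s, t). cell_map (cell_mult (pcomp X) c d) (cube_append (fst c) s t))"
    by (simp add: resolution_def o_def case_prod_unfold)
  then show ?thesis
    by (rule continuous_map_eq)
      (use True in \<open>auto simp: pt_mult_total_def cells_composable_def pt_mult_cell_map\<close>)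
next
  case False
  have "continuous_map (prod_topology (cube (fst c)) (cube (fst d))) Res (\<lambda>(s, t). cell_map c s)"
    using continuous_map_compose[OF continuous_map_fst continuous_map_cell_map[OF c]]
    by (simp add: resolution_def o_def case_prod_unfold)
  moreover have "tgt X (pt_value (cell_map c s)) \<noteq> src X (pt_value (cell_map d t))"
    if "s \<in> topspace (cube (fst c))" "t \<in> topspace (cube (fst d))" for s t
    using False cells_composable_if[OF c d that] by blast
  ultimately show ?thesis
    by (elim continuous_map_eq) (auto simp: pt_mult_total_def)
qed

text \<open>Nested induction on the two cells. A boundary point of the product cell has boundary
  coordinates in one of the factors; there the attaching map of that factor leads to an earlier
  product, known to be a cell by one of the two induction hypotheses.\<close>

lemma cell_mult_in_cells:
  assumes "c \<in> cells (paths X)" "d \<in> cells (paths X)" "cells_composable c d"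
  shows "cell_mult (pcomp X) c d \<in> cells (paths X)"
proof -
  let ?C = "cells (paths X)" and ?m = "cell_mult (pcomp X)"
  have "\<forall>d \<in> ?C. cells_composable c d \<longrightarrow> ?m c d \<in> ?C" using assms(1)
  proof (induction rule: cells_induct)
    case (attach c)
    note c = attach
    show ?case
    proof
      fix d assume "d \<in> ?C"
      then show "cells_composable c d \<longrightarrow> ?m c d \<in> ?C"
      proof (induction rule: cells_induct)
        case (attach d)
        let ?G = "?C \<inter> {c. \<forall>d \<in> ?C. cells_composable c d \<longrightarrow> ?m c d \<in> ?C}"
        let ?H = "?C \<inter> {d. cells_composable c d \<longrightarrow> ?m c d \<in> ?C}"
        obtain n a \<sigma> where c': "c = (n, a, \<sigma>)" by (cases c) auto
        obtain m b \<tau> where d': "d = (m, b, \<tau>)" by (cases d) auto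
        have a: "continuous_map (boundary_space n) (cell_space ?G) a" using c(1) by (simp add: c' attachable_def)
        have b: "continuous_map (boundary_space m) (cell_space ?H) b" using attach(1) by (simp add: d' attachable_def)
        have s: "continuous_map (cube n) (paths X) \<sigma>" using c(1) by (simp add: c' attachable_def)
        have t: "continuous_map (cube m) (paths X) \<tau>" using attach(1) by (simp add: d' attachable_def)
        have vc: "pt_value (cell_map c x) = \<sigma> x" if "x \<in> topspace (cube n)" for x
          using cell_map_value[OF c(1)] that by (simp add: c')
        have vd: "pt_value (cell_map d x) = \<tau> x" if "x \<in> topspace (cube m)" for x
          using cell_map_value[OF attach(1)] that by (simp add: d')
        \<comment> \<open>The cube of \<open>d\<close> is compact Hausdorff, so continuity may be
          tested on the cells in \<open>?G\<close>, whose products with \<open>d\<close> are cells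
          by the outer hypothesis. \<open>F2\<close> exchanges the roles and uses the inner
          one.\<close>
        have F1: "continuous_map (prod_topology (cube m) (cell_space ?G)) Res
            (\<lambda>(x, q). pt_mult_total q (cell_map d x))"
        proof (rule continuous_map_prod_cell_space[OF compact_space_cube Hausdorff_space_cube])
          fix e assume e: "e \<in> ?G"
          have "continuous_map (prod_topology (cube (fst e)) (cube (fst d))) Res
              (\<lambda>(s, t). pt_mult_total (cell_map e s) (cell_map d t))"
            using e attach(2) by (intro continuous_map_pt_mult_total_cells) auto
          from continuous_map_compose[OF continuous_map_swap this[unfolded d' fst_conv]]
          show "continuous_map (prod_topology (cube m) (cube (fst e))) Res
              (\<lambda>(k, t). (\<lambda>(x, q). pt_mult_total q (cell_map d x)) (k, cell_map e t))"
            by (simp add: case_prod_unfold o_def d')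
        qed
        have F2: "continuous_map (prod_topology (cube n) (cell_space ?H)) Res
            (\<lambda>(x, q). pt_mult_total (cell_map c x) q)"
        proof (rule continuous_map_prod_cell_space[OF compact_space_cube Hausdorff_space_cube])
          fix e assume e: "e \<in> ?H"
          have "continuous_map (prod_topology (cube (fst c)) (cube (fst e))) Res
              (\<lambda>(s, t). pt_mult_total (cell_map c s) (cell_map e t))"
            using e c(2) by (intro continuous_map_pt_mult_total_cells) auto
          then show "continuous_map (prod_topology (cube n) (cube (fst e))) Res
              (\<lambda>(k, t). (\<lambda>(x, q). pt_mult_total (cell_map c x) q) (k, cell_map e t))"
            by (simp add: case_prod_unfold c')
        qed
        show ?case
        proof
          assume comp: "cells_composable c d"
          let ?X = "boundary_space (n + m)"
          let ?e = "\<lambda>r. pt_mult_total (cell_map c (cube_left n r)) (cell_map d (cube_right n m r))"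
          have L: "continuous_map ?X (cube n) (cube_left n)" and R: "continuous_map ?X (cube m) (cube_right n m)"
            by (simp_all add: continuous_map_from_subtopology continuous_map_cube_left continuous_map_cube_right)
          let ?A = "{r \<in> topspace ?X. cube_left n r \<in> cube_boundary n}"
          let ?B = "{r \<in> topspace ?X. cube_right n m r \<in> cube_boundary m}"
          \<comment> \<open>Both branches are the same map; the case distinction only brings it into
            the form of the pasting lemma for two closed sets.\<close>
          have "continuous_map ?X Res (\<lambda>r. if r \<in> ?A then ?e r else ?e r)"
          proof (rule continuous_map_two_closed)
            show "closedin ?X ?A" by (rule closedin_continuous_map_preimage[OF L closedin_cube_boundary])
            show "closedin ?X ?B" by (rule closedin_continuous_map_preimage[OF R closedin_cube_boundary])
            show "topspace ?X \<subseteq> ?A \<union> ?B" using cube_boundary_append_iff by auto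
            have "continuous_map (subtopology ?X ?A) (boundary_space n) (cube_left n)"
              using L by (auto simp: continuous_map_in_subtopology continuous_map_from_subtopology)
            from continuous_map_compose[OF continuous_map_pairedI[OF continuous_map_from_subtopology[OF R] continuous_map_compose[OF this a]] F1]
            have "continuous_map (subtopology ?X ?A) Res (\<lambda>r. pt_mult_total (a (cube_left n r)) (cell_map d (cube_right n m r)))"
              by (simp add: o_def)
            then show "continuous_map (subtopology ?X ?A) Res ?e"
              by (rule continuous_map_eq) (auto simp: c' cell_map_boundary)
            have "continuous_map (subtopology ?X ?B) (boundary_space m) (cube_right n m)"
              using R by (auto simp: continuous_map_in_subtopology continuous_map_from_subtopology)
            from continuous_map_compose[OF continuous_map_pairedI[OF continuous_map_from_subtopology[OF L] continuous_map_compose[OF this b]] F2]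
            have "continuous_map (subtopology ?X ?B) Res (\<lambda>r. pt_mult_total (cell_map c (cube_left n r)) (b (cube_right n m r)))"
              by (simp add: o_def)
            then show "continuous_map (subtopology ?X ?B) Res ?e"
              by (rule continuous_map_eq) (auto simp: d' cell_map_boundary)
          qed simp
          then have e: "continuous_map ?X Res ?e" by simp
          have e_eq: "?e r = pt_mult (pcomp X) (cell_map c (cube_left n r)) (cell_map d (cube_right n m r))"
            if "r \<in> topspace (cube (n + m))" for r
            using comp cube_left_in[OF that] cube_right_in[OF that]
            by (simp add: pt_mult_total_def cells_composable_def c' d')
          have "?m c d \<in> attachable (paths X) ?C"
            unfolding cell_mult_def attachable_def
          proof (clarsimp simp only: mem_Collect_eq prod.case c' d' fst_conv snd_conv, intro conjI allI ballI impI)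
            show "continuous_map (boundary_space (n + m)) (cell_space ?C)
                (\<lambda>r. if r \<in> cube_boundary (n + m) then pt_mult (pcomp X) (cell_map (n, a, \<sigma>) (cube_left n r))
                  (cell_map (m, b, \<tau>) (cube_right n m r)) else Void)"
              by (rule continuous_map_eq[OF e[unfolded resolution_def]])
                (use e_eq in \<open>auto simp: c' d' topspace_boundary_space\<close>)
            have "continuous_map (cube (n + m)) (paths X) (\<lambda>r. pcomp X (\<sigma> (cube_left n r)) (\<tau> (cube_right n m r)))"
            proof (rule continuous_map_cube_pcomp)
              show "continuous_map (cube (n + m)) (paths X) (\<lambda>r. \<sigma> (cube_left n r))"
                using continuous_map_compose[OF continuous_map_cube_left s] by (simp add: o_def)
              show "continuous_map (cube (n + m)) (paths X) (\<lambda>r. \<tau> (cube_right n m r))"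
                using continuous_map_compose[OF continuous_map_cube_right t] by (simp add: o_def)
              show "tgt X (\<sigma> (cube_left n r)) = src X (\<tau> (cube_right n m r))" if "r \<in> topspace (cube (n + m))" for r
                using comp cube_left_in[OF that] cube_right_in[OF that] vc vd
                by (simp add: cells_composable_def c' d')
            qed
            then show "continuous_map (cube (n + m)) (paths X)
                (\<lambda>r\<in>topspace (cube (n + m)). pcomp X (\<sigma> (cube_left n r)) (\<tau> (cube_right n m r)))"
              by (rule continuous_map_eq) simp
            fix r assume r: "r \<in> cube_boundary (n + m)"
            then have r': "r \<in> topspace (cube (n + m))" using cube_boundary_subset by blast
            have "cell_map c (cube_left n r) \<in> topspace Res" "cell_map d (cube_right n m r) \<in> topspace Res"
              using c(2) attach(2) cube_left_in[OF r'] cube_right_in[OF r']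
              by (auto simp: resolution_def topspace_cell_space cell_points_def c' d' intro: bexI[rotated])
            then show "pt_value (if r \<in> cube_boundary (n + m) then pt_mult (pcomp X) (cell_map (n, a, \<sigma>) (cube_left n r))
                  (cell_map (m, b, \<tau>) (cube_right n m r)) else Void) =
                (\<lambda>r\<in>topspace (cube (n + m)). pcomp X (\<sigma> (cube_left n r)) (\<tau> (cube_right n m r))) r"
              using r r' vc[OF cube_left_in[OF r']] vd[OF cube_right_in[OF r']] by (simp add: pt_value_mult c' d')
          qed auto
          then show "?m c d \<in> ?C" using cells_unfold by blast
        qed
      qed
    qed
  qed
  then show ?thesis using assms by blast
qed

text \<open>The product of two copies of the complex is never tested directly. One variable at a
  time runs over cells while the other stays in a compact Hausdorff space, and composition with the
  graph of \<open>f\<close> gives the result.\<close>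

lemma continuous_map_resolution_mult:
  assumes K: "compact_space K" "Hausdorff_space K"
    and f: "continuous_map K Res f" and g: "continuous_map K Res g"
    and fg: "\<And>x. x \<in> topspace K \<Longrightarrow> tgt X (pt_value (f x)) = src X (pt_value (g x))"
  shows "continuous_map K Res (\<lambda>x. pt_mult (pcomp X) (f x) (g x))"
proof -
  let ?C = "cells (paths X)"
  have 1: "continuous_map (prod_topology (cube (fst c)) Res) Res (\<lambda>(s, q). pt_mult_total (cell_map c s) q)"
    if c: "c \<in> ?C" for c
    unfolding resolution_def[of "paths X"]
  proof (rule continuous_map_prod_cell_space[OF compact_space_cube Hausdorff_space_cube])
    fix d assume d: "d \<in> ?C"
    show "continuous_map (prod_topology (cube (fst c)) (cube (fst d))) (cell_space ?C)
        (\<lambda>(k, t). case (k, cell_map d t) of (s, q) \<Rightarrow> pt_mult_total (cell_map c s) q)"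
      using continuous_map_pt_mult_total_cells[OF c d] cell_mult_in_cells[OF c d] by (simp add: resolution_def)
  qed
  have 2: "continuous_map (prod_topology K Res) Res (\<lambda>(x, q). pt_mult_total q (g x))"
    unfolding resolution_def[of "paths X"]
  proof (rule continuous_map_prod_cell_space[OF K])
    fix c assume c: "c \<in> ?C"
    have "continuous_map (prod_topology K (cube (fst c))) (prod_topology (cube (fst c)) Res) (\<lambda>z. (snd z, (g \<circ> fst) z))"
      by (intro continuous_map_pairedI continuous_map_snd continuous_map_compose[OF continuous_map_fst g])
    from continuous_map_compose[OF this 1[OF c]]
    show "continuous_map (prod_topology K (cube (fst c))) (cell_space ?C)
        (\<lambda>(k, t). case (k, cell_map c t) of (x, q) \<Rightarrow> pt_mult_total q (g x))"
      by (simp add: resolution_def o_def case_prod_unfold)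
  qed
  have "continuous_map K (prod_topology K Res) (\<lambda>x. (x, f x))" using f by (simp add: continuous_map_paired)
  from continuous_map_compose[OF this 2] have "continuous_map K Res (\<lambda>x. pt_mult_total (f x) (g x))" by (simp add: o_def)
  then show ?thesis by (rule continuous_map_eq) (simp add: pt_mult_total_def fg)
qed

lemma pcomp_assoc_flow:
  assumes "x \<in> topspace (paths X)" "y \<in> topspace (paths X)" "z \<in> topspace (paths X)"
    "tgt X x = src X y" "tgt X y = src X z"
  shows "pcomp X (pcomp X x y) z = pcomp X x (pcomp X y z)"
  using X assms unfolding is_flow_def composable_def by blast

text \<open>Dimensions agree by associativity of addition, covered cubes by associativity in the
  flow. Attaching maps are compared at a boundary point, where one of the three factors lies in an
  earlier cell and the induction hypothesis for that factor applies.\<close>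

lemma cell_mult_assoc:
  assumes "c \<in> cells (paths X)" "d \<in> cells (paths X)" "e \<in> cells (paths X)"
    "cells_composable c d" "cells_composable d e"
  shows "cell_mult (pcomp X) (cell_mult (pcomp X) c d) e = cell_mult (pcomp X) c (cell_mult (pcomp X) d e)"
proof -
  let ?C = "cells (paths X)" and ?m = "cell_mult (pcomp X)" and ?p = "pt_mult (pcomp X)"
  \<comment> \<open>Composability is kept as a premise of the induction statement; for the earlier
    cells met on the boundary it is recovered by \<open>cd\<close> from a single pair of
    points.\<close>
  define A where "A = (\<lambda>c d e. cells_composable c d \<longrightarrow> cells_composable d e \<longrightarrow> ?m (?m c d) e = ?m c (?m d e))"
  have pt: "?p (?p (cell_map c x) (cell_map d y)) (cell_map e z) = ?p (cell_map c x) (?p (cell_map d y) (cell_map e z))"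
    if "A c d e" "cells_composable c d" "cells_composable d e" "x \<in> topspace (cube (fst c))" "y \<in> topspace (cube (fst d))"
      "z \<in> topspace (cube (fst e))" for c d e x y z
    using that by (simp add: pt_mult_cell_map cube_append_in cube_append_assoc A_def)
  have cd: "cells_composable c d \<longleftrightarrow> tgt X (pt_value (cell_map c x)) = src X (pt_value (cell_map d y))"
    if "c \<in> ?C" "d \<in> ?C" "x \<in> topspace (cube (fst c))" "y \<in> topspace (cube (fst d))" for c d x y
    using cells_composable_if that unfolding cells_composable_def by blast
  \<comment> \<open>The sets \<open>G\<close>, \<open>H\<close> and \<open>L\<close> carry the
    induction hypotheses for the three factors; the nested inductions at the end only instantiate
    them.\<close>
  have step: "A c d e"
    if c: "c \<in> attachable (paths X) G" "G \<subseteq> ?C" and d: "d \<in> attachable (paths X) H" "H \<subseteq> ?C"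
      and e: "e \<in> attachable (paths X) L" "L \<subseteq> ?C"
      and cC: "c \<in> ?C" and dC: "d \<in> ?C" and eC: "e \<in> ?C"
      and IH1: "\<And>c'. c' \<in> G \<Longrightarrow> A c' d e" and IH2: "\<And>d'. d' \<in> H \<Longrightarrow> A c d' e" and IH3: "\<And>e'. e' \<in> L \<Longrightarrow> A c d e'"
    for c d e G H L
    unfolding A_def
  proof (intro impI)
    assume comp: "cells_composable c d" "cells_composable d e"
    obtain n a \<sigma> where c': "c = (n, a, \<sigma>)" by (cases c) auto
    obtain m b \<tau> where d': "d = (m, b, \<tau>)" by (cases d) auto
    obtain l g \<upsilon> where e': "e = (l, g, \<upsilon>)" by (cases e) auto
    have key: "?p (?p (cell_map c x) (cell_map d y)) (cell_map e z) = ?p (cell_map c x) (?p (cell_map d y) (cell_map e z))"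
      if x: "x \<in> topspace (cube n)" and y: "y \<in> topspace (cube m)" and z: "z \<in> topspace (cube l)"
        and bd: "x \<in> cube_boundary n \<or> y \<in> cube_boundary m \<or> z \<in> cube_boundary l" for x y z
    proof -
      note xyz = x y z
      have t1: "tgt X (pt_value (cell_map c x)) = src X (pt_value (cell_map d y))"
        and t2: "tgt X (pt_value (cell_map d y)) = src X (pt_value (cell_map e z))"
        using comp xyz by (auto simp: cells_composable_def c' d' e')
      from bd consider "x \<in> cube_boundary n" | "y \<in> cube_boundary m" | "z \<in> cube_boundary l" by blast
      then show ?thesis
      proof cases
        case 1
        obtain c1 x1 where c1: "c1 \<in> G" "x1 \<in> topspace (cube (fst c1))" "a x = cell_map c1 x1"
          using attaching_point[OF c(1)[unfolded c'] 1] .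
        then have eq: "cell_map c x = cell_map c1 x1" using 1 by (simp add: cell_map_boundary c')
        have "cells_composable c1 d"
          using cd[of c1 d x1 y] c1 c(2) dC y t1 eq by (auto simp: d')
        then show ?thesis unfolding eq using pt[OF IH1[OF c1(1)] _ comp(2) c1(2)] xyz by (simp add: d' e')
      next
        case 2
        obtain d1 y1 where d1: "d1 \<in> H" "y1 \<in> topspace (cube (fst d1))" "b y = cell_map d1 y1"
          using attaching_point[OF d(1)[unfolded d'] 2] .
        then have eq: "cell_map d y = cell_map d1 y1" using 2 by (simp add: cell_map_boundary d')
        have "cells_composable c d1" "cells_composable d1 e"
          using cd[of c d1 x y1] cd[of d1 e y1 z] d1 d(2) cC eC xyz t1 t2 eq by (auto simp: c' e')
        then show ?thesis unfolding eq using pt[OF IH2[OF d1(1)] _ _ _ d1(2)] xyz by (simp add: c' e')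
      next
        case 3
        obtain e1 z1 where e1: "e1 \<in> L" "z1 \<in> topspace (cube (fst e1))" "g z = cell_map e1 z1"
          using attaching_point[OF e(1)[unfolded e'] 3] .
        then have eq: "cell_map e z = cell_map e1 z1" using 3 by (simp add: cell_map_boundary e')
        have "cells_composable d e1"
          using cd[of d e1 y z1] e1 e(2) dC y t2 eq by (auto simp: d')
        then show ?thesis unfolding eq using pt[OF IH3[OF e1(1)] comp(1) _ _ _ e1(2)] xyz by (simp add: c' d')
      qed
    qed
    have split: "\<exists>x y z. x \<in> topspace (cube n) \<and> y \<in> topspace (cube m) \<and> z \<in> topspace (cube l) \<and>
        r = cube_append (n + m) (cube_append n x y) z \<and> r = cube_append n x (cube_append m y z)"
      if "r \<in> topspace (cube (n + m + l))" for r
    proof (intro exI conjI)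
      let ?u = "cube_left (n + m) r"
      have u: "?u \<in> topspace (cube (n + m))" by (rule cube_left_in[OF that])
      show "cube_left n ?u \<in> topspace (cube n)" by (rule cube_left_in[OF u])
      show "cube_right n m ?u \<in> topspace (cube m)" by (rule cube_right_in[OF u])
      show "cube_right (n + m) l r \<in> topspace (cube l)" by (rule cube_right_in[OF that])
      show "r = cube_append (n + m) (cube_append n (cube_left n ?u) (cube_right n m ?u)) (cube_right (n + m) l r)"
        using cube_append_left_right[OF u] cube_append_left_right[OF that] by simp
      then show "r = cube_append n (cube_left n ?u) (cube_append m (cube_right n m ?u) (cube_right (n + m) l r))"
        by (simp only: cube_append_assoc)
    qed
    have fsts: "fst c = n" "fst d = m" "fst e = l" by (auto simp: c' d' e')
    have att: "fst (snd (?m (?m c d) e)) r = fst (snd (?m c (?m d e))) r" for r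
    proof (cases "r \<in> cube_boundary (n + m + l)")
      case True
      then have r: "r \<in> topspace (cube (n + m + l))" using cube_boundary_subset by blast
      from split[OF this] obtain x y z where x: "x \<in> topspace (cube n)" and y: "y \<in> topspace (cube m)"
        and z: "z \<in> topspace (cube l)" and r1: "r = cube_append (n + m) (cube_append n x y) z"
        and r2: "r = cube_append n x (cube_append m y z)" by blast
      note xy = cube_append_in[OF x y] and yz = cube_append_in[OF y z]
      have "x \<in> cube_boundary n \<or> y \<in> cube_boundary m \<or> z \<in> cube_boundary l"
        using True cube_boundary_append_iff[OF r] cube_boundary_append_iff[OF xy] x y z xy r1 by auto
      note k = key[OF x y z this]
      have "fst (snd (?m (?m c d) e)) r = ?p (cell_map (?m c d) (cube_left (n + m) r)) (cell_map e (cube_right (n + m) l r))"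
        using True by (subst (1) cell_mult_def) (simp add: fsts)
      also have "\<dots> = ?p (?p (cell_map c x) (cell_map d y)) (cell_map e z)"
        using xy x y z by (simp add: r1 pt_mult_cell_map fsts)
      also have "\<dots> = ?p (cell_map c x) (cell_map (?m d e) (cube_append m y z))"
        using k y z by (simp add: pt_mult_cell_map fsts)
      also have "\<dots> = fst (snd (?m c (?m d e))) r"
        using True x yz by (subst (2) cell_mult_def) (simp add: fsts r2 add.assoc)
      finally show ?thesis .
    qed (simp add: cell_mult_def[of _ "?m c d"] cell_mult_def[of _ c "?m d e"] fsts add.assoc)
    have val: "snd (snd (?m (?m c d) e)) r = snd (snd (?m c (?m d e))) r" for r
    proof (cases "r \<in> topspace (cube (n + m + l))")
      case True
      from split[OF this] obtain x y z where x: "x \<in> topspace (cube n)" and y: "y \<in> topspace (cube m)"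
        and z: "z \<in> topspace (cube l)" and r1: "r = cube_append (n + m) (cube_append n x y) z"
        and r2: "r = cube_append n x (cube_append m y z)" by blast
      note xy = cube_append_in[OF x y] and yz = cube_append_in[OF y z]
      have s: "\<sigma> x = pt_value (cell_map c x)" and t: "\<tau> y = pt_value (cell_map d y)" and u: "\<upsilon> z = pt_value (cell_map e z)"
        using cell_map_value[OF c(1)] cell_map_value[OF d(1)] cell_map_value[OF e(1)] x y z by (simp_all add: c' d' e')
      have "pcomp X (pcomp X (\<sigma> x) (\<tau> y)) (\<upsilon> z) = pcomp X (\<sigma> x) (pcomp X (\<tau> y) (\<upsilon> z))"
      proof (rule pcomp_assoc_flow)
        show "\<sigma> x \<in> topspace (paths X)" "\<tau> y \<in> topspace (paths X)" "\<upsilon> z \<in> topspace (paths X)"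
          unfolding s t u
          using funcset_mem[OF continuous_map_funspace[OF cell_continuous[OF cC]]]
            funcset_mem[OF continuous_map_funspace[OF cell_continuous[OF dC]]]
            funcset_mem[OF continuous_map_funspace[OF cell_continuous[OF eC]]] x y z fsts by simp_all
        show "tgt X (\<sigma> x) = src X (\<tau> y)" "tgt X (\<tau> y) = src X (\<upsilon> z)"
          unfolding s t u using comp x y z fsts by (simp_all add: cells_composable_def)
      qed
      moreover have "snd (snd (?m (?m c d) e)) r = pcomp X (snd (snd (?m c d)) (cube_append n x y)) (\<upsilon> z)"
        using True xy z by (subst (1) cell_mult_def) (simp add: fsts r1, simp add: e')
      moreover have "snd (snd (?m c d)) (cube_append n x y) = pcomp X (\<sigma> x) (\<tau> y)"
        using xy x y by (simp add: cell_mult_def fsts) (simp add: c' d')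
      moreover have "snd (snd (?m c (?m d e))) r = pcomp X (\<sigma> x) (snd (snd (?m d e)) (cube_append m y z))"
        using True x yz by (subst (1) cell_mult_def) (simp add: fsts r2 add.assoc, simp add: c')
      moreover have "snd (snd (?m d e)) (cube_append m y z) = pcomp X (\<tau> y) (\<upsilon> z)"
        using yz y z by (simp add: cell_mult_def fsts) (simp add: d' e')
      ultimately show ?thesis by simp
    qed (simp add: cell_mult_def[of _ "?m c d"] cell_mult_def[of _ c "?m d e"] fsts add.assoc)
    show "?m (?m c d) e = ?m c (?m d e)"
      using att val by (intro prod_eqI ext) (simp_all add: add.assoc)
  qed
  have "\<forall>d \<in> ?C. \<forall>e \<in> ?C. A c d e"
    using assms(1)
  proof (induction rule: cells_induct)
    case (attach c)
    note c = attach
    show ?case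
    proof
      fix d assume "d \<in> ?C"
      then show "\<forall>e \<in> ?C. A c d e"
      proof (induction rule: cells_induct)
        case (attach d)
        note d = attach
        show ?case
        proof
          fix e assume "e \<in> ?C"
          then show "A c d e"
          proof (induction rule: cells_induct)
            case (attach e)
            show ?case
              by (rule step[OF c(1) _ d(1) _ attach(1) _ c(2) d(2) attach(2)]) (use d(2) attach(2) in auto)
          qed
        qed
      qed
    qed
  qed
  then show ?thesis using assms by (simp add: A_def)
qed

lemma pt_mult_assoc:
  assumes p: "p \<in> topspace Res" and q: "q \<in> topspace Res" and r: "r \<in> topspace Res"
    and pq: "tgt X (pt_value p) = src X (pt_value q)" and qr: "tgt X (pt_value q) = src X (pt_value r)"
  shows "pt_mult (pcomp X) (pt_mult (pcomp X) p q) r = pt_mult (pcomp X) p (pt_mult (pcomp X) q r)"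
proof -
  obtain c x where c: "c \<in> cells (paths X)" "x \<in> topspace (cube (fst c))" "p = cell_map c x"
    using resolution_point[OF p] .
  obtain d y where d: "d \<in> cells (paths X)" "y \<in> topspace (cube (fst d))" "q = cell_map d y"
    using resolution_point[OF q] .
  obtain e z where e: "e \<in> cells (paths X)" "z \<in> topspace (cube (fst e))" "r = cell_map e z"
    using resolution_point[OF r] .
  have "cells_composable c d" "cells_composable d e"
    using cells_composable_if[OF c(1) d(1) c(2) d(2)] cells_composable_if[OF d(1) e(1) d(2) e(2)] pq qr c d e by auto
  from cell_mult_assoc[OF c(1) d(1) e(1) this] show ?thesis
    using c d e by (simp add: pt_mult_cell_map cube_append_in cube_append_assoc)
qed

end



section \<open>A cofibrant replacement of a flow\<close>

lemma continuous_map_cube_interval_delta_prod: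
  "continuous_map (cylinder (cube n)) (delta_prod X Y) (\<lambda>z. (f z, g z)) \<longleftrightarrow>
   continuous_map (cylinder (cube n)) X f \<and> continuous_map (cylinder (cube n)) Y g"
  by (simp add: continuous_map_cube_interval continuous_map_cube_delta_prod o_def)

text \<open>The point of \<open>A\<close> stays fixed. At time \<open>t\<close> the given path is
  prolonged by the part of \<open>v\<close> up to \<open>t\<close>, and the whole is run at speed
  \<open>1 + t\<close>; at time 0 nothing changes, so the lift starts at \<open>u\<close>
  strictly.\<close>

lemma mpath_end_homotopy_lifting:
  assumes Z: "delta_generated Z" and u: "continuous_map Z (mpath A B f) u"
    and v: "continuous_map (delta_prod Z unit_interval) B v"
    and uv: "\<And>z. z \<in> topspace Z \<Longrightarrow> snd (u z) 1 = v (z, 0)"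
  obtains h where "continuous_map (delta_prod Z unit_interval) (mpath A B f) h"
    "\<And>z. z \<in> topspace Z \<Longrightarrow> h (z, 0) = u z"
    "\<And>z t. z \<in> topspace Z \<Longrightarrow> t \<in> {0..1} \<Longrightarrow> snd (h (z, t)) 1 = v (z, t)"
proof -
  define w where "w = (\<lambda>z t s. if s * (1 + t) \<le> 1 then snd (u z) (s * (1 + t)) else v (z, s * (1 + t) - 1))"
  define h where "h = (\<lambda>(z, t). (fst (u z), \<lambda>s\<in>{0..1}. w z t s))"
  have carrier: "u z \<in> mpath_carrier A B f" if "z \<in> topspace Z" for z
    using continuous_map_funspace[OF u] that by auto
  have "continuous_map (delta_prod Z unit_interval) (mpath A B f) h"
  proof (rule continuous_map_delta_generated[OF delta_generated_delta_prod])
    fix n \<kappa> assume "continuous_map (cube n) (delta_prod Z unit_interval) \<kappa>"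
    then have z: "continuous_map (cube n) Z (fst \<circ> \<kappa>)" and t: "continuous_map (cube n) unit_interval (snd \<circ> \<kappa>)"
      by (auto simp: continuous_map_cube_delta_prod)
    note uz = continuous_map_compose[OF z u]
    let ?X = "cylinder (cube n)"
    let ?r = "\<lambda>x. snd x * (1 + snd (\<kappa> (fst x)))"
    have t01: "0 \<le> snd (\<kappa> a)" "snd (\<kappa> a) \<le> 1" if "a \<in> topspace (cube n)" for a
      using continuous_map_funspace[OF t] that by auto
    have t': "continuous_map ?X euclideanreal (\<lambda>x. snd (\<kappa> (fst x)))"
      using continuous_map_into_fulltopology[OF continuous_map_compose[OF continuous_map_fst t]] by (simp add: o_def)
    have s': "continuous_map ?X euclideanreal snd"
      by (rule continuous_map_into_fulltopology[OF continuous_map_snd])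
    have r: "continuous_map ?X euclideanreal ?r" by (intro continuous_intros s' t')
    have r0: "0 \<le> ?r x" "?r x \<le> 2" if "x \<in> topspace ?X" for x
      using that t01[of "fst x"] mult_mono[of "snd x" 1 "1 + snd (\<kappa> (fst x))" 2] by auto
    have uz': "continuous_map ?X (mpath A B f) (\<lambda>x. u (fst (\<kappa> (fst x))))"
      using continuous_map_compose[OF continuous_map_fst uz] by (simp add: o_def)
    have z': "continuous_map ?X Z (\<lambda>x. fst (\<kappa> (fst x)))"
      using continuous_map_compose[OF continuous_map_fst z] by (simp add: o_def)
    \<comment> \<open>Clamping keeps both parameters in the interval everywhere, so each branch is
      continuous on the whole cylinder before pasting.\<close>
    have "continuous_map ?X euclideanreal (\<lambda>x. min 1 (?r x))" by (intro continuous_intros r)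
    then have m1: "continuous_map ?X unit_interval (\<lambda>x. min 1 (?r x))"
      using r0 by (auto simp: continuous_map_in_subtopology)
    have "continuous_map ?X euclideanreal (\<lambda>x. max 0 (?r x - 1))" by (intro continuous_intros r)
    then have m2: "continuous_map ?X unit_interval (\<lambda>x. max 0 (?r x - 1))"
      using r0 by (auto simp: continuous_map_in_subtopology Pi_iff)
    have f1: "continuous_map ?X B (\<lambda>x. snd (u (fst (\<kappa> (fst x)))) (min 1 (?r x)))"
      by (rule continuous_map_mpath_app[OF uz' m1])
    have "continuous_map ?X (delta_prod Z unit_interval) (\<lambda>x. (fst (\<kappa> (fst x)), max 0 (?r x - 1)))"
      unfolding continuous_map_cube_interval_delta_prod using z' m2 by blast
    from continuous_map_compose[OF this v]
    have f2: "continuous_map ?X B (\<lambda>x. v (fst (\<kappa> (fst x)), max 0 (?r x - 1)))" by (simp add: o_def)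
    let ?P = "{x \<in> topspace ?X. ?r x \<in> {..1}}" and ?Q = "{x \<in> topspace ?X. ?r x \<in> {1..}}"
    have w: "continuous_map ?X B (\<lambda>x. if x \<in> ?P then snd (u (fst (\<kappa> (fst x)))) (min 1 (?r x))
        else v (fst (\<kappa> (fst x)), max 0 (?r x - 1)))"
    proof (rule continuous_map_two_closed)
      show "closedin ?X ?P" "closedin ?X ?Q"
        by (rule closedin_continuous_map_preimage[OF r], simp)+
      fix x assume x: "x \<in> ?P" "x \<in> ?Q"
      then have "fst x \<in> topspace (cube n)" "?r x = 1" by auto
      moreover from this have "fst (\<kappa> (fst x)) \<in> topspace Z" using continuous_map_funspace[OF z] by auto
      ultimately show "snd (u (fst (\<kappa> (fst x)))) (min 1 (?r x)) = v (fst (\<kappa> (fst x)), max 0 (?r x - 1))"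
        using uv by simp
    qed (use f1 f2 in \<open>auto intro: continuous_map_from_subtopology\<close>)
    have "continuous_map ?X B (\<lambda>x. w (fst (\<kappa> (fst x))) (snd (\<kappa> (fst x))) (snd x))"
      by (rule continuous_map_eq[OF w]) (auto simp: w_def)
    then have w': "continuous_map ?X B (\<lambda>(a, s). w (fst (\<kappa> a)) (snd (\<kappa> a)) s)"
      by (simp add: case_prod_unfold)
    have fu: "continuous_map (cube n) A (\<lambda>a. fst (u (fst (\<kappa> a))))"
      using continuous_map_compose[OF uz continuous_map_fst_mpath] by (simp add: o_def)
    have "continuous_map (cube n) (mpath A B f)
        (\<lambda>a. (fst (u (fst (\<kappa> a))), \<lambda>s\<in>{0..1}. (\<lambda>(a, s). w (fst (\<kappa> a)) (snd (\<kappa> a)) s) (a, s)))"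
    proof (rule continuous_map_cube_into_mpath[OF fu w'])
      fix a assume "a \<in> topspace (cube n)"
      then have "fst (\<kappa> a) \<in> topspace Z" using continuous_map_funspace[OF z] by auto
      from carrier[OF this]
      show "(\<lambda>(a, s). w (fst (\<kappa> a)) (snd (\<kappa> a)) s) (a, 0) = f (fst (u (fst (\<kappa> a))))"
        by (auto simp: w_def mpath_carrier_def)
    qed
    then show "continuous_map (cube n) (mpath A B f) (h \<circ> \<kappa>)" by (simp add: h_def o_def case_prod_unfold)
  qed
  then show ?thesis
  proof (rule that)
    fix z assume z: "z \<in> topspace Z"
    have ext: "snd (u z) \<in> extensional {0..1}" using carrier[OF z] by (auto simp: mpath_carrier_def)
    have "(\<lambda>s\<in>{0..1}. w z 0 s) = snd (u z)"
      using ext by (auto simp: w_def fun_eq_iff extensional_def)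
    then show "h (z, 0) = u z" by (simp add: h_def)
    show "snd (h (z, t)) 1 = v (z, t)" if "t \<in> {0..1}" for t
      using that uv[OF z] by (auto simp: h_def w_def)
  qed
qed

text \<open>Running the paths on the boundary backwards and extending this homotopy over the cube
  moves \<open>w\<close> to a cube whose boundary comes from \<open>A\<close>. It is filled there by
  assumption, and the homotopy traversed in the opposite direction supplies the paths.\<close>

lemma mpath_end_boundary_lifts:
  assumes fill: "\<And>n a \<sigma>. \<lbrakk>continuous_map (boundary_space n) A a; continuous_map (cube n) B \<sigma>;
      \<And>x. x \<in> cube_boundary n \<Longrightarrow> f (a x) = \<sigma> x\<rbrakk> \<Longrightarrow> boundary_lift A B f n a \<sigma>"
    and a: "continuous_map (boundary_space n) (mpath A B f) a"
  shows "boundary_lifts (mpath A B f) B (\<lambda>m. snd m 1) n a"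
  unfolding boundary_lifts_def
proof (intro allI impI)
  fix w assume w: "continuous_map (cube n) B w" and eq: "\<forall>x \<in> cube_boundary n. snd (a x) 1 = w x"
  have carrier: "a x \<in> mpath_carrier A B f" if "x \<in> cube_boundary n" for x
    using funcset_mem[OF continuous_map_funspace[OF a], unfolded topspace_boundary_space topspace_mpath, OF that] .
  have \<phi>: "continuous_map (cylinder (boundary_space n)) B (\<lambda>z. snd ((a \<circ> fst) z) (((\<lambda>t. 1 - t) \<circ> snd) z))"
    by (rule continuous_map_mpath_app[OF continuous_map_compose[OF continuous_map_fst a]
          continuous_map_compose[OF continuous_map_snd continuous_map_flip]])
  obtain F where F: "continuous_map (cylinder (cube n)) B F"
    "\<And>x. x \<in> topspace (cube n) \<Longrightarrow> F (x, 0) = w x"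
    "\<And>x t. x \<in> cube_boundary n \<Longrightarrow> t \<in> {0..1} \<Longrightarrow> F (x, t) = snd (a x) (1 - t)"
    using cube_homotopy_extension[OF w \<phi>] eq by auto
  have s: "continuous_map (cube n) B (F \<circ> (\<lambda>x. (x, 1)))"
    by (intro continuous_map_compose[OF _ F(1)] continuous_map_pairedI) auto
  have fa: "continuous_map (boundary_space n) A (fst \<circ> a)"
    by (rule continuous_map_compose[OF a continuous_map_fst_mpath])
  have "f ((fst \<circ> a) x) = (F \<circ> (\<lambda>x. (x, 1))) x" if "x \<in> cube_boundary n" for x
    using carrier[OF that] F(3)[OF that, of 1] by (auto simp: mpath_carrier_def)
  from fill[OF fa s this] obtain h where h: "continuous_map (cube n) A h"
    "\<And>x. x \<in> cube_boundary n \<Longrightarrow> h x = fst (a x)" "\<And>x. x \<in> topspace (cube n) \<Longrightarrow> f (h x) = F (x, 1)"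
    by (auto simp: boundary_lift_def)
  have F': "continuous_map (cylinder (cube n)) B (\<lambda>(x, t). F (x, 1 - t))"
  proof -
    have "continuous_map (cylinder (cube n)) (cylinder (cube n))
        (\<lambda>z. (fst z, ((\<lambda>t. 1 - t) \<circ> snd) z))"
      by (intro continuous_map_pairedI continuous_map_fst continuous_map_compose[OF continuous_map_snd continuous_map_flip])
    from continuous_map_compose[OF this F(1)] show ?thesis by (simp add: o_def case_prod_unfold)
  qed
  show "boundary_lift (mpath A B f) B (\<lambda>m. snd m 1) n a w"
    unfolding boundary_lift_def
  proof (intro exI conjI ballI)
    show "continuous_map (cube n) (mpath A B f) (\<lambda>x. (h x, \<lambda>t\<in>{0..1}. (\<lambda>(x, t). F (x, 1 - t)) (x, t)))"
      by (rule continuous_map_cube_into_mpath[OF h(1) F']) (simp add: h(3))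
    show "snd (h x, \<lambda>t\<in>{0..1}. (\<lambda>(x, t). F (x, 1 - t)) (x, t)) 1 = w x" if "x \<in> topspace (cube n)" for x
      using F(2)[OF that] by simp
    fix x assume x: "x \<in> cube_boundary n"
    have "snd (a x) \<in> extensional {0..1}" using carrier[OF x] by (auto simp: mpath_carrier_def)
    then have "(\<lambda>t\<in>{0..1}. F (x, 1 - t)) = snd (a x)"
      using F(3)[OF x] by (auto simp: fun_eq_iff extensional_def)
    then show "(h x, \<lambda>t\<in>{0..1}. (\<lambda>(x, t). F (x, 1 - t)) (x, t)) = a x" using h(2)[OF x] by simp
  qed
qed

text \<open>Cubes are connected, so a set that contains or misses the image of each cube behaves like
  an open and closed subset.\<close>

lemma continuous_map_from_subtopology_delta_kelley:
  assumes split: "\<And>n \<kappa>. continuous_map (cube n) T \<kappa> \<Longrightarrow>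
      \<kappa> ` topspace (cube n) \<subseteq> S \<or> \<kappa> ` topspace (cube n) \<inter> S = {}"
    and f: "\<And>n \<kappa>. continuous_map (cube n) T \<kappa> \<Longrightarrow> \<kappa> ` topspace (cube n) \<subseteq> S \<Longrightarrow> continuous_map (cube n) Y (f \<circ> \<kappa>)"
  shows "continuous_map (subtopology (delta_kelley T) S) Y f"
  unfolding continuous_map_def
proof (intro conjI allI impI)
  show "f \<in> topspace (subtopology (delta_kelley T) S) \<rightarrow> topspace Y"
  proof
    fix x assume "x \<in> topspace (subtopology (delta_kelley T) S)"
    then have x: "x \<in> topspace T" "x \<in> S" by auto
    then have "continuous_map (cube 0) T (\<lambda>_. x)" by simp
    from continuous_map_funspace[OF f[OF this]] x show "f x \<in> topspace Y" by (auto simp: topspace_cube)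
  qed
  fix U assume U: "openin Y U"
  let ?V = "{x \<in> topspace T. x \<in> S \<and> f x \<in> U}"
  have "openin (delta_kelley T) ?V"
    unfolding openin_delta_kelley_cube
  proof (intro conjI allI impI)
    fix n \<kappa> assume k: "continuous_map (cube n) T \<kappa>"
    from split[OF k] show "openin (cube n) {a \<in> topspace (cube n). \<kappa> a \<in> ?V}"
    proof
      assume S: "\<kappa> ` topspace (cube n) \<subseteq> S"
      have "openin (cube n) {a \<in> topspace (cube n). (f \<circ> \<kappa>) a \<in> U}"
        using f[OF k S] U by (simp add: continuous_map_def)
      also have "{a \<in> topspace (cube n). (f \<circ> \<kappa>) a \<in> U} = {a \<in> topspace (cube n). \<kappa> a \<in> ?V}"
        using S continuous_map_funspace[OF k] by auto
      finally show ?thesis .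
    next
      assume "\<kappa> ` topspace (cube n) \<inter> S = {}"
      then have "{a \<in> topspace (cube n). \<kappa> a \<in> ?V} = {}" by auto
      then show ?thesis by (simp only: openin_empty)
    qed
  qed auto
  then have "openin (subtopology (delta_kelley T) S) (S \<inter> ?V)" by (rule openin_subtopology_Int2)
  also have "S \<inter> ?V = {x \<in> topspace (subtopology (delta_kelley T) S). f x \<in> U}" by auto
  finally show "openin (subtopology (delta_kelley T) S) {x \<in> topspace (subtopology (delta_kelley T) S). f x \<in> U}" .
qed

text \<open>The injection \<open>e\<close> brings the path space back into the universe.\<close>

definition resolution_flow :: "('u pt \<times> (real \<Rightarrow> 'u) \<Rightarrow> 'u) \<Rightarrow> 'u flow \<Rightarrow> 'u flow" where
  "resolution_flow e U = \<lparr>states = states U,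
     paths = encode_topology e (mpath (resolution (paths U)) (paths U) pt_value),
     src = (\<lambda>w. src U (snd (inv_into UNIV e w) 1)),
     tgt = (\<lambda>w. tgt U (snd (inv_into UNIV e w) 1)),
     pcomp = (\<lambda>w w'. e (pt_mult (pcomp U) (fst (inv_into UNIV e w)) (fst (inv_into UNIV e w')),
       \<lambda>t\<in>{0..1}. pcomp U (snd (inv_into UNIV e w) t) (snd (inv_into UNIV e w') t)))\<rparr>"

definition resolution_flow_map :: "('u pt \<times> (real \<Rightarrow> 'u) \<Rightarrow> 'u) \<Rightarrow> ('u, 'u) flow_map" where
  "resolution_flow_map e = \<lparr>on_states = id, on_paths = (\<lambda>w. snd (inv_into UNIV e w) 1)\<rparr>"

section \<open>The flow structure on the replacement and its trivial fibration to
  \<open>U\<close>\<close>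

context
  fixes U :: "'u flow" and e :: "'u pt \<times> (real \<Rightarrow> 'u) \<Rightarrow> 'u"
  assumes U: "is_flow U" and e: "inj e"
begin

abbreviation "pathC \<equiv> mpath_carrier (resolution (paths U)) (paths U) pt_value"
abbreviation "pathM \<equiv> mpath (resolution (paths U)) (paths U) pt_value"
abbreviation "pathV \<equiv> encode_topology e pathM"
abbreviation "dec \<equiv> inv_into UNIV e"

lemma paths_resolution_flow: "paths (resolution_flow e U) = pathV"
  and src_resolution_flow: "src (resolution_flow e U) w = src U (snd (dec w) 1)"
  and tgt_resolution_flow: "tgt (resolution_flow e U) w = tgt U (snd (dec w) 1)"
  and states_resolution_flow: "states (resolution_flow e U) = states U"
  by (simp_all add: resolution_flow_def)

lemma dec_carrier: "w \<in> topspace pathV \<Longrightarrow> dec w \<in> pathC"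
  by (auto simp: topspace_encode_topology[OF e] inv_into_f_f[OF e])

lemma continuous_map_dec: "continuous_map pathV pathM dec"
  by (rule continuous_map_decode[OF e])

lemma continuous_map_endpoint: "continuous_map pathV (paths U) (\<lambda>w. snd (dec w) 1)"
  by (rule continuous_map_mpath_app[OF continuous_map_dec]) simp

lemma path_src_constant:
  assumes "m \<in> pathC" "t \<in> {0..1}"
  shows "src U (snd m t) = src U (snd m 1)" "tgt U (snd m t) = tgt U (snd m 1)"
proof -
  have "continuous_map unit_interval (paths U) (snd m)" using assms(1) by (auto simp: mpath_carrier_def)
  from flow_ends_constant[OF U connected_space_unit_interval this, of t 1] assms(2)
  show "src U (snd m t) = src U (snd m 1)" "tgt U (snd m t) = tgt U (snd m 1)" by simp_all
qed

lemma carrier_value: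
  assumes "m \<in> pathC"
  shows "fst m \<in> topspace (resolution (paths U))" "pt_value (fst m) = snd m 0"
    "t \<in> {0..1} \<Longrightarrow> snd m t \<in> topspace (paths U)"
  using assms continuous_map_funspace by (auto simp: mpath_carrier_def Pi_iff continuous_map_def)

definition path_mult :: "'u pt \<times> (real \<Rightarrow> 'u) \<Rightarrow> 'u pt \<times> (real \<Rightarrow> 'u) \<Rightarrow> 'u pt \<times> (real \<Rightarrow> 'u)" where
  "path_mult m m' = (pt_mult (pcomp U) (fst m) (fst m'), \<lambda>t\<in>{0..1}. pcomp U (snd m t) (snd m' t))"

lemma continuous_map_cube_path_mult:
  assumes f: "continuous_map (cube n) pathM f" and g: "continuous_map (cube n) pathM g"
    and fg: "\<And>a. a \<in> topspace (cube n) \<Longrightarrow> tgt U (snd (f a) 1) = src U (snd (g a) 1)"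
  shows "continuous_map (cube n) pathM (\<lambda>a. path_mult (f a) (g a))"
proof -
  have cf: "f a \<in> pathC"
    and cg: "g a \<in> pathC" if "a \<in> topspace (cube n)" for a
    using continuous_map_funspace[OF f] continuous_map_funspace[OF g] that by auto
  \<comment> \<open>Composability is known at the ends of the paths; sources and targets are
    constant along paths, so it holds at every time, in particular at time 0, where the points of
    the complex are multiplied.\<close>
  have comp: "tgt U (snd (f a) t) = src U (snd (g a) t)" if "a \<in> topspace (cube n)" "t \<in> {0..1}" for a t
    using path_src_constant[OF cf[OF that(1)] that(2)] path_src_constant[OF cg[OF that(1)] that(2)] fg[OF that(1)] by simp
  have 1: "continuous_map (cube n) (resolution (paths U)) (\<lambda>a. pt_mult (pcomp U) (fst (f a)) (fst (g a)))"
  proof (rule continuous_map_resolution_mult[OF U compact_space_cube Hausdorff_space_cube])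
    show "continuous_map (cube n) (resolution (paths U)) (\<lambda>a. fst (f a))"
      using continuous_map_compose[OF f continuous_map_fst_mpath] by (simp add: o_def)
    show "continuous_map (cube n) (resolution (paths U)) (\<lambda>a. fst (g a))"
      using continuous_map_compose[OF g continuous_map_fst_mpath] by (simp add: o_def)
    show "tgt U (pt_value (fst (f a))) = src U (pt_value (fst (g a)))" if "a \<in> topspace (cube n)" for a
      using comp[OF that, of 0] carrier_value(2)[OF cf[OF that]] carrier_value(2)[OF cg[OF that]] by simp
  qed
  let ?w = "\<lambda>(a, t). pcomp U (snd (f a) t) (snd (g a) t)"
  have 2: "continuous_map (cylinder (cube n)) (paths U) ?w"
    unfolding continuous_map_cube_interval prod.case
  proof (rule continuous_map_cube_pcomp[OF U])
    show "continuous_map (cube (Suc n)) (paths U) (\<lambda>y. snd (f (restrict y {..<n})) (y n))"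
      using continuous_map_mpath_app[OF continuous_map_compose[OF continuous_map_init f] continuous_map_last] by simp
    show "continuous_map (cube (Suc n)) (paths U) (\<lambda>y. snd (g (restrict y {..<n})) (y n))"
      using continuous_map_mpath_app[OF continuous_map_compose[OF continuous_map_init g] continuous_map_last] by simp
    fix y assume y: "y \<in> topspace (cube (Suc n))"
    then have "y n \<in> {0..1}" by (auto simp: in_topspace_cube)
    then show "tgt U (snd (f (restrict y {..<n})) (y n)) = src U (snd (g (restrict y {..<n})) (y n))"
      using comp restrict_in_cube[OF y] by blast
  qed
  have "continuous_map (cube n) pathM (\<lambda>a. (pt_mult (pcomp U) (fst (f a)) (fst (g a)), \<lambda>t\<in>{0..1}. ?w (a, t)))"
  proof (rule continuous_map_cube_into_mpath[OF 1 2])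
    fix a assume a: "a \<in> topspace (cube n)"
    show "?w (a, 0) = pt_value (pt_mult (pcomp U) (fst (f a)) (fst (g a)))"
      using carrier_value[OF cf[OF a]] carrier_value[OF cg[OF a]] by (simp add: pt_value_mult)
  qed
  then show ?thesis by (simp add: path_mult_def)
qed

lemma pcomp_resolution_flow: "pcomp (resolution_flow e U) w w' = e (path_mult (dec w) (dec w'))"
  by (simp add: resolution_flow_def path_mult_def)

lemma dec_e [simp]: "dec (e m) = m"
  by (rule inv_into_f_f[OF e UNIV_I])

lemma is_flow_resolution_flow: "is_flow (resolution_flow e U)"
proof -
  let ?V = "resolution_flow e U"
  have sU: "continuous_map (paths U) (discrete_topology (states U)) (src U)"
    and tU: "continuous_map (paths U) (discrete_topology (states U)) (tgt U)"
    and st: "\<And>x y. (x, y) \<in> composable U \<Longrightarrow> src U (pcomp U x y) = src U x \<and> tgt U (pcomp U x y) = tgt U y"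
    using U by (auto simp: is_flow_def)
  have s: "continuous_map pathV (discrete_topology (states U)) (src ?V)"
    using continuous_map_compose[OF continuous_map_endpoint sU]
    by (rule continuous_map_eq) (simp add: src_resolution_flow)
  have t: "continuous_map pathV (discrete_topology (states U)) (tgt ?V)"
    using continuous_map_compose[OF continuous_map_endpoint tU]
    by (rule continuous_map_eq) (simp add: tgt_resolution_flow)
  have comp_iff: "(w, w') \<in> composable ?V \<longleftrightarrow> w \<in> topspace pathV \<and> w' \<in> topspace pathV \<and>
      tgt U (snd (dec w) 1) = src U (snd (dec w') 1)" for w w'
    by (simp add: composable_def paths_resolution_flow src_resolution_flow tgt_resolution_flow)
  have comp: "continuous_map (subtopology (delta_prod pathV pathV) (composable ?V)) pathV (\<lambda>(x, y). pcomp ?V x y)"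
    unfolding delta_prod_def
  proof (rule continuous_map_from_subtopology_delta_kelley)
    fix n \<kappa> assume "continuous_map (cube n) (prod_topology pathV pathV) \<kappa>"
    then have k1: "continuous_map (cube n) pathV (fst \<circ> \<kappa>)" and k2: "continuous_map (cube n) pathV (snd \<circ> \<kappa>)"
      by (simp_all add: continuous_map_pairwise)
    have in1: "fst (\<kappa> a) \<in> topspace pathV" and in2: "snd (\<kappa> a) \<in> topspace pathV" if "a \<in> topspace (cube n)" for a
      using continuous_map_funspace[OF k1] continuous_map_funspace[OF k2] that by auto
    \<comment> \<open>Source and target are constant on a connected cube, so composability at one
      point spreads to all points.\<close>
    show "\<kappa> ` topspace (cube n) \<subseteq> composable ?V \<or> \<kappa> ` topspace (cube n) \<inter> composable ?V = {}"
    proof (rule disjCI)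
      assume "\<kappa> ` topspace (cube n) \<inter> composable ?V \<noteq> {}"
      then obtain a where a: "a \<in> topspace (cube n)" "\<kappa> a \<in> composable ?V" by auto
      show "\<kappa> ` topspace (cube n) \<subseteq> composable ?V"
      proof (rule image_subsetI)
        fix b assume b: "b \<in> topspace (cube n)"
        have "tgt ?V (fst (\<kappa> b)) = tgt ?V (fst (\<kappa> a))"
          using continuous_map_discrete_constant[OF connected_space_cube continuous_map_compose[OF k1 t] b a(1)] by simp
        moreover have "src ?V (snd (\<kappa> b)) = src ?V (snd (\<kappa> a))"
          using continuous_map_discrete_constant[OF connected_space_cube continuous_map_compose[OF k2 s] b a(1)] by simp
        moreover have "tgt ?V (fst (\<kappa> a)) = src ?V (snd (\<kappa> a))"
          using a(2) by (auto simp: composable_def case_prod_unfold)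
        ultimately show "\<kappa> b \<in> composable ?V"
          using in1[OF b] in2[OF b] by (simp add: composable_def case_prod_unfold mem_Times_iff paths_resolution_flow)
      qed
    qed
    assume S: "\<kappa> ` topspace (cube n) \<subseteq> composable ?V"
    have "continuous_map (cube n) pathM (\<lambda>a. path_mult ((dec \<circ> (fst \<circ> \<kappa>)) a) ((dec \<circ> (snd \<circ> \<kappa>)) a))"
    proof (rule continuous_map_cube_path_mult)
      fix a assume "a \<in> topspace (cube n)"
      then have "(fst (\<kappa> a), snd (\<kappa> a)) \<in> composable ?V" using S by auto
      then show "tgt U (snd ((dec \<circ> (fst \<circ> \<kappa>)) a) 1) = src U (snd ((dec \<circ> (snd \<circ> \<kappa>)) a) 1)"
        unfolding comp_iff by simp
    qed (intro continuous_map_compose[OF k1 continuous_map_dec] continuous_map_compose[OF k2 continuous_map_dec])+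
    from continuous_map_compose[OF this continuous_map_encode[OF e]]
    show "continuous_map (cube n) pathV ((\<lambda>(x, y). pcomp ?V x y) \<circ> \<kappa>)"
      by (simp add: o_def case_prod_unfold pcomp_resolution_flow)
  qed
  have ends: "src ?V (pcomp ?V w w') = src ?V w \<and> tgt ?V (pcomp ?V w w') = tgt ?V w'"
    if "(w, w') \<in> composable ?V" for w w'
  proof -
    have w: "w \<in> topspace pathV" "w' \<in> topspace pathV" "tgt U (snd (dec w) 1) = src U (snd (dec w') 1)"
      using that by (simp_all add: comp_iff)
    then have "(snd (dec w) 1, snd (dec w') 1) \<in> composable U"
      using carrier_value(3)[OF dec_carrier[OF w(1)], of 1] carrier_value(3)[OF dec_carrier[OF w(2)], of 1]
      by (simp add: composable_def)
    from st[OF this] show ?thesis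
      by (simp add: src_resolution_flow tgt_resolution_flow pcomp_resolution_flow path_mult_def)
  qed
  have assoc: "pcomp ?V (pcomp ?V x y) z = pcomp ?V x (pcomp ?V y z)"
    if "(x, y) \<in> composable ?V" "(y, z) \<in> composable ?V" for x y z
  proof -
    have cx: "dec x \<in> pathC"
      and cy: "dec y \<in> pathC"
      and cz: "dec z \<in> pathC"
      and xy: "tgt U (snd (dec x) 1) = src U (snd (dec y) 1)" and yz: "tgt U (snd (dec y) 1) = src U (snd (dec z) 1)"
      using that dec_carrier by (simp_all add: comp_iff)
    have xy': "tgt U (snd (dec x) t) = src U (snd (dec y) t)" and yz': "tgt U (snd (dec y) t) = src U (snd (dec z) t)"
      if "t \<in> {0..1}" for t
      using path_src_constant[OF cx that] path_src_constant[OF cy that] path_src_constant[OF cz that] xy yz by simp_all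
    have "pcomp U (pcomp U (snd (dec x) t) (snd (dec y) t)) (snd (dec z) t) =
        pcomp U (snd (dec x) t) (pcomp U (snd (dec y) t) (snd (dec z) t))" if "t \<in> {0..1}" for t
      by (rule pcomp_assoc_flow[OF U]) (use carrier_value(3)[OF cx] carrier_value(3)[OF cy] carrier_value(3)[OF cz]
          xy' yz' that in auto)
    moreover have "pt_mult (pcomp U) (pt_mult (pcomp U) (fst (dec x)) (fst (dec y))) (fst (dec z)) =
        pt_mult (pcomp U) (fst (dec x)) (pt_mult (pcomp U) (fst (dec y)) (fst (dec z)))"
      using xy'[of 0] yz'[of 0] carrier_value[OF cx] carrier_value[OF cy] carrier_value[OF cz]
      by (intro pt_mult_assoc[OF U]) auto
    ultimately have "path_mult (path_mult (dec x) (dec y)) (dec z) = path_mult (dec x) (path_mult (dec y) (dec z))"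
      by (auto simp: path_mult_def fun_eq_iff)
    then show ?thesis by (simp add: pcomp_resolution_flow)
  qed
  have "delta_generated pathV" by (rule delta_generated_encode_topology[OF e delta_generated_mpath])
  then show ?thesis
    unfolding is_flow_def paths_resolution_flow states_resolution_flow using s t comp ends assoc by blast
qed

lemma is_flow_map_resolution_flow_map: "is_flow_map (resolution_flow e U) U (resolution_flow_map e)"
  unfolding is_flow_map_def
  by (auto simp: resolution_flow_map_def states_resolution_flow paths_resolution_flow continuous_map_endpoint
      src_resolution_flow tgt_resolution_flow pcomp_resolution_flow path_mult_def)

text \<open>In this form, as a preimage under the endpoint map, a lift found among all paths lies
  between the right states as soon as its endpoints do.\<close>

lemma path_space_resolution_flow:
  "path_space (resolution_flow e U) \<alpha> \<beta> = subtopology pathV {w \<in> topspace pathV. snd (dec w) 1 \<in> topspace (path_space U \<alpha> \<beta>)}"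
proof -
  have "{w \<in> topspace pathV. snd (dec w) 1 \<in> topspace (path_space U \<alpha> \<beta>)} =
      {w \<in> topspace pathV. src U (snd (dec w) 1) = \<alpha> \<and> tgt U (snd (dec w) 1) = \<beta>}"
    using carrier_value(3)[OF dec_carrier, of _ 1] by (auto simp: path_space_def)
  then show ?thesis by (simp add: path_space_def paths_resolution_flow src_resolution_flow tgt_resolution_flow)
qed

lemma continuous_map_endpoint_path_space:
  "continuous_map (path_space (resolution_flow e U) \<alpha> \<beta>) (path_space U \<alpha> \<beta>) (\<lambda>w. snd (dec w) 1)"
  using continuous_map_from_subtopology[OF continuous_map_endpoint]
  unfolding path_space_resolution_flow
  by (auto simp: path_space_def continuous_map_in_subtopology)

lemma continuous_map_from_path_space: "continuous_map Z (path_space U \<alpha> \<beta>) v \<Longrightarrow> continuous_map Z (paths U) v"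
  unfolding path_space_def by (rule continuous_map_into_fulltopology)

lemma h_fibration_resolution_flow:
  "h_fibration (path_space (resolution_flow e U) \<alpha> \<beta>) (path_space U \<alpha> \<beta>) (\<lambda>w. snd (dec w) 1)"
  unfolding h_fibration_def
proof (intro conjI allI impI continuous_map_endpoint_path_space)
  fix Z :: "'u topology" assume Z: "delta_generated Z"
  let ?I = "delta_prod Z unit_interval" and ?Z0 = "topspace Z \<times> {0 :: real}"
  show "top_lifting (subtopology ?I ?Z0) ?I id
      (path_space (resolution_flow e U) \<alpha> \<beta>) (path_space U \<alpha> \<beta>) (\<lambda>w. snd (dec w) 1)"
    unfolding top_lifting_def
  proof (intro allI impI, elim conjE)
    fix u v assume u: "continuous_map (subtopology ?I ?Z0) (path_space (resolution_flow e U) \<alpha> \<beta>) u"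
      and v: "continuous_map ?I (path_space U \<alpha> \<beta>) v"
      and uv: "\<forall>a \<in> topspace (subtopology ?I ?Z0). snd (dec (u a)) 1 = v (id a)"
    \<comment> \<open>The problem is posed on the bottom of the cylinder, whereas
      \<open>mpath_end_homotopy_lifting\<close> expects its initial data on
      \<open>Z\<close>.\<close>
    have "continuous_map Z ?I (\<lambda>z. (z, 0))"
      by (intro continuous_map_into_delta_prod Z) auto
    then have "continuous_map Z (subtopology ?I ?Z0) (\<lambda>z. (z, 0))"
      by (auto simp: continuous_map_in_subtopology)
    from continuous_map_compose[OF continuous_map_compose[OF this continuous_map_into_fulltopology[OF
            u[unfolded path_space_resolution_flow]]] continuous_map_dec]
    have u': "continuous_map Z pathM (\<lambda>z. dec (u (z, 0)))" by (simp add: o_def)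
    obtain h where h: "continuous_map ?I pathM h"
      "\<And>z. z \<in> topspace Z \<Longrightarrow> h (z, 0) = dec (u (z, 0))"
      "\<And>z t. z \<in> topspace Z \<Longrightarrow> t \<in> {0..1} \<Longrightarrow> snd (h (z, t)) 1 = v (z, t)"
      using mpath_end_homotopy_lifting[OF Z u' continuous_map_from_path_space[OF v]] uv by auto
    have eh: "continuous_map ?I pathV (e \<circ> h)" by (rule continuous_map_compose[OF h(1) continuous_map_encode[OF e]])
    show "\<exists>h. continuous_map ?I (path_space (resolution_flow e U) \<alpha> \<beta>) h \<and>
        (\<forall>a \<in> topspace (subtopology ?I ?Z0). h (id a) = u a) \<and> (\<forall>b \<in> topspace ?I. snd (dec (h b)) 1 = v b)"
    proof (intro exI conjI ballI)
      have "snd (h b) 1 \<in> topspace (path_space U \<alpha> \<beta>)" if "b \<in> topspace ?I" for b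
        using that h(3)[of "fst b" "snd b"] funcset_mem[OF continuous_map_funspace[OF v], of b] by auto
      then show "continuous_map ?I (path_space (resolution_flow e U) \<alpha> \<beta>) (e \<circ> h)"
        unfolding path_space_resolution_flow continuous_map_in_subtopology
        using eh continuous_map_funspace[OF eh] by auto
      show "(e \<circ> h) (id a) = u a" if a: "a \<in> topspace (subtopology ?I ?Z0)" for a
      proof -
        have "u a \<in> topspace pathV"
          using funcset_mem[OF continuous_map_funspace[OF u] a] by (simp add: path_space_resolution_flow)
        then have "e (dec (u a)) = u a" by (auto simp: topspace_encode_topology[OF e])
        moreover obtain z where "a = (z, 0)" "z \<in> topspace Z" using a by auto
        ultimately show ?thesis using h(2) by simp
      qed
      show "snd (dec ((e \<circ> h) b)) 1 = v b" if "b \<in> topspace ?I" for b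
        using that h(3)[of "fst b" "snd b"] by auto
    qed
  qed
qed

text \<open>Fillers in the complex are cells, hence the endpoint map lifts against boundaries of
  cubes; fixing the two states keeps this property, because the cube to be lifted prescribes the
  endpoints.\<close>

lemma resolution_flow_weak_equivalence:
  "weak_homotopy_equivalence (path_space (resolution_flow e U) \<alpha> \<beta>) (path_space U \<alpha> \<beta>) (\<lambda>w. snd (dec w) 1)"
proof (rule weak_homotopy_equivalence_if_boundary_lifts[OF continuous_map_endpoint_path_space])
  fix n a assume a: "continuous_map (boundary_space n) (path_space (resolution_flow e U) \<alpha> \<beta>) a"
  have a': "continuous_map (boundary_space n) pathV a"
    using continuous_map_into_fulltopology[OF a[unfolded path_space_resolution_flow]] .
  have lifts: "boundary_lifts pathM (paths U) (\<lambda>m. snd m 1) n (dec \<circ> a)"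
  proof (rule mpath_end_boundary_lifts[OF _ continuous_map_compose[OF a' continuous_map_dec]])
    fix n b \<sigma> assume "continuous_map (boundary_space n) (resolution (paths U)) b" "continuous_map (cube n) (paths U) \<sigma>"
      "\<And>x. x \<in> cube_boundary n \<Longrightarrow> pt_value (b x) = \<sigma> x"
    from resolution_fill[OF this] show "boundary_lift (resolution (paths U)) (paths U) pt_value n b \<sigma>"
      unfolding boundary_lift_def by metis
  qed
  show "boundary_lifts (path_space (resolution_flow e U) \<alpha> \<beta>) (path_space U \<alpha> \<beta>) (\<lambda>w. snd (dec w) 1) n a"
    unfolding boundary_lifts_def
  proof (intro allI impI)
    fix w assume w: "continuous_map (cube n) (path_space U \<alpha> \<beta>) w"
      and eq: "\<forall>x \<in> cube_boundary n. snd (dec (a x)) 1 = w x"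
    then have "boundary_lift pathM (paths U) (\<lambda>m. snd m 1) n (dec \<circ> a) w"
      using lifts continuous_map_from_path_space[OF w] unfolding boundary_lifts_def by simp
    then obtain h where h: "continuous_map (cube n) pathM h" "\<And>x. x \<in> cube_boundary n \<Longrightarrow> h x = dec (a x)"
      "\<And>x. x \<in> topspace (cube n) \<Longrightarrow> snd (h x) 1 = w x" by (auto simp: boundary_lift_def)
    have eh: "continuous_map (cube n) pathV (e \<circ> h)" by (rule continuous_map_compose[OF h(1) continuous_map_encode[OF e]])
    show "boundary_lift (path_space (resolution_flow e U) \<alpha> \<beta>) (path_space U \<alpha> \<beta>) (\<lambda>w. snd (dec w) 1) n a w"
      unfolding boundary_lift_def
    proof (intro exI conjI ballI)
      show "continuous_map (cube n) (path_space (resolution_flow e U) \<alpha> \<beta>) (e \<circ> h)"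
        unfolding path_space_resolution_flow continuous_map_in_subtopology
        using eh continuous_map_funspace[OF eh] h(3) continuous_map_funspace[OF w] by (auto simp: Pi_iff)
      show "(e \<circ> h) x = a x" if x: "x \<in> cube_boundary n" for x
      proof -
        have "a x \<in> topspace pathV"
          using funcset_mem[OF continuous_map_funspace[OF a'], unfolded topspace_boundary_space, OF x] .
        then show ?thesis using h(2)[OF x] by (auto simp: topspace_encode_topology[OF e])
      qed
      show "snd (dec ((e \<circ> h) x)) 1 = w x" if "x \<in> topspace (cube n)" for x
        using h(3)[OF that] by simp
    qed
  qed
qed

lemma resolution_flow_fibration: "flow_m_fibration (resolution_flow e U) U (resolution_flow_map e)"
  using is_flow_map_resolution_flow_map h_fibration_resolution_flow
  by (simp add: flow_m_fibration_def resolution_flow_map_def)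

lemma resolution_flow_equivalence: "flow_weak_equivalence (resolution_flow e U) U (resolution_flow_map e)"
  using is_flow_map_resolution_flow_map resolution_flow_weak_equivalence
  by (simp add: flow_weak_equivalence_def resolution_flow_map_def states_resolution_flow)

end

section \<open>Lifting maps out of the path space\<close>

lemma m_cofibrant_flow_section:
  fixes U :: "'u flow"
  assumes univ: "universe TYPE('u)" and cof: "m_cofibrant_flow TYPE('u) U"
  obtains s where "continuous_map (paths U) (mpath (resolution (paths U)) (paths U) pt_value) s"
    "\<And>x. x \<in> topspace (paths U) \<Longrightarrow> snd (s x) 1 = x"
proof -
  \<comment> \<open>Cofibrancy is tested only against flows on \<open>'u\<close>, so points of the
    complex and paths have to be coded into that type.\<close>
  obtain c :: "'u pt \<Rightarrow> 'u" where "inj c" using universe_pt[OF univ] by blast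
  then obtain e :: "'u pt \<times> (real \<Rightarrow> 'u) \<Rightarrow> 'u" where e: "inj e" using universe_pair_path[OF univ] by blast
  have U: "is_flow U" using cof by (simp add: m_cofibrant_flow_def)
  let ?V = "resolution_flow e U" and ?p = "resolution_flow_map e"
  let ?id = "\<lparr>on_states = id, on_paths = id\<rparr> :: ('u, 'u) flow_map"
  have "flow_lifting empty_flow U ?id ?V U ?p"
    using cof U is_flow_resolution_flow[OF U e] resolution_flow_fibration[OF U e] resolution_flow_equivalence[OF U e]
    unfolding m_cofibrant_flow_def m_cofibration_flow_def by blast
  moreover have "is_flow_map empty_flow ?V ?id"
    by (simp add: is_flow_map_def empty_flow_def composable_def)
  moreover have "is_flow_map U U ?id"
    by (auto simp: is_flow_map_def)
  moreover have "flow_map_eq empty_flow (flow_map_comp ?p ?id) (flow_map_comp ?id ?id)"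
    by (simp add: flow_map_eq_def empty_flow_def)
  ultimately obtain h where h: "is_flow_map U ?V h" "flow_map_eq U (flow_map_comp ?p h) ?id"
    unfolding flow_lifting_def by blast
  show ?thesis
  proof (rule that)
    have "continuous_map (paths U) (paths ?V) (on_paths h)" using h(1) by (simp add: is_flow_map_def)
    then show "continuous_map (paths U) (mpath (resolution (paths U)) (paths U) pt_value) (inv_into UNIV e \<circ> on_paths h)"
      using continuous_map_compose[OF _ continuous_map_decode[OF e]] by (simp add: resolution_flow_def)
    show "snd ((inv_into UNIV e \<circ> on_paths h) x) 1 = x" if "x \<in> topspace (paths U)" for x
      using h(2) that by (simp add: flow_map_eq_def flow_map_comp_def resolution_flow_map_def)
  qed
qed

theorem theorem8p7:
  fixes U :: "'u flow"
  assumes "universe TYPE('u)"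
    and "universe TYPE('v)"
    and "m_cofibrant_flow TYPE('u) U"
  shows "m_cofibrant_top TYPE('v) (paths U)"
proof -
  let ?M = "mpath (resolution (paths U)) (paths U) pt_value"
  have dg: "delta_generated (paths U)" using assms(3) by (simp add: m_cofibrant_flow_def is_flow_def)
  obtain s where s: "continuous_map (paths U) ?M s" "\<And>x. x \<in> topspace (paths U) \<Longrightarrow> snd (s x) 1 = x"
    using m_cofibrant_flow_section[OF assms(1,3)] by blast
  have lift: "\<exists>h. continuous_map (paths U) Y h \<and> (\<forall>x \<in> topspace (paths U). p (h x) = v x)"
    if hfib: "h_fibration Y X p" and whe: "weak_homotopy_equivalence Y X p"
      and v: "continuous_map (paths U) X v" for Y X :: "'v topology" and p v
  proof -
    obtain k where k: "continuous_map (resolution (paths U)) Y k"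
      "\<And>q. q \<in> topspace (resolution (paths U)) \<Longrightarrow> p (k q) = v (pt_value q)"
      using resolution_lift[OF v boundary_lifts_trivial_fibration[OF assms(2) hfib whe]] by blast
    \<comment> \<open>Only a first approximation: it lies over \<open>v\<close> applied to the start
      of the path \<open>s x\<close>, while the end of that path is \<open>x\<close>.\<close>
    have u: "continuous_map (paths U) Y (k \<circ> (fst \<circ> s))"
      by (intro continuous_map_compose[OF continuous_map_compose[OF s(1) continuous_map_fst_mpath] k(1)])
    have "continuous_map (delta_prod (paths U) unit_interval) (paths U) (\<lambda>z. snd ((s \<circ> fst) z) (snd z))"
      by (rule continuous_map_mpath_app[OF continuous_map_compose[OF continuous_map_delta_prod_fst s(1)]
            continuous_map_delta_prod_snd])
    from continuous_map_compose[OF this v]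
    \<comment> \<open>The homotopy in \<open>X\<close> from there to \<open>v\<close> along the
      paths; its lift, taken at time 1, is the corrected map.\<close>
    have W: "continuous_map (delta_prod (paths U) unit_interval) X (\<lambda>(x, t). v (snd (s x) t))"
      by (simp add: o_def case_prod_unfold)
    have start: "p ((k \<circ> (fst \<circ> s)) x) = (\<lambda>(x, t). v (snd (s x) t)) (x, 0)" if "x \<in> topspace (paths U)" for x
      using funcset_mem[OF continuous_map_funspace[OF s(1)] that] k(2) by (auto simp: mpath_carrier_def)
    show ?thesis
    proof (rule h_fibration_lifting[OF assms(2) hfib dg u W start])
      fix H assume H: "continuous_map (delta_prod (paths U) unit_interval) Y H"
        and over: "\<And>x t. x \<in> topspace (paths U) \<Longrightarrow> t \<in> {0..1} \<Longrightarrow> p (H (x, t)) = (\<lambda>(x, t). v (snd (s x) t)) (x, t)"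
      have "continuous_map (paths U) (delta_prod (paths U) unit_interval) (\<lambda>x. (x, 1))"
        by (intro continuous_map_into_delta_prod dg) auto
      from continuous_map_compose[OF this H] have "continuous_map (paths U) Y (\<lambda>x. H (x, 1))" by (simp add: o_def)
      moreover have "p (H (x, 1)) = v x" if "x \<in> topspace (paths U)" for x
        using over[OF that, of 1] s(2)[OF that] by simp
      ultimately show ?thesis by blast
    qed
  qed
  show ?thesis
    unfolding m_cofibrant_top_def m_cofibration_top_def top_lifting_def
    \<comment> \<open>The cofibration in question starts at the empty space, so the condition on the
      upper map is void.\<close>
    using dg by (simp, intro allI impI, elim conjE, intro lift)
qed


end
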